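(* Let $K$ and $L$ be convex polygons in $\mathbb{R}^2$ and let $K'$ and $L'$ be closed convex sets in $\mathbb{R}^2$ with $g_{K,L}=g_{K',L'}$. Then $K'$ and $L'$ are polygons. Assume, moreover, that there exist no affine transformation $\mathcal{T}$ of $\mathbb{R}^2$, no different indices $i,j\in\{1,2\}$ and no choice of the parameters defining $(\mathcal{K}_1,\mathcal{L}_1)$ and $(\mathcal{K}_2,\mathcal{L}_2)$ such that $(\mathcal{T}K,\mathcal{T}L)$ is a trivial associate of $(\mathcal{K}_i,\mathcal{L}_i)$ and $(\mathcal{T}K',\mathcal{T}L')$ is a trivial associate of $(\mathcal{K}_j,\mathcal{L}_j)$. Then $(K,-L)$ and $(K',-L')$ are synisothetic.
   Context: Convex polygons are understood to be two-dimensional (compact, with non-empty interior). Affine transformations are non-singular. Cross covariogram: for convex sets $K,L\subset\mathbb{R}^2$, $g_{K,L}(x)=\lambda_2(K\cap(L+x))$ for those $x\in\mathbb{R}^2$ for which this is finite, where $\lambda_2$ is Lebesgue measure; equality of such functions means same domain and same values. Trivial associates: $(K,L)$ and $(K',L')$ are trivial associates if, for some $x\in\mathbb{R}^2$, either $(K,L)=(K'+x,L'+x)$ or $(K,L)=(-L'+x,-K'+x)$. Exceptional pairs: $[p,q]$ is the segment with endpoints $p,q$; sums of sets are Minkowski sums. Let $I_1=[(-1,0),(1,0)]$, $I_2=\frac{1}{\sqrt2}[(-1,-1),(1,1)]$, $I_3=[(0,-1),(0,1)]$, $I_4=\frac{1}{\sqrt2}[(1,-1),(-1,1)]$. For parameters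 $\alpha,\beta,\gamma,\delta>0$ and $y\in\mathbb{R}^2$: $\mathcal{K}_1=\alpha I_1+\beta I_2$, $\mathcal{L}_1=\gamma I_3+\delta I_4+y$, $\mathcal{K}_2=\alpha I_1+\delta I_4$, $\mathcal{L}_2=\beta I_2+\gamma I_3+y$ (the same parameters are used in both pairs). Synisothesis: for a proper face $F$ (edge or vertex) of a convex polygon $P$, the support cone is $\operatorname{cone}(P,F)=\{\mu(y-x): y\in P,\ \mu\ge0\}$, where $x$ is any point in the relative interior of $F$. A proper face $F$ of $P$ and a proper face $G$ of $Q$ are isothetic if $G$ is a translate of $F$ and $\operatorname{cone}(P,F)=\operatorname{cone}(Q,G)$. Pairs $(P_1,P_2)$ and $(Q_1,Q_2)$ of convex polygons are synisothetic if for every proper face $F$ of $P_1$ or of $P_2$ there is a proper face $G$ of $Q_1$ or of $Q_2$ (and conversely) such that $F$ and $G$ are isothetic. *)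

theory Defs
  imports "HOL-Analysis.Analysis"
begin

definition convex_polygon :: "(real^2) set \<Rightarrow> bool" where
  "convex_polygon P \<longleftrightarrow> polytope P \<and> interior P \<noteq> {}"

(* The cross covariogram lives only on the set of translations for which the measure
   is finite, so it is a partial function: equality means same domain and same values. *)
definition cross_covariogram :: "(real^2) set \<Rightarrow> (real^2) set \<Rightarrow> real^2 \<rightharpoonup> real" where
  "cross_covariogram K L =
     (\<lambda>x. if emeasure lebesgue (K \<inter> (+) x ` L) < \<infinity>
          then Some (measure lebesgue (K \<inter> (+) x ` L)) else None)"

definition affine_transformation :: "(real^2 \<Rightarrow> real^2) \<Rightarrow> bool" where
  "affine_transformation T \<longleftrightarrow> (\<exists>f b. linear f \<and> bij f \<and> T = (\<lambda>x. f x + b))"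

definition trivial_associate ::
  "(real^2) set \<times> (real^2) set \<Rightarrow> (real^2) set \<times> (real^2) set \<Rightarrow> bool" where
  "trivial_associate A B \<longleftrightarrow>
     (\<exists>x. A = ((+) x ` fst B, (+) x ` snd B) \<or>
          A = ((+) x ` uminus ` snd B, (+) x ` uminus ` fst B))"

definition seg1 :: "(real^2) set" where
  "seg1 = closed_segment (vector [-1, 0]) (vector [1, 0])"

definition seg2 :: "(real^2) set" where
  "seg2 = (*\<^sub>R) (1 / sqrt 2) ` closed_segment (vector [-1, -1]) (vector [1, 1])"

definition seg3 :: "(real^2) set" where
  "seg3 = closed_segment (vector [0, -1]) (vector [0, 1])"

definition seg4 :: "(real^2) set" where
  "seg4 = (*\<^sub>R) (1 / sqrt 2) ` closed_segment (vector [1, -1]) (vector [-1, 1])"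

(* Addition of sets is the Minkowski sum; the index i is meant to range over {1, 2}. *)
definition exceptional_pair ::
  "nat \<Rightarrow> real \<Rightarrow> real \<Rightarrow> real \<Rightarrow> real \<Rightarrow> real^2 \<Rightarrow> (real^2) set \<times> (real^2) set" where
  "exceptional_pair i \<alpha> \<beta> \<gamma> \<delta> y =
     (if i = 1
      then ((*\<^sub>R) \<alpha> ` seg1 + (*\<^sub>R) \<beta> ` seg2, (*\<^sub>R) \<gamma> ` seg3 + (*\<^sub>R) \<delta> ` seg4 + {y})
      else ((*\<^sub>R) \<alpha> ` seg1 + (*\<^sub>R) \<delta> ` seg4, (*\<^sub>R) \<beta> ` seg2 + (*\<^sub>R) \<gamma> ` seg3 + {y}))"

(* The library counts the empty set and the polytope itself as faces; for a polygon,
   what remains are exactly its edges and its (singleton) vertices. *)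
definition proper_face :: "(real^2) set \<Rightarrow> (real^2) set \<Rightarrow> bool" where
  "proper_face P F \<longleftrightarrow> F face_of P \<and> F \<noteq> {} \<and> F \<noteq> P"

(* The base point is an arbitrary one; see support_cone_eq for independence of the choice. *)
definition support_cone :: "(real^2) set \<Rightarrow> (real^2) set \<Rightarrow> (real^2) set" where
  "support_cone P F =
     (let x = (SOME x. x \<in> rel_interior F) in {\<mu> *\<^sub>R (y - x) | \<mu> y. y \<in> P \<and> \<mu> \<ge> 0})"

definition isothetic :: "(real^2) set \<Rightarrow> (real^2) set \<Rightarrow> (real^2) set \<Rightarrow> (real^2) set \<Rightarrow> bool" where
  "isothetic P F Q G \<longleftrightarrow>
     (\<exists>t. G = (+) t ` F) \<and> support_cone P F = support_cone Q G"

(* Faces are quantified together with the polygon they belong to, because the support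
   cone depends on that polygon. *)
definition synisothetic ::
  "(real^2) set \<times> (real^2) set \<Rightarrow> (real^2) set \<times> (real^2) set \<Rightarrow> bool" where
  "synisothetic A B \<longleftrightarrow>
     (\<forall>P\<in>{fst A, snd A}. \<forall>F. proper_face P F \<longrightarrow>
        (\<exists>Q\<in>{fst B, snd B}. \<exists>G. proper_face Q G \<and> isothetic P F Q G)) \<and>
     (\<forall>Q\<in>{fst B, snd B}. \<forall>G. proper_face Q G \<longrightarrow>
        (\<exists>P\<in>{fst A, snd A}. \<exists>F. proper_face P F \<and> isothetic P F Q G))"

lemma support_cone_base_mono:
  fixes P F :: "(real^2) set"
  assumes F: "F face_of P" and P: "convex P" and x: "x \<in> F" and x': "x' \<in> rel_interior F"
  shows "{\<mu> *\<^sub>R (y - x) | \<mu> y. y \<in> P \<and> \<mu> \<ge> 0} \<subseteq> {\<mu> *\<^sub>R (y - x') | \<mu> y. y \<in> P \<and> \<mu> \<ge> 0}"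
proof
  fix v assume "v \<in> {\<mu> *\<^sub>R (y - x) | \<mu> y. y \<in> P \<and> \<mu> \<ge> 0}"
  then obtain m y where v: "v = m *\<^sub>R (y - x)" "y \<in> P" "m \<ge> 0" by blast
  have "convex F" "F \<noteq> {}" using face_of_imp_convex[OF F] x by auto
  then obtain e where e: "e > 1" "(1 - e) *\<^sub>R x + e *\<^sub>R x' \<in> F"
    using convex_rel_interior_iff[of F x'] x x' by blast
  define z where "z = (1 - e) *\<^sub>R x + e *\<^sub>R x'"
  define w where "w = (1 - 1 / e) *\<^sub>R y + (1 / e) *\<^sub>R z"
  have "z \<in> P" using e(2) face_of_imp_subset[OF F] by (auto simp: z_def)
  then have "w \<in> P"
    unfolding w_def using e(1) v(2) P by (intro convexD) auto
  moreover have "w - x' = (1 - 1 / e) *\<^sub>R (y - x)"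
    using e(1) by (simp add: w_def z_def algebra_simps diff_divide_distrib)
  then have "v = (m / (1 - 1 / e)) *\<^sub>R (w - x')"
    using e(1) by (simp add: v(1))
  moreover have "m / (1 - 1 / e) \<ge> 0" using e(1) v(3) by simp
  ultimately show "v \<in> {\<mu> *\<^sub>R (y - x') | \<mu> y. y \<in> P \<and> \<mu> \<ge> 0}" by blast
qed

lemma support_cone_eq:
  fixes P F :: "(real^2) set"
  assumes F: "F face_of P" and P: "convex P" and x: "x \<in> rel_interior F"
  shows "support_cone P F = {\<mu> *\<^sub>R (y - x) | \<mu> y. y \<in> P \<and> \<mu> \<ge> 0}"
proof -
  define x' where "x' = (SOME x. x \<in> rel_interior F)"
  have x': "x' \<in> rel_interior F" unfolding x'_def using x by (rule someI)
  have "x \<in> F" "x' \<in> F" using x x' rel_interior_subset by auto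
  then show ?thesis
    unfolding support_cone_def Let_def x'_def[symmetric]
    using support_cone_base_mono[OF F P _ x] support_cone_base_mono[OF F P _ x']
    by (intro subset_antisym) auto
qed

end

theory Submission
  imports Defs "HOL-Computational_Algebra.Polynomial" "HOL-Real_Asymp.Real_Asymp"
begin

text \<open>
  With \<open>M = - L\<close> the cross covariogram is the convolution of the indicator functions of \<open>K\<close> and \<open>M\<close>.
  Hence it determines \<open>K + M\<close> (the closure of its support) and the product of the Laplace transforms of
  \<open>K\<close> and \<open>M\<close>. If \<open>u\<close> exposes vertices \<open>v\<close> of \<open>K\<close> and \<open>w\<close> of \<open>M\<close>, the behaviour of this product at
  \<open>t u\<close> for large \<open>t\<close> yields the product of the Laplace transforms of the two support cones; the
  transform of the cone spanned by \<open>a\<close> and \<open>b\<close> is \<open>\<bar>det(a, b)\<bar> / ((\<xi> \<bullet> a) (\<xi> \<bullet> b))\<close>. So the four rays of the two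
  cones are determined, and by Ptolemy's relation so is their distribution into two pairs, unless the
  rays \<open>a, b, c, d\<close>, in angular order, form a harmonic quadruple; then \<open>ab | cd\<close> and \<open>ad | bc\<close> are both
  possible. If this ambiguity really occurs at one vertex, walking around the boundaries
  it recurs at every vertex, all four polygons are parallelograms, and they form the exceptional pairs.
  Finally, if \<open>u\<close> is normal to edges of both polygons, their two lengths are determined by their sum (from
  \<open>K + M\<close>) and their product (from the Laplace transforms at \<open>t u\<close>).
\<close>

section \<open>Planar linear algebra and cones\<close>

text \<open>At the start K' and L' are merely closed and convex: they could be unbounded, or have
  empty interior. Hence the first thing extracted from the covariogram is the open set on which it
  is positive, a sum of interiors; boundedness, non-empty interiors and finally polygonality of the
  summands follow from it. The vertex analysis becomes elementary in one coordinate, the slope of a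
  ray relative to u: rays in the open half-plane turn into real numbers, cones into intervals,
  determinants into differences. Turning u into \<open>u + z *\<^sub>R rot u\<close> makes the
  identity between cone transforms an equality of rational functions of z. Their denominators reveal
  the four slopes, their value at z = 0 the product of the two interval lengths. The pairing ac | bd
  drops out because its product is the sum of the other two. A direction that singles out a vertex
  of one polygon may be normal to an edge of another, so directions are perturbed until they expose
  a vertex of all four polygons. The walk is rigid because two of the four rays at the new vertices
  are shared by both pairs; they cancel and force the other two.\<close>

definition rot :: "real^2 \<Rightarrow> real^2" where
  "rot x = vector [- (x $ 2), x $ 1]"

text \<open>The determinant det(a, b), expressed by an inner product so that the lines on which
  \<open>cross2 a\<close> is constant are hyperplanes in the library's sense.\<close>

definition cross2 :: "real^2 \<Rightarrow> real^2 \<Rightarrow> real" where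
  "cross2 a b = rot a \<bullet> b"

definition pos2 :: "real^2 \<Rightarrow> real^2 \<Rightarrow> (real^2) set" where
  "pos2 a b = {s *\<^sub>R a + t *\<^sub>R b | s t. s \<ge> 0 \<and> t \<ge> 0}"

lemma inner2: "(x::real^2) \<bullet> y = x $ 1 * y $ 1 + x $ 2 * y $ 2"
  by (simp add: inner_vec_def sum_2)

lemma rot_component [simp]: "rot x $ 1 = - (x $ 2)" "rot x $ 2 = x $ 1"
  by (simp_all add: rot_def)

lemma cross2_eq: "cross2 a b = a $ 1 * b $ 2 - a $ 2 * b $ 1"
  by (simp add: cross2_def inner2)

lemma cross2_add [simp]:
  "cross2 (a + b) c = cross2 a c + cross2 b c" "cross2 a (b + c) = cross2 a b + cross2 a c"
  by (simp_all add: cross2_eq algebra_simps)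

lemma cross2_diff [simp]:
  "cross2 (a - b) c = cross2 a c - cross2 b c" "cross2 a (b - c) = cross2 a b - cross2 a c"
  by (simp_all add: cross2_eq algebra_simps)

lemma cross2_scaleR [simp]:
  "cross2 (s *\<^sub>R a) b = s * cross2 a b" "cross2 a (s *\<^sub>R b) = s * cross2 a b"
  by (simp_all add: cross2_eq algebra_simps)

lemma cross2_minus [simp]: "cross2 (- a) b = - cross2 a b" "cross2 a (- b) = - cross2 a b"
  by (simp_all add: cross2_eq)

lemma cross2_self [simp]: "cross2 a a = 0"
  by (simp add: cross2_eq)

lemma cross2_zero [simp]: "cross2 0 a = 0" "cross2 a 0 = 0"
  by (simp_all add: cross2_eq)

lemma cross2_commute: "cross2 a b = - cross2 b a"
  by (simp add: cross2_eq)

lemma rot_inner_self [simp]: "rot u \<bullet> u = 0" "u \<bullet> rot u = 0"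
  by (simp_all add: inner2)

lemma rot_eq_0_iff [simp]: "rot u = 0 \<longleftrightarrow> u = 0"
  by (auto simp: vec_eq_iff forall_2)

lemma rot_inner_rot [simp]: "rot u \<bullet> rot v = u \<bullet> v"
  by (simp add: inner2)

text \<open>Cramer's rule, multiplied through by the determinant so that no non-degeneracy is
  required.\<close>

lemma cross2_expand:
  "cross2 a b *\<^sub>R x = cross2 x b *\<^sub>R a + cross2 a x *\<^sub>R b"
  by (simp add: vec_eq_iff forall_2 cross2_eq algebra_simps)

text \<open>Expansion in the orthogonal basis u, \<open>rot u\<close>, again free of
  division.\<close>

lemma rot_expand: "(u \<bullet> u) *\<^sub>R x = (u \<bullet> x) *\<^sub>R u + (rot u \<bullet> x) *\<^sub>R rot u"
  by (simp add: vec_eq_iff forall_2 inner2 algebra_simps)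

lemma pos2I: "s \<ge> 0 \<Longrightarrow> t \<ge> 0 \<Longrightarrow> s *\<^sub>R a + t *\<^sub>R b \<in> pos2 a b"
  by (auto simp: pos2_def)

lemma pos2_generators [simp]: "a \<in> pos2 a b" "b \<in> pos2 a b" "0 \<in> pos2 a b"
  using pos2I[of 1 0 a b] pos2I[of 0 1 a b] pos2I[of 0 0 a b] by auto

lemma pos2_commute: "pos2 a b = pos2 b a"
  unfolding pos2_def by (metis (no_types, opaque_lifting) add.commute)

lemma pos2_iff_cross2:
  assumes "cross2 a b > 0"
  shows "x \<in> pos2 a b \<longleftrightarrow> cross2 a x \<ge> 0 \<and> cross2 x b \<ge> 0"
proof
  assume "x \<in> pos2 a b"
  then show "cross2 a x \<ge> 0 \<and> cross2 x b \<ge> 0"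
    using assms cross2_commute[of b a] by (auto simp: pos2_def)
next
  assume x: "cross2 a x \<ge> 0 \<and> cross2 x b \<ge> 0"
  have "x = (1 / cross2 a b) *\<^sub>R (cross2 a b *\<^sub>R x)"
    using assms by simp
  also have "\<dots> = (cross2 x b / cross2 a b) *\<^sub>R a + (cross2 a x / cross2 a b) *\<^sub>R b"
    by (subst cross2_expand) (simp add: scaleR_add_right)
  finally show "x \<in> pos2 a b"
    using x assms pos2I[of "cross2 x b / cross2 a b" "cross2 a x / cross2 a b" a b] by simp
qed

lemma pos2_scaleR:
  assumes "s > 0" "t > 0"
  shows "pos2 (s *\<^sub>R a) (t *\<^sub>R b) = pos2 a b"
proof -
  have *: "pos2 (s *\<^sub>R a) (t *\<^sub>R b) \<subseteq> pos2 a b" if "s > 0" "t > 0" for s t :: real and a b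
  proof
    fix x assume "x \<in> pos2 (s *\<^sub>R a) (t *\<^sub>R b)"
    then obtain p q where "x = (p * s) *\<^sub>R a + (q * t) *\<^sub>R b" "p \<ge> 0" "q \<ge> 0"
      by (auto simp: pos2_def)
    then show "x \<in> pos2 a b" using pos2I[of "p * s" "q * t" a b] that by simp
  qed
  show ?thesis
    using *[of s t a b] *[of "1/s" "1/t" "s *\<^sub>R a" "t *\<^sub>R b"] assms by auto
qed

lemma convex_pos2: "convex (pos2 a b)"
proof (rule convexI)
  fix x y and u v :: real
  assume "x \<in> pos2 a b" "y \<in> pos2 a b" and uv: "0 \<le> u" "0 \<le> v" "u + v = 1"
  then obtain s t s' t' where "x = s *\<^sub>R a + t *\<^sub>R b" "y = s' *\<^sub>R a + t' *\<^sub>R b"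
      and st: "s \<ge> 0" "t \<ge> 0" "s' \<ge> 0" "t' \<ge> 0"
    by (auto simp: pos2_def)
  then have "u *\<^sub>R x + v *\<^sub>R y = (u * s + v * s') *\<^sub>R a + (u * t + v * t') *\<^sub>R b"
    by (simp add: algebra_simps)
  then show "u *\<^sub>R x + v *\<^sub>R y \<in> pos2 a b"
    using st uv pos2I[of "u * s + v * s'" "u * t + v * t'" a b] by simp
qed

lemma closed_pos2:
  assumes "cross2 a b > 0"
  shows "closed (pos2 a b)"
proof -
  have "pos2 a b = {x. 0 \<le> rot a \<bullet> x} \<inter> {x. 0 \<le> - rot b \<bullet> x}"
    using pos2_iff_cross2[OF assms] cross2_commute[of _ b] by (auto simp: cross2_def)
  then show ?thesis
    by (auto simp: inner_commute intro!: closed_Int closed_Collect_le continuous_intros)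
qed

lemma pos2_antisym:
  assumes "cross2 a b \<noteq> 0" "x \<in> pos2 a b" "- x \<in> pos2 a b"
  shows "x = 0"
proof -
  obtain s t s' t' where x: "x = s *\<^sub>R a + t *\<^sub>R b" "- x = s' *\<^sub>R a + t' *\<^sub>R b"
      and st: "s \<ge> 0" "t \<ge> 0" "s' \<ge> 0" "t' \<ge> 0"
    using assms by (auto simp: pos2_def)
  have 0: "0 = (s + s') *\<^sub>R a + (t + t') *\<^sub>R b"
    using arg_cong2[where f = plus, OF x] by (simp add: algebra_simps)
  have "(s + s') * cross2 a b = 0" "(t + t') * cross2 a b = 0"
    using arg_cong[OF 0, of "\<lambda>x. cross2 x b"] arg_cong[OF 0, of "cross2 a"]
    by (simp_all del: mult_eq_0_iff)
  then have "s + s' = 0" "t + t' = 0" using assms(1) by simp_all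
  then have "s = 0" "t = 0" using st by simp_all
  then show ?thesis using x by simp
qed

lemma pos2_inner_neg:
  assumes "u \<bullet> a < 0" "u \<bullet> b < 0" "x \<in> pos2 a b" "x \<noteq> 0"
  shows "u \<bullet> x < 0"
proof -
  obtain s t where x: "x = s *\<^sub>R a + t *\<^sub>R b" and st: "s \<ge> 0" "t \<ge> 0"
    using assms by (auto simp: pos2_def)
  have "s > 0 \<or> t > 0" using assms(4) x st by (cases "s = 0"; cases "t = 0") auto
  then show ?thesis
    using st mult_nonneg_nonpos[of s "u \<bullet> a"] mult_nonneg_nonpos[of t "u \<bullet> b"]
      mult_pos_neg[of s "u \<bullet> a"] mult_pos_neg[of t "u \<bullet> b"] assms(1,2)
    by (auto simp: x inner_add_right intro: add_neg_nonpos add_nonpos_neg)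
qed

text \<open>A projective coordinate on the half-plane \<open>u \<bullet> x < 0\<close>: scale x to
  \<open>u \<bullet> x = -1\<close> and take its inner product with \<open>rot u\<close>. It depends
  only on the ray of x.\<close>

definition slope :: "real^2 \<Rightarrow> real^2 \<Rightarrow> real" where
  "slope u x = (rot u \<bullet> x) / - (u \<bullet> x)"

text \<open>Determinants become differences of slopes, which makes a relation between four numbers
  applicable to four rays. The sign shows that slopes decrease in counterclockwise order.\<close>

lemma slope_cross2:
  assumes "u \<bullet> a < 0" "u \<bullet> b < 0"
  shows "(u \<bullet> u) * cross2 a b = (u \<bullet> a) * (u \<bullet> b) * (slope u a - slope u b)"
  using assms unfolding slope_def
  by (simp add: field_simps) (simp add: cross2_eq inner2 algebra_simps)

lemma slope_less_iff:
  assumes "u \<bullet> a < 0" "u \<bullet> b < 0"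
  shows "slope u b < slope u a \<longleftrightarrow> cross2 a b > 0"
proof -
  have "u \<noteq> 0" using assms by auto
  then have "u \<bullet> u > 0" by simp
  moreover have "(u \<bullet> a) * (u \<bullet> b) > 0" using assms by (simp add: mult_neg_neg)
  ultimately show ?thesis
    using slope_cross2[OF assms] by (metis diff_gt_0_iff_gt zero_less_mult_pos zero_less_mult_iff)
qed

lemma slope_eq_imp:
  assumes "u \<bullet> a < 0" "u \<bullet> b < 0" "slope u a = slope u b"
  shows "a = ((u \<bullet> a) / (u \<bullet> b)) *\<^sub>R b"
proof -
  have u: "u \<noteq> 0" using assms by auto
  define k where "k = (u \<bullet> a) / (u \<bullet> b)"
  have "rot u \<bullet> a = k * (rot u \<bullet> b)" "u \<bullet> a = k * (u \<bullet> b)"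
    using assms by (simp_all add: slope_def field_simps k_def)
  then have "(u \<bullet> u) *\<^sub>R a = k *\<^sub>R ((u \<bullet> u) *\<^sub>R b)"
    by (simp add: rot_expand scaleR_add_right)
  then have "(u \<bullet> u) *\<^sub>R a = (u \<bullet> u) *\<^sub>R (k *\<^sub>R b)" by (simp add: mult.commute)
  then have "a = k *\<^sub>R b" using u by (metis scaleR_left_imp_eq inner_eq_zero_iff)
  then show ?thesis by (simp only: k_def)
qed

lemma pos2_slope_cong:
  assumes "u \<bullet> a < 0" "u \<bullet> b < 0" "u \<bullet> c < 0" "u \<bullet> d < 0"
    and "slope u a = slope u c" "slope u b = slope u d"
  shows "pos2 a b = pos2 c d"
proof -
  have "a = ((u \<bullet> a) / (u \<bullet> c)) *\<^sub>R c" "b = ((u \<bullet> b) / (u \<bullet> d)) *\<^sub>R d"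
    using assms slope_eq_imp by blast+
  moreover have "(u \<bullet> a) / (u \<bullet> c) > 0" "(u \<bullet> b) / (u \<bullet> d) > 0"
    using assms by (simp_all add: divide_neg_neg)
  ultimately show ?thesis by (metis pos2_scaleR)
qed

text \<open>A slope 0 contributes the invisible factor 1; the equal sizes make up for this loss of
  degree. Reversing the polynomials gives monic ones whose roots are the slopes, and these agree at
  infinitely many points.\<close>

lemma linear_factor_mset_eq:
  fixes A B :: "real multiset"
  assumes e: "e > 0" and size: "size A = size B"
    and eq: "\<And>z. \<bar>z\<bar> < e \<Longrightarrow> (\<Prod>s\<in>#A. 1 - z * s) = (\<Prod>s\<in>#B. 1 - z * s)"
  shows "A = B"
proof -
  \<comment> \<open>Reversal: put z = 1 / Z and clear denominators.\<close>
  have *: "poly (\<Prod>s\<in>#C. [:- s, 1:]) Z = Z ^ size C * (\<Prod>s\<in>#C. 1 - (1 / Z) * s)"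
    if "Z \<noteq> 0" for C :: "real multiset" and Z
    by (induction C) (use that in \<open>auto simp: field_simps\<close>)
  have "poly (\<Prod>s\<in>#A. [:- s, 1:]) Z = poly (\<Prod>s\<in>#B. [:- s, 1:]) Z" if "Z > 1 / e" for Z
  proof -
    have "Z > 0" using that e by (meson less_trans zero_less_divide_1_iff)
    moreover have "1 / Z < e" using that e \<open>Z > 0\<close> by (simp add: field_simps)
    ultimately show ?thesis using eq[of "1 / Z"] * size by simp
  qed
  then have "{1 / e <..} \<subseteq> {Z. poly (\<Prod>s\<in>#A. [:- s, 1:]) Z = poly (\<Prod>s\<in>#B. [:- s, 1:]) Z}" by auto
  then have "infinite {Z. poly (\<Prod>s\<in>#A. [:- s, 1:]) Z = poly (\<Prod>s\<in>#B. [:- s, 1:]) Z}"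
    using infinite_Ioi infinite_super by blast
  then have eqp: "(\<Prod>s\<in>#A. [:- s, 1:]) = (\<Prod>s\<in>#B. [:- s, 1:])"
    using poly_roots_finite[of "(\<Prod>s\<in>#A. [:- s, 1:]) - (\<Prod>s\<in>#B. [:- s, 1:])"] by auto
  have "proots (\<Prod>s\<in>#C. [:- s, 1:]) = C" for C :: "real multiset"
  proof (induction C)
    case (add x C)
    have "(\<Prod>s\<in>#C. [:- s, 1:]) \<noteq> 0" by auto
    then show ?case using add by (simp add: proots_mult del: mult_pCons_left)
  qed simp
  then show ?thesis using eqp by metis
qed

section \<open>Pairing off four real numbers\<close>

lemma pair_of_intervals_sorted:
  fixes p q r s :: real
  assumes "p < q" "r < s"
  obtains s1 s2 s3 s4 where "s1 \<le> s2" "s2 \<le> s3" "s3 \<le> s4"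
    "{#p, q, r, s#} = {#s1, s2, s3, s4#}"
    "{(p, q), (r, s)} = {(s1, s2), (s3, s4)} \<and> (q - p) * (s - r) = (s2 - s1) * (s4 - s3) \<and> s1 < s2 \<and> s3 < s4 \<or>
     {(p, q), (r, s)} = {(s1, s3), (s2, s4)} \<and> (q - p) * (s - r) = (s3 - s1) * (s4 - s2) \<and> s1 < s3 \<and> s2 < s4 \<or>
     {(p, q), (r, s)} = {(s1, s4), (s2, s3)} \<and> (q - p) * (s - r) = (s4 - s1) * (s3 - s2) \<and> s2 < s3"
proof (cases "p \<le> r")
  case True
  consider "q \<le> r" | "r \<le> q" "q \<le> s" | "s \<le> q" by linarith
  then show ?thesis
  proof cases
    case 1 then show ?thesis using that[of p q r s] assms by (auto simp: mult.commute)
  next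
    case 2 then show ?thesis using that[of p r q s] assms True
      by (auto simp: mult.commute add_mset_commute)
  next
    case 3 then show ?thesis using that[of p r s q] assms True
      by (auto simp: mult.commute add_mset_commute)
  qed
next
  case False
  consider "s \<le> p" | "p \<le> s" "s \<le> q" | "q \<le> s" by linarith
  then show ?thesis
  proof cases
    case 1 then show ?thesis using that[of r s p q] assms
      by (auto simp: mult.commute insert_commute add_mset_commute)
  next
    case 2 then show ?thesis using that[of r p s q] assms False
      by (auto simp: mult.commute insert_commute add_mset_commute)
  next
    case 3 then show ?thesis using that[of r p q s] assms False
      by (auto simp: mult.commute insert_commute add_mset_commute)
  qed
qed

text \<open>Two intervals are disjoint, crossed or nested. The crossed product is the sum of the
  other two, so it can equal one of them only if the other vanishes; then two endpoints coincide and
  both pairings are the same. What remains is disjoint against nested, with equal products.\<close>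

lemma cone_pair_cases:
  fixes p q p' q' :: real
  assumes "p < q" "r < s" "p' < q'" "r' < s'"
    and mset: "{#p, q, r, s#} = {#p', q', r', s'#}"
    and prod: "(q - p) * (s - r) = (q' - p') * (s' - r')"
  shows "{(p, q), (r, s)} = {(p', q'), (r', s')} \<or>
    (\<exists>s1 s2 s3 s4. s1 < s2 \<and> s2 < s3 \<and> s3 < s4 \<and> (s2 - s1) * (s4 - s3) = (s4 - s1) * (s3 - s2) \<and>
      ({(p, q), (r, s)} = {(s1, s2), (s3, s4)} \<and> {(p', q'), (r', s')} = {(s1, s4), (s2, s3)} \<or>
       {(p, q), (r, s)} = {(s1, s4), (s2, s3)} \<and> {(p', q'), (r', s')} = {(s1, s2), (s3, s4)}))"
proof -
  obtain s1 s2 s3 s4 where le: "s1 \<le> s2" "s2 \<le> s3" "s3 \<le> s4"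
    and ms: "{#p, q, r, s#} = {#s1, s2, s3, s4#}"
    and part: "{(p, q), (r, s)} = {(s1, s2), (s3, s4)} \<and> (q - p) * (s - r) = (s2 - s1) * (s4 - s3) \<and> s1 < s2 \<and> s3 < s4 \<or>
     {(p, q), (r, s)} = {(s1, s3), (s2, s4)} \<and> (q - p) * (s - r) = (s3 - s1) * (s4 - s2) \<and> s1 < s3 \<and> s2 < s4 \<or>
     {(p, q), (r, s)} = {(s1, s4), (s2, s3)} \<and> (q - p) * (s - r) = (s4 - s1) * (s3 - s2) \<and> s2 < s3"
    using pair_of_intervals_sorted[OF assms(1,2)] by blast
  obtain t1 t2 t3 t4 where le': "t1 \<le> t2" "t2 \<le> t3" "t3 \<le> t4"
    and mt: "{#p', q', r', s'#} = {#t1, t2, t3, t4#}"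
    and part': "{(p', q'), (r', s')} = {(t1, t2), (t3, t4)} \<and> (q' - p') * (s' - r') = (t2 - t1) * (t4 - t3) \<and> t1 < t2 \<and> t3 < t4 \<or>
     {(p', q'), (r', s')} = {(t1, t3), (t2, t4)} \<and> (q' - p') * (s' - r') = (t3 - t1) * (t4 - t2) \<and> t1 < t3 \<and> t2 < t4 \<or>
     {(p', q'), (r', s')} = {(t1, t4), (t2, t3)} \<and> (q' - p') * (s' - r') = (t4 - t1) * (t3 - t2) \<and> t2 < t3"
    using pair_of_intervals_sorted[OF assms(3,4)] by blast
  have "mset [s1, s2, s3, s4] = mset [t1, t2, t3, t4]"
    using mset ms mt by simp
  then have "[s1, s2, s3, s4] = [t1, t2, t3, t4]"
    using le le' properties_for_sort[of "[s1, s2, s3, s4]" "[t1, t2, t3, t4]"]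
      sorted_sort_id[of "[t1, t2, t3, t4]"] by simp
  then have t: "t1 = s1" "t2 = s2" "t3 = s3" "t4 = s4" by auto
  \<comment> \<open>Ptolemy's relation between the three ways of pairing off four numbers\<close>
  have pt: "(s3 - s1) * (s4 - s2) = (s2 - s1) * (s4 - s3) + (s4 - s1) * (s3 - s2)"
    by (simp add: algebra_simps)
  define E where "E \<longleftrightarrow> (s2 - s1) * (s4 - s3) = (s4 - s1) * (s3 - s2)"
  have *: ?thesis
    if "s1 < s2" "s2 < s3" "s3 < s4" "E"
      "{(p, q), (r, s)} = {(s1, s2), (s3, s4)} \<and> {(p', q'), (r', s')} = {(s1, s4), (s2, s3)} \<or>
       {(p, q), (r, s)} = {(s1, s4), (s2, s3)} \<and> {(p', q'), (r', s')} = {(s1, s2), (s3, s4)}"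
    using that unfolding E_def
    by - (rule disjI2, rule exI[of _ s1], rule exI[of _ s2], rule exI[of _ s3], rule exI[of _ s4],
        (intro conjI; assumption))
  have 23: "s2 = s3" if "(s4 - s1) * (s3 - s2) = 0" using that le by auto
  have 12: "s1 = s2 \<or> s3 = s4" if "(s2 - s1) * (s4 - s3) = 0" using that by auto
  note part' = part'[unfolded t]
  consider
      (a) "{(p, q), (r, s)} = {(s1, s2), (s3, s4)}" "(q - p) * (s - r) = (s2 - s1) * (s4 - s3)" "s1 < s2" "s3 < s4"
    | (b) "{(p, q), (r, s)} = {(s1, s3), (s2, s4)}" "(q - p) * (s - r) = (s3 - s1) * (s4 - s2)"
    | (c) "{(p, q), (r, s)} = {(s1, s4), (s2, s3)}" "(q - p) * (s - r) = (s4 - s1) * (s3 - s2)" "s2 < s3"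
    using part by (elim disjE conjE)
  note cs = this
  consider
      (a) "{(p', q'), (r', s')} = {(s1, s2), (s3, s4)}" "(q' - p') * (s' - r') = (s2 - s1) * (s4 - s3)" "s1 < s2" "s3 < s4"
    | (b) "{(p', q'), (r', s')} = {(s1, s3), (s2, s4)}" "(q' - p') * (s' - r') = (s3 - s1) * (s4 - s2)"
    | (c) "{(p', q'), (r', s')} = {(s1, s4), (s2, s3)}" "(q' - p') * (s' - r') = (s4 - s1) * (s3 - s2)" "s2 < s3"
    using part' by (elim disjE conjE)
  note cs' = this
  show ?thesis
  proof (cases rule: cs)
    case 1: a
    show ?thesis
    proof (cases rule: cs')
      case a then show ?thesis using 1 by simp
    next
      case b
      then have "s2 = s3" using prod pt 1 by (intro 23) linarith
      then show ?thesis using 1 b by simp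
    next
      case c
      then have "E" using prod 1 by (simp add: E_def)
      then show ?thesis using 1 c by (intro *) simp_all
    qed
  next
    case 1: b
    show ?thesis
    proof (cases rule: cs')
      case a
      then have "s2 = s3" using prod pt 1 by (intro 23) linarith
      then show ?thesis using 1 a by simp
    next
      case b then show ?thesis using 1 by simp
    next
      case c
      then have "s1 = s2 \<or> s3 = s4" using prod pt 1 by (intro 12) linarith
      then show ?thesis using 1 c by (auto simp: insert_commute)
    qed
  next
    case 1: c
    show ?thesis
    proof (cases rule: cs')
      case a
      then have "E" using prod 1 by (simp add: E_def)
      then show ?thesis using 1 a by (intro *) simp_all
    next
      case b
      then have "s1 = s2 \<or> s3 = s4" using prod pt 1 by (intro 12) linarith
      then show ?thesis using 1 b by (auto simp: insert_commute)
    next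
      case c then show ?thesis using 1 by simp
    qed
  qed
qed

section \<open>Faces and support cones of convex polygons\<close>

definition face_in :: "real^2 \<Rightarrow> (real^2) set \<Rightarrow> (real^2) set" where
  "face_in u P = {x \<in> P. \<forall>y\<in>P. u \<bullet> y \<le> u \<bullet> x}"

definition exposes :: "real^2 \<Rightarrow> (real^2) set \<Rightarrow> real^2 \<Rightarrow> bool" where
  "exposes u P v \<longleftrightarrow> v \<in> P \<and> (\<forall>y\<in>P. y \<noteq> v \<longrightarrow> u \<bullet> y < u \<bullet> v)"

text \<open>The support cone with its base point as an argument instead of a chosen point of the
  relative interior.\<close>

definition tcone :: "(real^2) set \<Rightarrow> real^2 \<Rightarrow> (real^2) set" where
  "tcone P v = {\<mu> *\<^sub>R (y - v) | \<mu> y. y \<in> P \<and> \<mu> \<ge> 0}"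

lemma tconeI: "y \<in> P \<Longrightarrow> \<mu> \<ge> 0 \<Longrightarrow> \<mu> *\<^sub>R (y - v) \<in> tcone P v"
  by (auto simp: tcone_def)

lemma diff_in_tcone: "y \<in> P \<Longrightarrow> y - v \<in> tcone P v"
  using tconeI[of y P 1 v] by simp

lemma tcone_obtain_point:
  assumes "c \<in> tcone P v" "c \<noteq> 0"
  obtains s where "s > 0" "v + s *\<^sub>R c \<in> P"
proof -
  obtain m y where c: "c = m *\<^sub>R (y - v)" "y \<in> P" "m \<ge> 0"
    using assms(1) by (auto simp: tcone_def)
  then have "m > 0" using assms(2) by (cases "m = 0") auto
  then show ?thesis using c that[of "1 / m"] by simp
qed

lemma convex_polygonD:
  assumes "convex_polygon P"
  shows "convex P" "compact P" "closed P" "bounded P" "P \<noteq> {}" "interior P \<noteq> {}" "polytope P"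
  using assms polytope_imp_convex polytope_imp_compact compact_imp_closed compact_imp_bounded
  by (auto simp: convex_polygon_def)

lemma convex_polygon_not_subset_hyperplane:
  assumes "convex_polygon P" "u \<noteq> 0"
  shows "\<not> P \<subseteq> {x. u \<bullet> x = c}"
proof
  assume "P \<subseteq> {x. u \<bullet> x = c}"
  then have "interior P \<subseteq> interior {x. u \<bullet> x = c}" by (rule interior_mono)
  then show False using interior_hyperplane[OF assms(2)] convex_polygonD(6)[OF assms(1)] by auto
qed

lemma exposes_of_tcone:
  assumes "v \<in> P" "tcone P v = pos2 a b" "u \<bullet> a < 0" "u \<bullet> b < 0"
  shows "exposes u P v"
  unfolding exposes_def
proof (intro conjI ballI impI)
  fix y assume y: "y \<in> P" "y \<noteq> v"
  then have "y - v \<in> pos2 a b" using diff_in_tcone assms(2) by blast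
  then have "u \<bullet> (y - v) < 0" using pos2_inner_neg[OF assms(3,4)] y by simp
  then show "u \<bullet> y < u \<bullet> v" by (simp add: inner_diff_right)
qed (rule assms(1))

lemma exposes_unique: "exposes u P v \<Longrightarrow> exposes u P w \<Longrightarrow> v = w"
  unfolding exposes_def by (metis order_less_asym)

lemma exposes_imp_face_in: "exposes u P v \<Longrightarrow> face_in u P = {v}"
  unfolding exposes_def face_in_def by (fastforce simp: not_le)

lemma exposes_sum:
  assumes "exposes u P v" "exposes u Q w"
  shows "exposes u (P + Q) (v + w)"
  unfolding exposes_def
proof (intro conjI ballI impI)
  show "v + w \<in> P + Q" using assms by (simp add: exposes_def set_plus_intro)
next
  fix z assume "z \<in> P + Q" "z \<noteq> v + w"
  then obtain x y where xy: "z = x + y" "x \<in> P" "y \<in> Q" "x \<noteq> v \<or> y \<noteq> w"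
    by (elim set_plus_elim) auto
  have "x = v \<or> u \<bullet> x < u \<bullet> v" "y = w \<or> u \<bullet> y < u \<bullet> w"
    using assms xy unfolding exposes_def by blast+
  then show "u \<bullet> z < u \<bullet> (v + w)"
    using xy(1,4) by (auto simp: inner_add_right)
qed

section \<open>Support cones at vertices and exposing directions\<close>

lemma polytope_finite_hull:
  assumes "convex_polygon P"
  obtains V where "finite V" "P = convex hull V"
  using assms by (auto simp: convex_polygon_def polytope_def)

text \<open>P is the hull of finitely many points. Seen from v they all lie in the half-plane of
  negative \<open>u\<close>-values, and those of largest and smallest slope span the cone.\<close>

lemma tcone_eq_pos2:
  assumes P: "convex_polygon P" and ex: "exposes u P v"
  obtains a b where "tcone P v = pos2 a b" "u \<bullet> a < 0" "u \<bullet> b < 0" "cross2 a b > 0"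
proof -
  obtain V where V: "finite V" "P = convex hull V" using polytope_finite_hull[OF P] .
  define W where "W = (\<lambda>x. x - v) ` (V - {v})"
  have vP: "v \<in> P" using ex by (simp add: exposes_def)
  have W_neg: "u \<bullet> w < 0" if "w \<in> W" for w
    using that ex hull_subset[of V convex] V(2)
    by (auto simp: W_def exposes_def inner_diff_right)
  have W_P: "v + w \<in> P" if "w \<in> W" for w
    using that hull_subset[of V convex] V(2) by (auto simp: W_def)
  have "W \<noteq> {}"
  proof
    assume "W = {}"
    then have "V \<subseteq> {v}" by (auto simp: W_def)
    then have "P \<subseteq> {v}" using V(2) hull_mono[of V "{v}" convex] by simp
    moreover have "axis 1 1 \<noteq> (0::real^2)" by simp
    ultimately show False
      using convex_polygon_not_subset_hyperplane[OF P, of "axis 1 1" "axis 1 1 \<bullet> v"] by auto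
  qed
  have "finite W" using V by (simp add: W_def)
  obtain a where a: "a \<in> W" "\<And>w. w \<in> W \<Longrightarrow> slope u w \<le> slope u a"
  proof -
    have "Max (slope u ` W) \<in> slope u ` W" using \<open>finite W\<close> \<open>W \<noteq> {}\<close> by (intro Max_in) auto
    then obtain x where "x \<in> W" "slope u x = Max (slope u ` W)" by auto
    then show ?thesis using that[of x] Max_ge[of "slope u ` W"] \<open>finite W\<close> by simp
  qed
  obtain b where b: "b \<in> W" "\<And>w. w \<in> W \<Longrightarrow> slope u b \<le> slope u w"
  proof -
    have "Min (slope u ` W) \<in> slope u ` W" using \<open>finite W\<close> \<open>W \<noteq> {}\<close> by (intro Min_in) auto
    then obtain x where "x \<in> W" "slope u x = Min (slope u ` W)" by auto
    then show ?thesis using that[of x] Min_le[of "slope u ` W"] \<open>finite W\<close> by simp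
  qed
  have ab: "u \<bullet> a < 0" "u \<bullet> b < 0" using a b W_neg by auto
  have cross: "cross2 a w \<ge> 0" "cross2 w b \<ge> 0" if "w \<in> W" for w
  proof -
    have w: "u \<bullet> w < 0" using W_neg that .
    have "\<not> cross2 w a > 0" "\<not> cross2 b w > 0"
      using slope_less_iff[OF w ab(1)] slope_less_iff[OF ab(2) w] a(2)[OF that] b(2)[OF that] by auto
    then show "cross2 a w \<ge> 0" "cross2 w b \<ge> 0"
      using cross2_commute[of a w] cross2_commute[of w b] by auto
  qed
  \<comment> \<open>If the extreme slopes agreed, all generating points would lie on the line
    through v in direction a, and P would have no interior.\<close>
  have pos: "cross2 a b > 0"
  proof (rule ccontr)
    assume "\<not> cross2 a b > 0"
    then have "\<not> slope u b < slope u a" using slope_less_iff[OF ab] by simp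
    then have eq: "slope u w = slope u a" if "w \<in> W" for w
      using a(2)[OF that] b(2)[OF that] by linarith
    have "cross2 a w = 0" if "w \<in> W" for w
      using slope_cross2[of u a w] eq[OF that] ab W_neg[OF that] by auto
    then have "rot a \<bullet> x = rot a \<bullet> v" if "x \<in> V" for x
      using that by (cases "x = v") (force simp: W_def cross2_def inner_diff_right)+
    then have "V \<subseteq> {x. rot a \<bullet> x = rot a \<bullet> v}" by auto
    then have "P \<subseteq> {x. rot a \<bullet> x = rot a \<bullet> v}"
      unfolding V(2) by (rule hull_minimal) (rule convex_hyperplane)
    moreover have "rot a \<noteq> 0" using ab by auto
    ultimately show False using convex_polygon_not_subset_hyperplane[OF P] by blast
  qed
  have "V \<subseteq> (+) v ` pos2 a b"
  proof
    fix x assume x: "x \<in> V"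
    have "x - v \<in> pos2 a b"
    proof (cases "x = v")
      case False
      then have "x - v \<in> W" using x by (auto simp: W_def)
      then show ?thesis using cross pos2_iff_cross2[OF pos] by blast
    qed simp
    then show "x \<in> (+) v ` pos2 a b" by (intro image_eqI[of _ _ "x - v"]) auto
  qed
  then have sub: "P \<subseteq> (+) v ` pos2 a b"
    unfolding V(2) by (rule hull_minimal) (intro convex_translation convex_pos2)
  have "tcone P v \<subseteq> pos2 a b"
  proof
    fix c assume "c \<in> tcone P v"
    then obtain m y where c: "c = m *\<^sub>R (y - v)" "y \<in> P" "m \<ge> 0" by (auto simp: tcone_def)
    then obtain s t where "y - v = s *\<^sub>R a + t *\<^sub>R b" "s \<ge> 0" "t \<ge> 0"
      using sub by (auto simp: pos2_def)
    then show "c \<in> pos2 a b" using c pos2I[of "m * s" "m * t" a b] by (simp add: scaleR_add_right)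
  qed
  moreover have "pos2 a b \<subseteq> tcone P v"
  proof
    fix c assume "c \<in> pos2 a b"
    then obtain s t where c: "c = s *\<^sub>R a + t *\<^sub>R b" and st: "s \<ge> 0" "t \<ge> 0" by (auto simp: pos2_def)
    show "c \<in> tcone P v"
    proof (cases "s + t = 0")
      case True
      then have "c = 0 *\<^sub>R (v - v)" using c st by (simp add: add_nonneg_eq_0_iff)
      then show ?thesis using vP by (auto simp: tcone_def)
    next
      case False
      define y where "y = (s / (s + t)) *\<^sub>R (v + a) + (t / (s + t)) *\<^sub>R (v + b)"
      have st1: "s / (s + t) + t / (s + t) = 1" using False by (simp flip: add_divide_distrib)
      have "y \<in> P"
        unfolding y_def using convexD[OF convex_polygonD(1)[OF P] W_P[OF a(1)] W_P[OF b(1)] _ _ st1] st by simp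
      moreover have "y = v + (s / (s + t)) *\<^sub>R a + (t / (s + t)) *\<^sub>R b"
      proof -
        have "y = (s / (s + t) + t / (s + t)) *\<^sub>R v + (s / (s + t)) *\<^sub>R a + (t / (s + t)) *\<^sub>R b"
          by (simp only: y_def scaleR_add_right scaleR_add_left) (simp only: add_ac)
        then show ?thesis by (simp only: st1 scaleR_one)
      qed
      then have "c = (s + t) *\<^sub>R (y - v)" using False c by (simp add: scaleR_add_right)
      ultimately show ?thesis using st tconeI[of y P "s + t" v] by simp
    qed
  qed
  ultimately show ?thesis using that ab pos by blast
qed

text \<open>Only finitely many hull points compete with v. Those with smaller \<open>u\<close>-value
  stay below for small e by continuity, and ties are broken by t as soon as e > 0.\<close>

lemma lexicographic_max_exposed:
  assumes P: "convex_polygon P" and u: "u \<noteq> 0" and t: "t \<noteq> 0" "u \<bullet> t = 0"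
    and v: "v \<in> P" "\<And>y. y \<in> P \<Longrightarrow> u \<bullet> y < u \<bullet> v \<or> u \<bullet> y = u \<bullet> v \<and> t \<bullet> y \<le> t \<bullet> v"
  shows "eventually (\<lambda>e. exposes (u + e *\<^sub>R t) P v) (at_right 0)"
proof -
  obtain V where V: "finite V" "P = convex hull V" using polytope_finite_hull[OF P] .
  have *: "eventually (\<lambda>e. (u + e *\<^sub>R t) \<bullet> x < (u + e *\<^sub>R t) \<bullet> v) (at_right 0)" if x: "x \<in> V" "x \<noteq> v" for x
  proof -
    have xP: "x \<in> P" using x V hull_subset[of V convex] by auto
    show ?thesis
    proof (cases "u \<bullet> x < u \<bullet> v")
      case True
      have "((\<lambda>e. (u + e *\<^sub>R t) \<bullet> x - (u + e *\<^sub>R t) \<bullet> v) \<longlongrightarrow> (u + 0 *\<^sub>R t) \<bullet> x - (u + 0 *\<^sub>R t) \<bullet> v) (at_right 0)"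
        by (intro tendsto_intros)
      then have "eventually (\<lambda>e. (u + e *\<^sub>R t) \<bullet> x - (u + e *\<^sub>R t) \<bullet> v < 0) (at_right 0)"
        by (rule order_tendstoD) (use True in simp)
      then show ?thesis by eventually_elim simp
    next
      case False
      then have ux: "u \<bullet> x = u \<bullet> v" "t \<bullet> x \<le> t \<bullet> v" using v(2)[OF xP] by auto
      \<comment> \<open>Being orthogonal and non-zero, u and t are coordinates of the plane; a tie
        in both would force x = v.\<close>
      have "t \<bullet> x \<noteq> t \<bullet> v"
      proof
        assume "t \<bullet> x = t \<bullet> v"
        then have "u \<bullet> (x - v) = 0" "t \<bullet> (x - v) = 0" using ux by (simp_all add: inner_diff_right)
        moreover from this have "(u \<bullet> u) *\<^sub>R (x - v) = (rot u \<bullet> (x - v)) *\<^sub>R rot u"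
          using rot_expand[of u "x - v"] by simp
        moreover have "(u \<bullet> u) *\<^sub>R t = (rot u \<bullet> t) *\<^sub>R rot u"
          using rot_expand[of u t] t by simp
        ultimately have "(rot u \<bullet> t) * (rot u \<bullet> (x - v)) = 0"
          by (metis inner_scaleR_left mult_zero_right)
        moreover have "rot u \<bullet> t \<noteq> 0" using \<open>(u \<bullet> u) *\<^sub>R t = _\<close> u t by auto
        ultimately have "rot u \<bullet> (x - v) = 0" by simp
        then show False using \<open>(u \<bullet> u) *\<^sub>R (x - v) = _\<close> u x by simp
      qed
      then have "eventually (\<lambda>e. (u + e *\<^sub>R t) \<bullet> x < (u + e *\<^sub>R t) \<bullet> v) (at_right (0::real))"
        using ux by (auto simp: inner_add_left eventually_at_filter)
      then show ?thesis .
    qed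
  qed
  have "eventually (\<lambda>e. \<forall>x\<in>V - {v}. (u + e *\<^sub>R t) \<bullet> x < (u + e *\<^sub>R t) \<bullet> v) (at_right 0)"
    using V * by (intro eventually_ball_finite) auto
  then show ?thesis
  proof eventually_elim
    case (elim e)
    define n where "n = u + e *\<^sub>R t"
    have "V \<subseteq> insert v {x. n \<bullet> x < n \<bullet> v}" using elim by (auto simp: n_def)
    \<comment> \<open>An open half-plane stays convex when one boundary point is added, so
      strictness at the hull points extends to all of P except v.\<close>
    moreover have "convex (insert v {x. n \<bullet> x < n \<bullet> v})"
    proof (rule convexI)
      fix x y and a b :: real
      assume xy: "x \<in> insert v {x. n \<bullet> x < n \<bullet> v}" "y \<in> insert v {x. n \<bullet> x < n \<bullet> v}"
        and ab: "0 \<le> a" "0 \<le> b" "a + b = 1"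
      then have le: "n \<bullet> x \<le> n \<bullet> v" "n \<bullet> y \<le> n \<bullet> v" by auto
      consider "a = 0" | "b = 0" | "x = v" "y = v" | "a > 0" "b > 0" "n \<bullet> x < n \<bullet> v \<or> n \<bullet> y < n \<bullet> v"
        using xy ab by fastforce
      then show "a *\<^sub>R x + b *\<^sub>R y \<in> insert v {x. n \<bullet> x < n \<bullet> v}"
      proof cases
        case 3
        then have "a *\<^sub>R x + b *\<^sub>R y = v" using ab by (simp flip: scaleR_add_left)
        then show ?thesis by simp
      next
        case 4
        then have "a * (n \<bullet> x) + b * (n \<bullet> y) < a * (n \<bullet> v) + b * (n \<bullet> v)"
          using le by (auto intro: add_le_less_mono add_less_le_mono mult_left_mono mult_strict_left_mono)
        also have "\<dots> = n \<bullet> v" using ab by (simp flip: distrib_right)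
        finally show ?thesis by (simp add: inner_add_right)
      qed (use xy ab in auto)
    qed
    ultimately have "P \<subseteq> insert v {x. n \<bullet> x < n \<bullet> v}" unfolding V(2) by (rule hull_minimal)
    then show ?case using v(1) by (auto simp: exposes_def n_def)
  qed
qed

text \<open>The difference of two apexes would lie in the cone together with its negative, but the
  cone is pointed.\<close>

lemma tcone_apex_unique:
  assumes "v \<in> P" "w \<in> P" "tcone P v = pos2 a b" "tcone P w = pos2 a b" "cross2 a b \<noteq> 0"
  shows "v = w"
proof -
  have "w - v \<in> pos2 a b" "- (w - v) \<in> pos2 a b"
    using diff_in_tcone[of w P v] diff_in_tcone[of v P w] assms by simp_all
  then have "w - v = 0" by (rule pos2_antisym[OF assms(5)])
  then show ?thesis by simp
qed

lemma bounded_ray_parameters: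
  fixes a :: "'a::real_normed_vector"
  assumes "bounded P" "a \<noteq> 0"
  shows "bounded {s::real. v + s *\<^sub>R a \<in> P}"
proof -
  obtain B where B: "\<And>x. x \<in> P \<Longrightarrow> norm x \<le> B" using assms(1) by (auto simp: bounded_iff)
  have "\<bar>s\<bar> \<le> (B + norm v) / norm a" if "v + s *\<^sub>R a \<in> P" for s
  proof -
    have "norm (s *\<^sub>R a) \<le> norm (v + s *\<^sub>R a) + norm v"
      using norm_triangle_ineq4[of "v + s *\<^sub>R a" v] by simp
    also have "\<dots> \<le> B + norm v" using B[OF that] by simp
    finally show ?thesis using assms(2) by (simp add: pos_le_divide_eq)
  qed
  then show ?thesis by (auto simp: bounded_iff)
qed

text \<open>Follow the ray from v to its last point w in P. This w is the lexicographic maximum for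
  n and then a, hence exposed, so its cone has two generators. The backward direction
  \<open>- a\<close> lies on the supporting line and must be one of them up to scaling.\<close>

lemma adjacent_vertex:
  assumes P: "convex_polygon P" and v: "v \<in> P" and cone: "tcone P v = pos2 a b"
    and n: "n \<bullet> a = 0" "n \<bullet> b < 0" and a0: "a \<noteq> 0"
  obtains l c where "l > 0" "v + l *\<^sub>R a \<in> P" "tcone P (v + l *\<^sub>R a) = pos2 (- a) c" "n \<bullet> c < 0"
proof -
  define S where "S = {0..} \<inter> (\<lambda>s. v + s *\<^sub>R a) -` P"
  have "closed S"
    unfolding S_def using convex_polygonD(3)[OF P]
    by (intro closed_Int closed_vimage continuous_intros) auto
  moreover have "bounded S"
    by (rule bounded_subset[OF bounded_ray_parameters[OF convex_polygonD(4)[OF P] a0, of v]])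
      (auto simp: S_def)
  ultimately have "compact S" using compact_eq_bounded_closed by blast
  moreover have "0 \<in> S" using v by (simp add: S_def)
  ultimately obtain l where l: "l \<in> S" "\<And>s. s \<in> S \<Longrightarrow> s \<le> l"
    using compact_attains_sup[of S] by blast
  obtain s where "s > 0" "v + s *\<^sub>R a \<in> P"
    using tcone_obtain_point[of a P v] cone a0 by auto
  then have "l > 0" using l(2)[of s] by (simp add: S_def)
  define w where "w = v + l *\<^sub>R a"
  have wP: "w \<in> P" using l(1) by (simp add: S_def w_def)
  have n0: "n \<noteq> 0" using n by auto
  have le: "n \<bullet> y < n \<bullet> w \<or> n \<bullet> y = n \<bullet> w \<and> a \<bullet> y \<le> a \<bullet> w" if y: "y \<in> P" for y
  proof -
    obtain s t where st: "y - v = s *\<^sub>R a + t *\<^sub>R b" "s \<ge> 0" "t \<ge> 0"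
      using diff_in_tcone[OF y, of v] unfolding cone pos2_def by blast
    then have y_eq: "y = v + s *\<^sub>R a + t *\<^sub>R b" by (simp add: algebra_simps)
    show ?thesis
    proof (cases "t = 0")
      case True
      then have "s \<in> S" using y y_eq st by (simp add: S_def)
      then have "s * (a \<bullet> a) \<le> l * (a \<bullet> a)" using l(2) by (intro mult_right_mono) auto
      then show ?thesis using True y_eq n by (simp add: w_def inner_add_right)
    next
      case False
      then have "t * (n \<bullet> b) < 0" using st n by (simp add: mult_pos_neg)
      then show ?thesis using y_eq n by (simp add: w_def inner_add_right)
    qed
  qed
  have "eventually (\<lambda>e. exposes (n + e *\<^sub>R a) P w) (at_right 0)"
    using lexicographic_max_exposed[OF P n0 a0 n(1) wP le] by blast
  then obtain e where e: "exposes (n + e *\<^sub>R a) P w"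
    using eventually_happens'[OF trivial_limit_at_right_real] by blast
  obtain a' b' where ab': "tcone P w = pos2 a' b'" "cross2 a' b' > 0"
    using tcone_eq_pos2[OF P e] by blast
  have le0: "n \<bullet> c \<le> 0" if c: "c \<in> pos2 a' b'" for c
  proof -
    obtain m y where "c = m *\<^sub>R (y - w)" "y \<in> P" "m \<ge> 0" using c ab'(1) unfolding tcone_def by blast
    then show ?thesis using le[of y] by (auto simp: inner_diff_right intro!: mult_nonneg_nonpos)
  qed
  have par: "cross2 x y = 0" if "n \<bullet> x = 0" "n \<bullet> y = 0" for x y
  proof -
    have "(n \<bullet> n) * cross2 x y = (n \<bullet> x) * cross2 n y - (n \<bullet> y) * cross2 n x"
      by (simp add: cross2_eq inner2 algebra_simps)
    then show ?thesis using that n0 by simp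
  qed
  have "- a \<in> pos2 a' b'"
    using tconeI[OF v, of "1 / l" w] \<open>l > 0\<close> ab' by (simp add: w_def)
  then obtain s t where st: "- a = s *\<^sub>R a' + t *\<^sub>R b'" "s \<ge> 0" "t \<ge> 0" by (auto simp: pos2_def)
  have "s * (n \<bullet> a') + t * (n \<bullet> b') = 0"
    using arg_cong[OF st(1), of "(\<bullet>) n"] n by (simp add: inner_add_right)
  moreover have "s * (n \<bullet> a') \<le> 0" "t * (n \<bullet> b') \<le> 0"
    using st le0 by (auto intro: mult_nonneg_nonpos)
  ultimately have "s * (n \<bullet> a') = 0" "t * (n \<bullet> b') = 0" by linarith+
  moreover have "\<not> (n \<bullet> a' = 0 \<and> n \<bullet> b' = 0)" using par ab' by fastforce
  \<comment> \<open>Both generators have \<open>n\<close>-value at most 0, while \<open>- a\<close>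
    has value 0; since they are not parallel, only one generator can contribute to
    \<open>- a\<close>.\<close>
  ultimately consider "t = 0" "n \<bullet> a' = 0" "n \<bullet> b' \<noteq> 0" "s > 0" | "s = 0" "n \<bullet> b' = 0" "n \<bullet> a' \<noteq> 0" "t > 0"
    using st a0 by (cases "s = 0"; cases "t = 0") auto
  then obtain c where "pos2 a' b' = pos2 (- a) c" "n \<bullet> c < 0"
  proof cases
    case 1
    then have "pos2 (- a) b' = pos2 a' b'" using st pos2_scaleR[of s 1 a' b'] by simp
    moreover have "n \<bullet> b' < 0" using le0[of b'] 1 by simp
    ultimately show ?thesis using that[of b'] by simp
  next
    case 2
    then have "pos2 (- a) a' = pos2 a' b'" using st pos2_scaleR[of t 1 b' a'] by (simp add: pos2_commute)
    moreover have "n \<bullet> a' < 0" using le0[of a'] 2 by simp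
    ultimately show ?thesis using that[of a'] by simp
  qed
  then show ?thesis using that[of l c] \<open>l > 0\<close> wP ab' by (simp add: w_def)
qed

text \<open>Edges and vertices share one description: l = 0 is the case of a vertex, and l measures
  length in units of \<open>rot u\<close>.\<close>

lemma face_in_segment:
  assumes P: "compact P" "convex P" "P \<noteq> {}" and u: "u \<noteq> 0"
  obtains p l where "l \<ge> 0" "face_in u P = {p + s *\<^sub>R rot u | s. 0 \<le> s \<and> s \<le> l}"
proof -
  have "continuous_on P ((\<bullet>) u)" by (intro continuous_intros)
  then obtain x0 where x0: "x0 \<in> P" "\<And>y. y \<in> P \<Longrightarrow> u \<bullet> y \<le> u \<bullet> x0"
    using continuous_attains_sup[OF P(1,3)] by blast
  have F: "face_in u P = P \<inter> {x. u \<bullet> x = u \<bullet> x0}"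
  proof (intro equalityI subsetI)
    fix x assume "x \<in> face_in u P"
    then show "x \<in> P \<inter> {x. u \<bullet> x = u \<bullet> x0}"
      using x0 order_antisym[of "u \<bullet> x" "u \<bullet> x0"] by (simp add: face_in_def)
  qed (use x0 in \<open>simp add: face_in_def\<close>)
  have "compact (face_in u P)" "convex (face_in u P)" "x0 \<in> face_in u P"
    unfolding F using P x0 by (simp_all add: compact_Int_closed closed_hyperplane convex_Int convex_hyperplane)
  note F' = this
  have cont: "continuous_on (face_in u P) ((\<bullet>) (rot u))" by (intro continuous_intros)
  obtain q where q: "q \<in> face_in u P" "\<And>y. y \<in> face_in u P \<Longrightarrow> rot u \<bullet> y \<le> rot u \<bullet> q"
    using continuous_attains_sup[OF F'(1) _ cont] F'(3) by blast
  obtain p where p: "p \<in> face_in u P" "\<And>y. y \<in> face_in u P \<Longrightarrow> rot u \<bullet> p \<le> rot u \<bullet> y"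
    using continuous_attains_inf[OF F'(1) _ cont] F'(3) by blast
  have uu: "u \<bullet> u > 0" using u by simp
  define f where "f x = (rot u \<bullet> (x - p)) / (u \<bullet> u)" for x
  have f: "x = p + f x *\<^sub>R rot u" if "x \<in> face_in u P" for x
  proof -
    have "u \<bullet> (x - p) = 0" using that p(1) F by (simp add: inner_diff_right)
    then have "(u \<bullet> u) *\<^sub>R (x - p) = (rot u \<bullet> (x - p)) *\<^sub>R rot u" using rot_expand[of u "x - p"] by simp
    also have "\<dots> = (u \<bullet> u) *\<^sub>R (f x *\<^sub>R rot u)" using uu by (simp add: f_def)
    finally have "x - p = f x *\<^sub>R rot u" by (rule scaleR_left_imp_eq[rotated]) (use uu in simp)
    then show ?thesis by (simp add: algebra_simps)
  qed
  have "face_in u P = {p + s *\<^sub>R rot u | s. 0 \<le> s \<and> s \<le> f q}"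
  proof (intro equalityI subsetI)
    fix x assume x: "x \<in> face_in u P"
    have "0 \<le> f x" "f x \<le> f q"
      using p(2)[OF x] q(2)[OF x] uu by (simp_all add: f_def inner_diff_right divide_right_mono)
    then show "x \<in> {p + s *\<^sub>R rot u | s. 0 \<le> s \<and> s \<le> f q}" using f[OF x] by blast
  next
    fix x assume "x \<in> {p + s *\<^sub>R rot u | s. 0 \<le> s \<and> s \<le> f q}"
    then obtain s where s: "x = p + s *\<^sub>R rot u" "0 \<le> s" "s \<le> f q" by blast
    show "x \<in> face_in u P"
    proof (cases "f q = 0")
      case True then show ?thesis using s p(1) by simp
    next
      case False
      define k where "k = s / f q"
      have k: "0 \<le> k" "0 \<le> 1 - k" "s = k * f q" using s False by (auto simp: k_def divide_le_eq)
      have "(1 - k) *\<^sub>R p + k *\<^sub>R q \<in> face_in u P"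
        using convexD[OF F'(2) p(1) q(1) k(2,1)] by simp
      moreover have "(1 - k) *\<^sub>R p + k *\<^sub>R (p + f q *\<^sub>R rot u) = x"
        using s k(3) by (simp add: algebra_simps)
      ultimately show ?thesis by (simp flip: f[OF q(1)])
    qed
  qed
  moreover have "f q \<ge> 0" using p(2)[OF q(1)] uu by (simp add: f_def inner_diff_right)
  ultimately show ?thesis using that by blast
qed

text \<open>P has a point y strictly below the supporting line, since it has interior. A multiple of
  \<open>y - x\<close> absorbs the normal component of a vector of the half-plane; the rest is
  parallel to the edge, and P extends from x both ways along it.\<close>

lemma tcone_edge:
  assumes P: "convex_polygon P" and u: "u \<noteq> 0" and x: "x \<in> face_in u P"
    and e: "e > 0" "x + e *\<^sub>R rot u \<in> P" "x - e *\<^sub>R rot u \<in> P"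
  shows "tcone P x = {z. u \<bullet> z \<le> 0}"
proof (intro equalityI subsetI)
  fix z assume "z \<in> tcone P x"
  then obtain m y where "z = m *\<^sub>R (y - x)" "y \<in> P" "m \<ge> 0" by (auto simp: tcone_def)
  then show "z \<in> {z. u \<bullet> z \<le> 0}"
    using x by (auto simp: face_in_def inner_diff_right intro!: mult_nonneg_nonpos)
next
  fix z assume "z \<in> {z. u \<bullet> z \<le> 0}"
  then have uz: "u \<bullet> z \<le> 0" by simp
  have xP: "x \<in> P" using x by (simp add: face_in_def)
  obtain y where y: "y \<in> P" "u \<bullet> y < u \<bullet> x"
  proof (rule ccontr)
    assume "\<not> thesis"
    then have "P \<subseteq> {y. u \<bullet> y = u \<bullet> x}" using that x by (fastforce simp: face_in_def)
    then show False using convex_polygon_not_subset_hyperplane[OF P u] by blast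
  qed
  define t where "t = (u \<bullet> z) / (u \<bullet> (y - x))"
  have uyx: "u \<bullet> (y - x) < 0" using y by (simp add: inner_diff_right)
  then have t: "t \<ge> 0" using uz by (simp add: t_def divide_nonpos_neg)
  define w where "w = z - t *\<^sub>R (y - x)"
  have "u \<bullet> w = 0" using uyx by (simp add: w_def t_def inner_diff_right)
  define k where "k = (rot u \<bullet> w) / (u \<bullet> u)"
  have "(u \<bullet> u) *\<^sub>R w = (u \<bullet> u) *\<^sub>R (k *\<^sub>R rot u)"
    using rot_expand[of u w] u \<open>u \<bullet> w = 0\<close> by (simp add: k_def)
  then have wk: "w = k *\<^sub>R rot u" by (rule scaleR_left_imp_eq[rotated]) (use u in simp)
  \<comment> \<open>The neighbour of x on the side given by the sign of k, so that its coefficient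
    \<open>\<bar>k\<bar> / e\<close> is non-negative.\<close>
  define q where "q = (if k \<ge> 0 then x + e *\<^sub>R rot u else x - e *\<^sub>R rot u)"
  have q: "q \<in> P" using e by (simp add: q_def)
  have z: "z = t *\<^sub>R (y - x) + (\<bar>k\<bar> / e) *\<^sub>R (q - x)"
    using wk e by (auto simp: q_def w_def algebra_simps)
  show "z \<in> tcone P x"
  proof (cases "t + \<bar>k\<bar> / e = 0")
    case True
    then have "t = 0" "\<bar>k\<bar> / e = 0" using t e by (simp_all add: add_nonneg_eq_0_iff)
    then have "z = 0 *\<^sub>R (x - x)" using z by simp
    then show ?thesis using xP by (auto simp: tcone_def)
  next
    case False
    define r where "r = t + \<bar>k\<bar> / e"
    have r: "r > 0" using False t e unfolding r_def by (smt (verit) divide_nonneg_pos)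
    have "(t / r) *\<^sub>R y + ((\<bar>k\<bar> / e) / r) *\<^sub>R q \<in> P"
    proof (rule convexD[OF convex_polygonD(1)[OF P] y(1) q])
      have "t / r + \<bar>k\<bar> / e / r = (t + \<bar>k\<bar> / e) / r" by (simp only: add_divide_distrib)
      then show "t / r + \<bar>k\<bar> / e / r = 1" using r by (simp only: flip: r_def) simp
    qed (use r t e in auto)
    moreover have "z = r *\<^sub>R (((t / r) *\<^sub>R y + ((\<bar>k\<bar> / e) / r) *\<^sub>R q) - x)"
    proof -
      have "r *\<^sub>R (((t / r) *\<^sub>R y + ((\<bar>k\<bar> / e) / r) *\<^sub>R q) - x) = t *\<^sub>R y + (\<bar>k\<bar> / e) *\<^sub>R q - r *\<^sub>R x"
        using r by (simp add: scaleR_add_right scaleR_diff_right)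
      also have "\<dots> = z" unfolding z r_def by (simp add: algebra_simps)
      finally show ?thesis by simp
    qed
    ultimately show ?thesis using r tconeI[of _ P r x] by simp
  qed
qed

section \<open>Proper faces and their support cones\<close>

lemma proper_face_face_in:
  assumes P: "convex_polygon P" and u: "u \<noteq> 0"
  shows "proper_face P (face_in u P)"
proof -
  obtain p l where l: "l \<ge> 0" "face_in u P = {p + s *\<^sub>R rot u | s. 0 \<le> s \<and> s \<le> l}"
    using face_in_segment[OF convex_polygonD(2,1,5)[OF P] u] .
  have "p + 0 *\<^sub>R rot u \<in> face_in u P" unfolding l using l(1) by blast
  then have p: "p \<in> face_in u P" by simp
  have F: "face_in u P = P \<inter> {x. u \<bullet> x = u \<bullet> p}"
  proof (intro equalityI subsetI)
    fix x assume "x \<in> face_in u P"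
    then show "x \<in> P \<inter> {x. u \<bullet> x = u \<bullet> p}"
      using p order_antisym[of "u \<bullet> x" "u \<bullet> p"] by (simp add: face_in_def)
  qed (use p in \<open>simp add: face_in_def\<close>)
  have "face_in u P face_of P"
    unfolding F using p by (intro face_of_Int_supporting_hyperplane_le convex_polygonD(1)[OF P]) (auto simp: face_in_def)
  moreover have "face_in u P \<noteq> P"
    using convex_polygon_not_subset_hyperplane[OF P u, of "u \<bullet> p"] F by auto
  ultimately show ?thesis using p by (auto simp: proper_face_def)
qed

text \<open>Faces of a polyhedron are exposed, which supplies an outer normal; it is non-zero
  because F is neither empty nor all of P.\<close>

lemma proper_face_imp_face_in:
  assumes P: "convex_polygon P" and F: "proper_face P F"
  obtains u where "u \<noteq> 0" "F = face_in u P"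
proof -
  have "polyhedron P" using P by (simp add: convex_polygon_def polytope_imp_polyhedron)
  then have "F exposed_face_of P"
    using F exposed_face_of_polyhedron by (auto simp: proper_face_def)
  then obtain u b where u: "P \<subseteq> {x. u \<bullet> x \<le> b}" "F = P \<inter> {x. u \<bullet> x = b}"
    by (auto simp: exposed_face_of_def)
  obtain x where x: "x \<in> F" using F by (auto simp: proper_face_def)
  have "u \<noteq> 0" using u x F by (auto simp: proper_face_def)
  moreover have "F = face_in u P" using u x by (fastforce simp: face_in_def)
  ultimately show ?thesis using that by blast
qed

lemma support_cone_vertex:
  assumes "convex P" "{v} face_of P"
  shows "support_cone P {v} = tcone P v"
  using support_cone_eq[OF assms(2,1), of v] by (simp add: tcone_def)

lemma support_cone_edge:
  assumes P: "convex_polygon P" and u: "u \<noteq> 0" and l: "l > 0"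
    and F: "face_in u P = {p + s *\<^sub>R rot u | s. 0 \<le> s \<and> s \<le> l}"
  shows "support_cone P (face_in u P) = {z. u \<bullet> z \<le> 0}"
proof -
  define x where "x = p + (l / 2) *\<^sub>R rot u"
  have seg: "face_in u P = closed_segment p (p + l *\<^sub>R rot u)"
  proof (intro equalityI subsetI)
    fix y assume "y \<in> face_in u P"
    then obtain s where s: "y = p + s *\<^sub>R rot u" "0 \<le> s" "s \<le> l" using F by blast
    then have "y = (1 - s / l) *\<^sub>R p + (s / l) *\<^sub>R (p + l *\<^sub>R rot u)" using l by (simp add: algebra_simps)
    moreover have "0 \<le> s / l" "s / l \<le> 1" using s l by auto
    ultimately show "y \<in> closed_segment p (p + l *\<^sub>R rot u)" by (auto simp: closed_segment_def)
  next
    fix y assume "y \<in> closed_segment p (p + l *\<^sub>R rot u)"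
    then obtain s where s: "y = (1 - s) *\<^sub>R p + s *\<^sub>R (p + l *\<^sub>R rot u)" "0 \<le> s" "s \<le> 1"
      by (auto simp: closed_segment_def)
    then have "y = p + (s * l) *\<^sub>R rot u" by (simp add: algebra_simps)
    moreover have "0 \<le> s * l" "s * l \<le> l" using s l by (auto simp: mult_left_le_one_le)
    ultimately show "y \<in> face_in u P" using F by blast
  qed
  have "x \<in> open_segment p (p + l *\<^sub>R rot u)"
  proof -
    have "x = (1 - 1/2) *\<^sub>R p + (1/2) *\<^sub>R (p + l *\<^sub>R rot u)"
      by (simp add: x_def vec_eq_iff field_simps)
    then show ?thesis using l u unfolding in_segment by (intro conjI exI[of _ "1/2"]) auto
  qed
  then have xr: "x \<in> rel_interior (face_in u P)"
    unfolding seg using l u by (simp add: rel_interior_closed_segment)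
  have x: "x \<in> face_in u P" using xr rel_interior_subset by blast
  have "x + (l / 2) *\<^sub>R rot u \<in> face_in u P" "x - (l / 2) *\<^sub>R rot u \<in> face_in u P"
  proof -
    have "x + (l / 2) *\<^sub>R rot u = p + l *\<^sub>R rot u" "x - (l / 2) *\<^sub>R rot u = p + 0 *\<^sub>R rot u"
      by (simp_all add: x_def vec_eq_iff field_simps)
    then show "x + (l / 2) *\<^sub>R rot u \<in> face_in u P" "x - (l / 2) *\<^sub>R rot u \<in> face_in u P"
      unfolding F using l by (metis (mono_tags, lifting) CollectI less_imp_le order_refl)+
  qed
  then have "tcone P x = {z. u \<bullet> z \<le> 0}"
    using l by (intro tcone_edge[OF P u x, of "l / 2"]) (auto simp: face_in_def)
  moreover have "face_in u P face_of P" using proper_face_face_in[OF P u] by (simp add: proper_face_def)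
  ultimately show ?thesis
    using support_cone_eq[OF _ convex_polygonD(1)[OF P] xr] by (simp add: tcone_def)
qed

section \<open>Laplace transforms of plane sets\<close>

lemma nn_integral_lborel_translate:
  fixes p :: "'a::euclidean_space"
  assumes [measurable]: "h \<in> borel_measurable borel"
  shows "(\<integral>\<^sup>+x. h (p + x) \<partial>lborel) = (\<integral>\<^sup>+x. h x \<partial>lborel)"
proof -
  have "(\<integral>\<^sup>+x. h x \<partial>lborel) = (\<integral>\<^sup>+x. h x \<partial>distr lborel borel ((+) p))"
    by (simp add: lborel_distr_plus)
  then show ?thesis by (simp add: nn_integral_distr)
qed

text \<open>Lebesgue measure is characterised by its values on boxes. The preimage of a box under
  the coordinate map is its image under the inverse map g, given by Cramer's rule, with determinant
  \<open>1 / cross2 a b\<close>.\<close>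

lemma lborel_eq_distr_plane:
  fixes a b :: "real^2"
  assumes c: "cross2 a b \<noteq> 0"
  shows "lborel = scale_measure (ennreal \<bar>cross2 a b\<bar>) (distr lborel borel (\<lambda>x::real^2. x $ 1 *\<^sub>R a + x $ 2 *\<^sub>R b))"
    (is "_ = scale_measure _ (distr _ _ ?f)")
proof (rule lborel_eqI)
  fix l u :: "real^2" assume lu: "\<And>b. b \<in> Basis \<Longrightarrow> l \<bullet> b \<le> u \<bullet> b"
  define g :: "real^2 \<Rightarrow> real^2"
    where "g x = vector [cross2 x b / cross2 a b, cross2 a x / cross2 a b]" for x
  have lin: "linear g"
    by (rule linearI) (simp_all add: g_def vec_eq_iff forall_2 add_divide_distrib)
  have fg: "?f (g x) = x" for x
  proof -
    have "cross2 a b *\<^sub>R ?f (g x) = cross2 x b *\<^sub>R a + cross2 a x *\<^sub>R b"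
      using c by (simp add: g_def scaleR_add_right)
    then have "cross2 a b *\<^sub>R ?f (g x) = cross2 a b *\<^sub>R x" by (simp only: cross2_expand[of a b x])
    then show ?thesis using c by simp
  qed
  have gf: "g (?f x) = x" for x
    using c by (simp add: g_def vec_eq_iff forall_2 cross2_eq) (simp add: field_simps)
  have pre: "?f -` box l u = g ` box l u"
    using fg gf by (auto simp: image_iff) (metis)
  have "det (matrix g) = 1 / cross2 a b"
    using c by (simp add: det_2 matrix_def g_def cross2_eq axis_def power2_eq_square divide_simps)
  then have "measure lebesgue (g ` box l u) = \<bar>1 / cross2 a b\<bar> * measure lebesgue (box l u)"
    using measure_linear_image[OF lin, of "box l u"] by simp
  moreover have "g ` box l u \<in> lmeasurable"
    by (rule measurable_linear_image[OF lin]) simp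
  ultimately have m: "emeasure lebesgue (g ` box l u) = ennreal (\<bar>1 / cross2 a b\<bar> * measure lebesgue (box l u))"
    using emeasure_eq_measure2 by metis
  have fm: "?f \<in> borel_measurable lborel" by measurable
  have "emeasure (scale_measure (ennreal \<bar>cross2 a b\<bar>) (distr lborel borel ?f)) (box l u)
      = ennreal \<bar>cross2 a b\<bar> * emeasure lborel (?f -` box l u)"
    using fm by (simp add: emeasure_distr)
  also have "emeasure lborel (?f -` box l u) = emeasure lebesgue (g ` box l u)"
    using measurable_sets[OF fm, of "box l u"] by (simp add: pre)
  also have "ennreal \<bar>cross2 a b\<bar> * \<dots> = ennreal (measure lebesgue (box l u))"
    unfolding m using c by (simp flip: ennreal_mult')
  also have "\<dots> = (\<Prod>b\<in>Basis. (u - l) \<bullet> b)"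
    using lu by simp
  finally show "emeasure (scale_measure (ennreal \<bar>cross2 a b\<bar>) (distr lborel borel ?f)) (box l u)
      = (\<Prod>b\<in>Basis. (u - l) \<bullet> b)" .
qed simp

lemma nn_integral_affine_plane:
  fixes a b p :: "real^2"
  assumes c: "cross2 a b \<noteq> 0" and [measurable]: "h \<in> borel_measurable borel"
  shows "(\<integral>\<^sup>+x. h x \<partial>lborel) = ennreal \<bar>cross2 a b\<bar> * (\<integral>\<^sup>+x. h (p + ((x::real^2) $ 1 *\<^sub>R a + x $ 2 *\<^sub>R b)) \<partial>lborel)"
proof -
  have "(\<integral>\<^sup>+x. h x \<partial>lborel) = (\<integral>\<^sup>+x. h (p + x) \<partial>lborel)"
    by (simp add: nn_integral_lborel_translate)
  also have "\<dots> = (\<integral>\<^sup>+x. h (p + x) \<partial>scale_measure (ennreal \<bar>cross2 a b\<bar>) (distr lborel borel (\<lambda>x::real^2. x $ 1 *\<^sub>R a + x $ 2 *\<^sub>R b)))"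
    using lborel_eq_distr_plane[OF c] by simp
  also have "\<dots> = ennreal \<bar>cross2 a b\<bar> * (\<integral>\<^sup>+x. h (p + ((x::real^2) $ 1 *\<^sub>R a + x $ 2 *\<^sub>R b)) \<partial>lborel)"
    by (simp add: nn_integral_scale_measure nn_integral_distr)
  finally show ?thesis .
qed

lemma nn_integral_product_plane:
  fixes f g :: "real \<Rightarrow> ennreal"
  assumes [measurable]: "f \<in> borel_measurable borel" "g \<in> borel_measurable borel"
  shows "(\<integral>\<^sup>+x. f (x $ 1) * g (x $ 2) \<partial>(lborel :: (real^2) measure)) = (\<integral>\<^sup>+t. f t \<partial>lborel) * (\<integral>\<^sup>+t. g t \<partial>lborel)"
proof -
  define e1 e2 :: "real^2" where "e1 = axis 1 1" and "e2 = axis 2 1"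
  have ne: "e1 \<noteq> e2" by (simp add: e1_def e2_def axis_eq_axis)
  have B: "(Basis :: (real^2) set) = {e1, e2}"
    by (auto simp: Basis_vec_def e1_def e2_def UNIV_2)
  define F where "F b = (if b = e1 then f else g)" for b
  have "(\<integral>\<^sup>+x. (\<Prod>b\<in>Basis. F b (x \<bullet> b)) \<partial>lborel) = (\<Prod>b\<in>Basis. (\<integral>\<^sup>+t. F b t \<partial>lborel))"
    by (rule nn_integral_lborel_prod) (auto simp: F_def)
  then show ?thesis
    using ne by (simp add: B F_def) (simp add: e1_def e2_def inner_axis)
qed

lemma nn_integral_exp_decay:
  assumes "c < 0"
  shows "(\<integral>\<^sup>+t. ennreal (exp (c * t)) * indicator {0..} t \<partial>lborel) = ennreal (- 1 / c)"
proof -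
  have "((\<lambda>t. exp (c * t) / c) \<longlongrightarrow> 0) at_top"
    using assms by real_asymp
  then have "(\<integral>\<^sup>+t. ennreal (exp (c * t)) * indicator {0..} t \<partial>lborel) = ennreal (0 - exp (c * 0) / c)"
    by (intro nn_integral_FTC_atLeast) (use assms in \<open>auto intro!: derivative_eq_intros\<close>)
  then show ?thesis by simp
qed

lemma ennreal_mult3:
  assumes "a \<ge> 0" "b \<ge> 0" "c \<ge> 0"
  shows "ennreal a * (ennreal b * (ennreal c * x)) = ennreal (a * b * c) * x"
  using assms by (simp add: ennreal_mult mult.assoc)

text \<open>The Laplace transform of an indicator function, with the sign chosen so that a cone has
  a finite transform where \<xi> is negative on its rays. Values in \<open>ennreal\<close> admit
  unbounded sets without integrability conditions.\<close>

definition lap :: "(real^2) set \<Rightarrow> real^2 \<Rightarrow> ennreal" where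
  "lap P \<xi> = (\<integral>\<^sup>+x. indicator P x * ennreal (exp (\<xi> \<bullet> x)) \<partial>lborel)"

text \<open>In coordinates along a and b the cone is a quadrant and the exponential
  factorises.\<close>

lemma lap_pos2:
  assumes "cross2 a b \<noteq> 0" "\<xi> \<bullet> a < 0" "\<xi> \<bullet> b < 0"
  shows "lap (pos2 a b) \<xi> = ennreal (\<bar>cross2 a b\<bar> / ((\<xi> \<bullet> a) * (\<xi> \<bullet> b)))"
proof -
  have "closed (pos2 a b)"
    using assms(1) closed_pos2[of a b] closed_pos2[of b a] cross2_commute[of a b] pos2_commute[of a b]
    by (cases "cross2 a b > 0") auto
  then have [measurable]: "pos2 a b \<in> sets borel" by simp
  have mem: "indicator (pos2 a b) (s *\<^sub>R a + t *\<^sub>R b) = (indicator {0..} s * indicator {0..} t :: ennreal)" for s t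
  proof (cases "s \<ge> 0 \<and> t \<ge> 0")
    case True then show ?thesis by (simp add: pos2I)
  next
    case False
    have "s *\<^sub>R a + t *\<^sub>R b \<notin> pos2 a b"
    proof
      assume "s *\<^sub>R a + t *\<^sub>R b \<in> pos2 a b"
      then obtain s' t' where e: "s *\<^sub>R a + t *\<^sub>R b = s' *\<^sub>R a + t' *\<^sub>R b" "s' \<ge> 0" "t' \<ge> 0"
        by (auto simp: pos2_def)
      have "s = s'" "t = t'"
        using arg_cong[OF e(1), of "\<lambda>x. cross2 x b"] arg_cong[OF e(1), of "cross2 a"] assms(1) by simp_all
      then show False using False e by simp
    qed
    then show ?thesis using False by (auto simp: indicator_def)
  qed
  have "lap (pos2 a b) \<xi> = ennreal \<bar>cross2 a b\<bar> * (\<integral>\<^sup>+x.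
      indicator (pos2 a b) (0 + ((x::real^2) $ 1 *\<^sub>R a + x $ 2 *\<^sub>R b)) * ennreal (exp (\<xi> \<bullet> (0 + ((x::real^2) $ 1 *\<^sub>R a + x $ 2 *\<^sub>R b)))) \<partial>lborel)"
    unfolding lap_def by (rule nn_integral_affine_plane[OF assms(1)]) measurable
  also have "(\<integral>\<^sup>+x. indicator (pos2 a b) (0 + ((x::real^2) $ 1 *\<^sub>R a + x $ 2 *\<^sub>R b)) * ennreal (exp (\<xi> \<bullet> (0 + ((x::real^2) $ 1 *\<^sub>R a + x $ 2 *\<^sub>R b)))) \<partial>lborel)
    = (\<integral>\<^sup>+x. (ennreal (exp ((\<xi> \<bullet> a) * (x::real^2) $ 1)) * indicator {0..} (x $ 1)) *
              (ennreal (exp ((\<xi> \<bullet> b) * x $ 2)) * indicator {0..} (x $ 2)) \<partial>lborel)"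
    by (intro nn_integral_cong) (simp add: mem inner_add_right exp_add ennreal_mult mult_ac)
  also have "\<dots> = ennreal (- 1 / (\<xi> \<bullet> a)) * ennreal (- 1 / (\<xi> \<bullet> b))"
    using assms by (subst nn_integral_product_plane) (simp_all add: nn_integral_exp_decay)
  also have "\<dots> = ennreal (1 / ((\<xi> \<bullet> a) * (\<xi> \<bullet> b)))"
    using assms by (subst ennreal_mult[symmetric]) (simp_all add: divide_nonpos_neg)
  also have "ennreal \<bar>cross2 a b\<bar> * \<dots> = ennreal (\<bar>cross2 a b\<bar> / ((\<xi> \<bullet> a) * (\<xi> \<bullet> b)))"
    using assms by (subst ennreal_mult'[symmetric]) (simp_all add: zero_le_mult_iff)
  finally show ?thesis .
qed

text \<open>Blow P up about v. By convexity the dilates increase and exhaust the support cone, so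
  monotone convergence applies. The prefactor is the Jacobian of the dilation times the correction
  for moving v to the origin.\<close>

lemma lap_vertex_limit:
  assumes P: "closed P" "convex P" and v: "v \<in> P"
  shows "(\<lambda>n. ennreal (real (Suc n) ^ 2 * exp (- (real (Suc n) * (\<xi> \<bullet> v)))) * lap P (real (Suc n) *\<^sub>R \<xi>))
    \<longlonglongrightarrow> lap (tcone P v) \<xi>"
proof -
  have [measurable]: "P \<in> sets borel" using P by simp
  \<comment> \<open>The dilate of \<open>P - v\<close> by the factor n + 1; the shift by one keeps
    the factor non-zero.\<close>
  define Q where "Q n = {z. v + (1 / real (Suc n)) *\<^sub>R z \<in> P}" for n
  have Q_borel[measurable]: "Q n \<in> sets borel" for n
    unfolding Q_def by measurable
  have eq: "ennreal (real (Suc n) ^ 2 * exp (- (real (Suc n) * (\<xi> \<bullet> v)))) * lap P (real (Suc n) *\<^sub>R \<xi>) = lap (Q n) \<xi>" for n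
  proof -
    define N where "N = real (Suc n)"
    have N: "N > 0" by (simp add: N_def)
    define a b :: "real^2" where "a = axis 1 (1 / N)" and "b = axis 2 (1 / N)"
    have ab: "x $ 1 *\<^sub>R a + x $ 2 *\<^sub>R b = (1 / N) *\<^sub>R x" for x
      by (simp add: vec_eq_iff forall_2 a_def b_def axis_def)
    have c: "cross2 a b = 1 / N ^ 2"
      by (simp add: cross2_eq a_def b_def axis_def power2_eq_square)
    have e: "ennreal (exp ((N *\<^sub>R \<xi>) \<bullet> (v + (1 / N) *\<^sub>R x))) = ennreal (exp (N * (\<xi> \<bullet> v))) * ennreal (exp (\<xi> \<bullet> x))" for x
      using N by (simp add: inner_add_right exp_add ennreal_mult)
    have "lap P (N *\<^sub>R \<xi>) = ennreal \<bar>cross2 a b\<bar> * (\<integral>\<^sup>+x. indicator P (v + ((x::real^2) $ 1 *\<^sub>R a + x $ 2 *\<^sub>R b)) *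
        ennreal (exp ((N *\<^sub>R \<xi>) \<bullet> (v + (x $ 1 *\<^sub>R a + x $ 2 *\<^sub>R b)))) \<partial>lborel)"
      unfolding lap_def by (rule nn_integral_affine_plane) (use N c in auto)
    also have "\<dots> = ennreal (1 / N ^ 2) * (\<integral>\<^sup>+x. ennreal (exp (N * (\<xi> \<bullet> v))) * (indicator (Q n) x * ennreal (exp (\<xi> \<bullet> x))) \<partial>lborel)"
    proof -
      have "indicator P (v + (1 / N) *\<^sub>R x) = (indicator (Q n) x :: ennreal)" for x
        by (simp add: Q_def indicator_def N_def)
      then show ?thesis unfolding ab c e using N by (simp add: mult_ac)
    qed
    also have "\<dots> = ennreal (1 / N ^ 2) * (ennreal (exp (N * (\<xi> \<bullet> v))) * lap (Q n) \<xi>)"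
      unfolding lap_def by (subst nn_integral_cmult) auto
    finally have "ennreal (N ^ 2 * exp (- (N * (\<xi> \<bullet> v)))) * lap P (N *\<^sub>R \<xi>)
        = ennreal (N ^ 2 * exp (- (N * (\<xi> \<bullet> v))) * (1 / N ^ 2) * exp (N * (\<xi> \<bullet> v))) * lap (Q n) \<xi>"
      using N by (simp add: ennreal_mult3)
    also have "N ^ 2 * exp (- (N * (\<xi> \<bullet> v))) * (1 / N ^ 2) * exp (N * (\<xi> \<bullet> v)) = 1"
      using N by (simp flip: exp_add)
    finally show ?thesis by (simp add: N_def)
  qed
  have mono: "Q m \<subseteq> Q n" if "m \<le> n" for m n
  proof
    fix z assume "z \<in> Q m"
    then have z: "v + (1 / real (Suc m)) *\<^sub>R z \<in> P" by (simp add: Q_def)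
    define k where "k = real (Suc m) / real (Suc n)"
    have k: "0 \<le> k" "0 \<le> 1 - k" "1 - k + k = 1" using that by (auto simp: k_def)
    have "(1 - k) *\<^sub>R v + k *\<^sub>R (v + (1 / real (Suc m)) *\<^sub>R z) \<in> P"
      using convexD[OF P(2) v z k(2,1,3)] .
    also have "(1 - k) *\<^sub>R v + k *\<^sub>R (v + (1 / real (Suc m)) *\<^sub>R z) = v + (k / real (Suc m)) *\<^sub>R z"
      by (simp add: algebra_simps)
    also have "k / real (Suc m) = 1 / real (Suc n)" by (simp add: k_def del: of_nat_Suc)
    finally show "z \<in> Q n" by (simp add: Q_def)
  qed
  have union: "(\<Union>n. Q n) = tcone P v"
  proof (intro equalityI subsetI)
    fix z assume "z \<in> (\<Union>n. Q n)"
    then obtain n where "v + (1 / real (Suc n)) *\<^sub>R z \<in> P" by (auto simp: Q_def)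
    then have "real (Suc n) *\<^sub>R (v + (1 / real (Suc n)) *\<^sub>R z - v) \<in> tcone P v" by (rule tconeI) simp
    then show "z \<in> tcone P v" by (simp del: of_nat_Suc)
  next
    fix z assume "z \<in> tcone P v"
    then obtain m y where z: "z = m *\<^sub>R (y - v)" "y \<in> P" "m \<ge> 0" by (auto simp: tcone_def)
    obtain n where n: "m < real n" using reals_Archimedean2 by blast
    define k where "k = m / real (Suc n)"
    have k: "0 \<le> k" "0 \<le> 1 - k" "1 - k + k = 1" using n z by (auto simp: k_def)
    have "(1 - k) *\<^sub>R v + k *\<^sub>R y \<in> P" using convexD[OF P(2) v z(2) k(2,1,3)] .
    also have "(1 - k) *\<^sub>R v + k *\<^sub>R y = v + (1 / real (Suc n)) *\<^sub>R z"
      unfolding z(1) by (simp add: k_def algebra_simps)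
    finally show "z \<in> (\<Union>n. Q n)" by (auto simp: Q_def)
  qed
  have ind_mono: "indicator (Q m) x \<le> (indicator (Q n) x :: ennreal)" if "m \<le> n" for m n x
    using mono[OF that] by (auto simp: indicator_def)
  have inc: "incseq (\<lambda>n x. indicator (Q n) x * ennreal (exp (\<xi> \<bullet> x)))"
    unfolding incseq_def le_fun_def by (intro allI impI mult_right_mono ind_mono) auto
  have "lap (tcone P v) \<xi> = (\<integral>\<^sup>+x. (SUP n. indicator (Q n) x * ennreal (exp (\<xi> \<bullet> x))) \<partial>lborel)"
    unfolding lap_def union[symmetric]
  proof (intro nn_integral_cong)
    fix x
    show "indicator (\<Union>n. Q n) x * ennreal (exp (\<xi> \<bullet> x)) = (SUP n. indicator (Q n) x * ennreal (exp (\<xi> \<bullet> x)))"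
    proof (cases "x \<in> (\<Union>n. Q n)")
      case True
      then obtain n where "x \<in> Q n" by auto
      then have "(SUP n. indicator (Q n) x * ennreal (exp (\<xi> \<bullet> x))) = ennreal (exp (\<xi> \<bullet> x))"
        by (intro antisym SUP_least SUP_upper2[of n]) (auto simp: indicator_def)
      then show ?thesis using True by simp
    qed (auto simp: indicator_def)
  qed
  also have "\<dots> = (SUP n. lap (Q n) \<xi>)"
    unfolding lap_def by (rule nn_integral_monotone_convergence_SUP[OF inc]) measurable
  finally have sup: "lap (tcone P v) \<xi> = (SUP n. lap (Q n) \<xi>)" .
  have "incseq (\<lambda>n. lap (Q n) \<xi>)"
    unfolding lap_def incseq_def
    by (intro allI impI nn_integral_mono mult_right_mono ind_mono) auto
  then show ?thesis
    unfolding eq sup by (rule LIMSEQ_SUP)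
qed

text \<open>Stretching only the direction normal to the edge makes P look like the half-strip over
  the edge, where the exponential weight, normalised to mass 1 in the normal direction, leaves the
  edge length. The stretched sets need not increase with n, so dominated convergence replaces
  monotone convergence. For l = 0 the limit is 0.\<close>

lemma lap_edge_limit:
  assumes P: "convex_polygon P" and u: "u \<noteq> 0" and l: "l \<ge> 0"
    and F: "face_in u P = {p + s *\<^sub>R rot u | s. 0 \<le> s \<and> s \<le> l}"
  shows "(\<lambda>n. ennreal (real (Suc n) * exp (- (real (Suc n) * (u \<bullet> p)))) * lap P (real (Suc n) *\<^sub>R u)) \<longlonglongrightarrow> ennreal l"
proof -
  have [measurable]: "P \<in> sets borel" using convex_polygonD(3)[OF P] by simp
  define U where "U = u \<bullet> u"
  have U: "U > 0" using u by (simp add: U_def)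
  define h where "h n x = indicator P (p + (x $ 1 *\<^sub>R rot u - (x $ 2 / real (Suc n)) *\<^sub>R u)) * ennreal (U * exp (- U * x $ 2))"
    for n and x :: "real^2"
  have eq: "ennreal (real (Suc n) * exp (- (real (Suc n) * (u \<bullet> p)))) * lap P (real (Suc n) *\<^sub>R u)
      = (\<integral>\<^sup>+x. h n x \<partial>lborel)" for n
  proof -
    define N where "N = real (Suc n)"
    have N: "N > 0" by (simp add: N_def)
    \<comment> \<open>The inward normal shrinks with N, while the edge direction keeps its
      scale.\<close>
    define b where "b = - (1 / N) *\<^sub>R u"
    have c: "cross2 (rot u) b = U / N"
      by (simp add: cross2_eq b_def U_def inner2 add_divide_distrib)
    have ab: "x $ 1 *\<^sub>R rot u + x $ 2 *\<^sub>R b = x $ 1 *\<^sub>R rot u - (x $ 2 / N) *\<^sub>R u" for x :: "real^2"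
      by (simp add: b_def)
    have e: "ennreal (exp ((N *\<^sub>R u) \<bullet> (p + (s *\<^sub>R rot u - (t / N) *\<^sub>R u)))) = ennreal (exp (N * (u \<bullet> p))) * ennreal (exp (- U * t))" for s t
    proof -
      have "(N *\<^sub>R u) \<bullet> (p + (s *\<^sub>R rot u - (t / N) *\<^sub>R u)) = N * (u \<bullet> p) + - U * t"
        using N by (simp add: inner_add_right inner_diff_right U_def algebra_simps)
      then show ?thesis by (simp only: exp_add) (simp add: ennreal_mult)
    qed
    have "lap P (N *\<^sub>R u) = ennreal \<bar>cross2 (rot u) b\<bar> * (\<integral>\<^sup>+x. indicator P (p + ((x::real^2) $ 1 *\<^sub>R rot u + x $ 2 *\<^sub>R b)) *
        ennreal (exp ((N *\<^sub>R u) \<bullet> (p + (x $ 1 *\<^sub>R rot u + x $ 2 *\<^sub>R b)))) \<partial>lborel)"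
      unfolding lap_def by (rule nn_integral_affine_plane) (use N c U in auto)
    also have "\<dots> = ennreal (U / N) * (\<integral>\<^sup>+x. ennreal (exp (N * (u \<bullet> p)) / U) * h n x \<partial>lborel)"
    proof (rule arg_cong2[where f = "(*)"], goal_cases)
      case 1 show ?case using c U N by simp
    next
      case 2 show ?case
      proof (rule nn_integral_cong)
      fix x :: "real^2"
      have "ennreal (exp (N * (u \<bullet> p)) / U) * ennreal (U * exp (- U * x $ 2)) = ennreal (exp (N * (u \<bullet> p))) * ennreal (exp (- U * x $ 2))"
        using U by (simp flip: ennreal_mult)
      then show "indicator P (p + ((x::real^2) $ 1 *\<^sub>R rot u + x $ 2 *\<^sub>R b)) * ennreal (exp ((N *\<^sub>R u) \<bullet> (p + (x $ 1 *\<^sub>R rot u + x $ 2 *\<^sub>R b))))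
          = ennreal (exp (N * (u \<bullet> p)) / U) * h n x"
        unfolding ab e h_def N_def[symmetric] by (simp only: mult.left_commute[of "ennreal (exp (N * (u \<bullet> p)) / U)"])
    qed
    qed
    also have "\<dots> = ennreal (U / N) * (ennreal (exp (N * (u \<bullet> p)) / U) * (\<integral>\<^sup>+x. h n x \<partial>lborel))"
      unfolding h_def by (subst nn_integral_cmult) auto
    finally have "ennreal (N * exp (- (N * (u \<bullet> p)))) * lap P (N *\<^sub>R u)
       = ennreal (N * exp (- (N * (u \<bullet> p))) * (U / N) * (exp (N * (u \<bullet> p)) / U)) * (\<integral>\<^sup>+x. h n x \<partial>lborel)"
      using U N by (simp add: ennreal_mult3)
    also have "N * exp (- (N * (u \<bullet> p))) * (U / N) * (exp (N * (u \<bullet> p)) / U) = 1"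
      using U N by (simp flip: exp_add)
    finally show ?thesis by (simp add: N_def)
  qed
  have le: "u \<bullet> y \<le> u \<bullet> p" if "y \<in> P" for y
  proof -
    have "p + 0 *\<^sub>R rot u \<in> face_in u P" unfolding F using l by blast
    then show ?thesis using that by (simp add: face_in_def)
  qed
  obtain B where B: "\<And>x. x \<in> P \<Longrightarrow> norm x \<le> B" using convex_polygonD(4)[OF P] by (auto simp: bounded_iff)
  \<comment> \<open>By Cauchy-Schwarz, R bounds the coordinate along \<open>rot u\<close> of every
    point of P relative to p; this gives an integrable majorant independent of n.\<close>
  define R where "R = (B + norm p) * norm u / U"
  define w where "w x = indicator {-R..R} (x $ 1) * (ennreal (U * exp (- U * x $ 2)) * indicator {0..} (x $ 2))" for x :: "real^2"
  have bound: "h n x \<le> w x" for n x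
  proof (cases "p + (x $ 1 *\<^sub>R rot u - (x $ 2 / real (Suc n)) *\<^sub>R u) \<in> P")
    case True
    define y where "y = p + (x $ 1 *\<^sub>R rot u - (x $ 2 / real (Suc n)) *\<^sub>R u)"
    have y: "y \<in> P" using True by (simp add: y_def)
    have "u \<bullet> y = u \<bullet> p - (x $ 2 / real (Suc n)) * U"
      by (simp add: y_def inner_add_right inner_diff_right U_def)
    then have "0 \<le> (x $ 2 / real (Suc n)) * U" using le[OF y] by simp
    then have x2: "x $ 2 \<ge> 0" using U by (simp add: zero_le_mult_iff zero_le_divide_iff)
    have "rot u \<bullet> (y - p) = x $ 1 * U" by (simp add: y_def inner_diff_right U_def)
    moreover have "\<bar>rot u \<bullet> (y - p)\<bar> \<le> norm (rot u) * norm (y - p)" by (rule Cauchy_Schwarz_ineq2)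
    moreover have "norm (rot u) = norm u" by (simp add: norm_eq_sqrt_inner)
    moreover have "norm (y - p) \<le> B + norm p" using norm_triangle_ineq4[of y p] B[OF y] by simp
    ultimately have "\<bar>x $ 1 * U\<bar> \<le> norm u * norm (y - p)" "norm u * norm (y - p) \<le> norm u * (B + norm p)"
      by (auto intro: mult_left_mono)
    then have "\<bar>x $ 1\<bar> * U \<le> norm u * (B + norm p)" using U by (simp add: abs_mult)
    then have "\<bar>x $ 1\<bar> \<le> R" using U by (simp add: R_def pos_le_divide_eq mult.commute)
    then have "x $ 1 \<in> {-R..R}" by auto
    then show ?thesis using x2 by (simp add: h_def w_def indicator_def)
  qed (simp add: h_def)
  have int_exp: "(\<integral>\<^sup>+t. ennreal (U * exp (- U * t)) * indicator {0..} t \<partial>lborel) = 1"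
  proof -
    have "(\<integral>\<^sup>+t. ennreal (U * exp (- U * t)) * indicator {0..} t \<partial>lborel)
        = (\<integral>\<^sup>+t. ennreal U * (ennreal (exp (- U * t)) * indicator {0..} t) \<partial>lborel)"
      using U by (intro nn_integral_cong) (simp add: ennreal_mult mult_ac)
    also have "\<dots> = ennreal U * (\<integral>\<^sup>+t. ennreal (exp (- U * t)) * indicator {0..} t \<partial>lborel)"
      by (rule nn_integral_cmult) measurable
    also have "\<dots> = ennreal U * ennreal (- 1 / - U)"
      using nn_integral_exp_decay[of "- U"] U by simp
    also have "\<dots> = 1" using U by (simp flip: ennreal_mult)
    finally show ?thesis .
  qed
  have int: "(\<integral>\<^sup>+x. indicator A (x $ 1) * (ennreal (U * exp (- U * x $ 2)) * indicator {0..} (x $ 2)) \<partial>(lborel :: (real^2) measure))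
      = emeasure lborel A" if [measurable]: "A \<in> sets borel" for A :: "real set"
    by (subst nn_integral_product_plane) (simp_all add: int_exp[simplified])
  define h' where "h' x = indicator {0..l} (x $ 1) * (ennreal (U * exp (- U * x $ 2)) * indicator {0..} (x $ 2))" for x :: "real^2"
  \<comment> \<open>Over the two endpoints of the edge the indicators may fail to converge to the
    chosen limit, so these null lines are discarded.\<close>
  have AE_ne: "AE x in lborel. (x::real^2) $ 1 \<noteq> c" for c
  proof -
    have "negligible {x::real^2. x $ 1 = c}" using negligible_hyperplane[of "axis 1 1 :: real^2" c] by (simp add: inner_axis' )
    then have "AE x in lebesgue. (x::real^2) $ 1 \<noteq> c"
      by (intro AE_I'[of "{x::real^2. x $ 1 = c}"]) (auto simp: negligible_iff_null_sets)
    then show ?thesis by (simp add: AE_completion_iff)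
  qed
  have conv: "AE x in lborel. (\<lambda>n. h n x) \<longlonglongrightarrow> h' x"
    using AE_ne[of 0] AE_ne[of l]
  proof eventually_elim
    case (elim x)
    have lim: "(\<lambda>n. p + (x $ 1 *\<^sub>R rot u - (x $ 2 / real (Suc n)) *\<^sub>R u)) \<longlonglongrightarrow> p + (x $ 1 *\<^sub>R rot u - 0 *\<^sub>R u)"
    proof (intro tendsto_intros)
      show "(\<lambda>n. x $ 2 / real (Suc n)) \<longlonglongrightarrow> 0" by real_asymp
    qed
    have "eventually (\<lambda>n. h n x = h' x) sequentially"
    proof (cases "0 < x $ 1 \<and> x $ 1 < l \<and> 0 \<le> x $ 2")
      case True
      define q where "q = p + x $ 1 *\<^sub>R rot u"
      have q: "q \<in> face_in u P" unfolding F q_def using True by (intro CollectI exI[of _ "x $ 1"]) simp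
      define d where "d = min (x $ 1) (l - x $ 1)"
      have d: "d > 0" "d \<le> x $ 1" "d \<le> l - x $ 1" using True by (auto simp: d_def)
      have "q + d *\<^sub>R rot u = p + (x $ 1 + d) *\<^sub>R rot u" "q - d *\<^sub>R rot u = p + (x $ 1 - d) *\<^sub>R rot u"
        by (simp_all add: q_def algebra_simps)
      moreover have "p + (x $ 1 + d) *\<^sub>R rot u \<in> face_in u P"
        unfolding F using d True by (intro CollectI exI[of _ "x $ 1 + d"]) simp
      moreover have "p + (x $ 1 - d) *\<^sub>R rot u \<in> face_in u P"
        unfolding F using d True by (intro CollectI exI[of _ "x $ 1 - d"]) simp
      ultimately have "q + d *\<^sub>R rot u \<in> P" "q - d *\<^sub>R rot u \<in> P" by (auto simp: face_in_def)
      \<comment> \<open>At a relative interior point of the edge the cone is the whole half-plane,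
        so the segment from q straight inwards stays in P for a while.\<close>
      then have "tcone P q = {z. u \<bullet> z \<le> 0}" using tcone_edge[OF P u q d(1)] by simp
      then have "- (x $ 2) *\<^sub>R u \<in> tcone P q" using True by simp
      then obtain m y where my: "- (x $ 2) *\<^sub>R u = m *\<^sub>R (y - q)" "y \<in> P" "m \<ge> 0" by (auto simp: tcone_def)
      have "eventually (\<lambda>n. m < real (Suc n)) sequentially" by real_asymp
      then show ?thesis
      proof eventually_elim
        case (elim n)
        define k where "k = m / real (Suc n)"
        have k: "0 \<le> k" "0 \<le> 1 - k" "1 - k + k = 1" using elim my by (auto simp: k_def)
        have qP: "q \<in> P" using q by (simp add: face_in_def)
        have "(1 - k) *\<^sub>R q + k *\<^sub>R y \<in> P" using convexD[OF convex_polygonD(1)[OF P] qP my(2) k(2,1,3)] .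
        also have "(1 - k) *\<^sub>R q + k *\<^sub>R y = q + (1 / real (Suc n)) *\<^sub>R (m *\<^sub>R (y - q))"
          by (simp add: k_def algebra_simps)
        also have "\<dots> = p + (x $ 1 *\<^sub>R rot u - (x $ 2 / real (Suc n)) *\<^sub>R u)"
          unfolding my(1)[symmetric] by (simp add: q_def)
        finally show ?case using True by (simp add: h_def h'_def)
      qed
    next
      case False
      consider "x $ 2 < 0" | "x $ 2 \<ge> 0" "x $ 1 < 0 \<or> x $ 1 > l"
        using False elim by fastforce
      then show ?thesis
      proof cases
        case 1
        have "p + (x $ 1 *\<^sub>R rot u - (x $ 2 / real (Suc n)) *\<^sub>R u) \<notin> P" for n
        proof
          assume "p + (x $ 1 *\<^sub>R rot u - (x $ 2 / real (Suc n)) *\<^sub>R u) \<in> P"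
          from le[OF this] have "0 \<le> (x $ 2 / real (Suc n)) * U"
            by (simp add: inner_add_right inner_diff_right U_def)
          then show False using 1 U by (simp add: zero_le_mult_iff zero_le_divide_iff)
        qed
        then show ?thesis using 1 by (simp add: h_def h'_def)
      next
        case 2
        \<comment> \<open>Beyond the ends of the edge the limit point misses the closed set P, and
          so do all points close to it.\<close>
        have "p + x $ 1 *\<^sub>R rot u \<notin> P"
        proof
          assume "p + x $ 1 *\<^sub>R rot u \<in> P"
          then have "p + x $ 1 *\<^sub>R rot u \<in> face_in u P" using le by (simp add: face_in_def inner_add_right)
          then obtain s where "x $ 1 *\<^sub>R rot u = s *\<^sub>R rot u" "0 \<le> s" "s \<le> l" unfolding F by auto
          then show False using 2 u by simp
        qed
        then have "eventually (\<lambda>n. p + (x $ 1 *\<^sub>R rot u - (x $ 2 / real (Suc n)) *\<^sub>R u) \<in> - P) sequentially"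
          using topological_tendstoD[OF lim, of "- P"] convex_polygonD(3)[OF P] by auto
        then show ?thesis
          by eventually_elim (use 2 in \<open>auto simp: h_def h'_def\<close>)
      qed
    qed
    then show ?case by (rule tendsto_eventually)
  qed
  have "(\<lambda>n. \<integral>\<^sup>+x. h n x \<partial>lborel) \<longlonglongrightarrow> (\<integral>\<^sup>+x. h' x \<partial>lborel)"
  proof (rule nn_integral_dominated_convergence[where w = w])
    show "(\<integral>\<^sup>+x. w x \<partial>lborel) < \<infinity>" unfolding w_def by (subst int) (simp_all only: emeasure_lborel_Icc_eq, simp_all)
  next
    show "h n \<in> borel_measurable lborel" for n
      unfolding h_def[abs_def] by measurable
    show "h' \<in> borel_measurable lborel" "w \<in> borel_measurable lborel"
      unfolding h'_def[abs_def] w_def[abs_def] by measurable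
  qed (use bound conv in auto)
  also have "(\<integral>\<^sup>+x. h' x \<partial>lborel) = ennreal l" unfolding h'_def using l by (subst int) auto
  finally show ?thesis unfolding eq .
qed

lemma lap_convolution:
  assumes [measurable]: "K \<in> sets borel" "M \<in> sets borel"
  shows "lap K \<xi> * lap M \<xi> = (\<integral>\<^sup>+x. emeasure lborel (K \<inter> {y. x - y \<in> M}) * ennreal (exp (\<xi> \<bullet> x)) \<partial>lborel)"
proof -
  have [measurable]: "(\<lambda>(x, y). indicator K y * indicator M (x - y) * ennreal (exp (\<xi> \<bullet> x)))
      \<in> borel_measurable (lborel \<Otimes>\<^sub>M (lborel :: (real^2) measure))"
    by measurable
  have "(\<integral>\<^sup>+x. emeasure lborel (K \<inter> {y. x - y \<in> M}) * ennreal (exp (\<xi> \<bullet> x)) \<partial>lborel)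
     = (\<integral>\<^sup>+x. (\<integral>\<^sup>+y. indicator K y * indicator M (x - y) * ennreal (exp (\<xi> \<bullet> x)) \<partial>lborel) \<partial>lborel)"
  proof (intro nn_integral_cong)
    fix x
    have [measurable]: "K \<inter> {y. x - y \<in> M} \<in> sets borel" by measurable
    have "emeasure lborel (K \<inter> {y. x - y \<in> M}) * ennreal (exp (\<xi> \<bullet> x))
        = (\<integral>\<^sup>+y. indicator (K \<inter> {y. x - y \<in> M}) y * ennreal (exp (\<xi> \<bullet> x)) \<partial>lborel)"
      by (simp add: nn_integral_multc)
    also have "\<dots> = (\<integral>\<^sup>+y. indicator K y * indicator M (x - y) * ennreal (exp (\<xi> \<bullet> x)) \<partial>lborel)"
      by (intro nn_integral_cong) (auto simp: indicator_def)
    finally show "emeasure lborel (K \<inter> {y. x - y \<in> M}) * ennreal (exp (\<xi> \<bullet> x)) = \<dots>" .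
  qed
  also have "\<dots> = (\<integral>\<^sup>+y. (\<integral>\<^sup>+x. indicator K y * indicator M (x - y) * ennreal (exp (\<xi> \<bullet> x)) \<partial>lborel) \<partial>lborel)"
    by (rule lborel_pair.Fubini') measurable
  also have "\<dots> = (\<integral>\<^sup>+y. indicator K y * ennreal (exp (\<xi> \<bullet> y)) * lap M \<xi> \<partial>lborel)"
  proof (intro nn_integral_cong)
    fix y
    have "(\<integral>\<^sup>+x. indicator K y * indicator M (x - y) * ennreal (exp (\<xi> \<bullet> x)) \<partial>lborel)
       = (\<integral>\<^sup>+x. indicator K y * indicator M (y + x - y) * ennreal (exp (\<xi> \<bullet> (y + x))) \<partial>lborel)"
      by (rule nn_integral_lborel_translate[symmetric]) measurable
    also have "\<dots> = (\<integral>\<^sup>+x. (indicator K y * ennreal (exp (\<xi> \<bullet> y))) * (indicator M x * ennreal (exp (\<xi> \<bullet> x))) \<partial>lborel)"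
      by (intro nn_integral_cong) (simp add: inner_add_right exp_add ennreal_mult mult_ac)
    also have "\<dots> = indicator K y * ennreal (exp (\<xi> \<bullet> y)) * lap M \<xi>"
      unfolding lap_def by (rule nn_integral_cmult) measurable
    finally show "(\<integral>\<^sup>+x. indicator K y * indicator M (x - y) * ennreal (exp (\<xi> \<bullet> x)) \<partial>lborel)
       = indicator K y * ennreal (exp (\<xi> \<bullet> y)) * lap M \<xi>" .
  qed
  also have "\<dots> = lap K \<xi> * lap M \<xi>"
    unfolding lap_def[of K] by (rule nn_integral_multc) measurable
  finally show ?thesis ..
qed

section \<open>Cones and edges determined by the convolution\<close>

text \<open>All that is retained of the equality of covariograms: the support and the transform of
  the convolution. In this form the two members of a pair, and the two pairs, are freely
  interchangeable.\<close>

definition same_convolution :: "(real^2) set \<Rightarrow> (real^2) set \<Rightarrow> (real^2) set \<Rightarrow> (real^2) set \<Rightarrow> bool" where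
  "same_convolution P Q P' Q' \<longleftrightarrow>
     convex_polygon P \<and> convex_polygon Q \<and> convex_polygon P' \<and> convex_polygon Q' \<and>
     P + Q = P' + Q' \<and> (\<forall>\<xi>. lap P \<xi> * lap Q \<xi> = lap P' \<xi> * lap Q' \<xi>)"

lemma same_convolution_swap:
  assumes "same_convolution P Q P' Q'"
  shows "same_convolution Q P P' Q'" "same_convolution P Q Q' P'" "same_convolution P' Q' P Q"
  using assms unfolding same_convolution_def by (simp_all add: add.commute mult.commute)

lemma exposed_sum_eq:
  assumes "same_convolution P Q P' Q'"
    and "exposes u P v" "exposes u Q w" "exposes u P' v'" "exposes u Q' w'"
  shows "v + w = v' + w'"
  using assms exposes_sum exposes_unique unfolding same_convolution_def by metis

lemma tcone_cross2_nonzero: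
  assumes P: "convex_polygon P" and "tcone P v = pos2 a b" "a \<noteq> 0"
  shows "cross2 a b \<noteq> 0"
proof
  assume c: "cross2 a b = 0"
  have "P \<subseteq> {x. rot a \<bullet> x = rot a \<bullet> v}"
  proof
    fix y assume "y \<in> P"
    then have "y - v \<in> pos2 a b" using diff_in_tcone assms(2) by blast
    then obtain s t where "y - v = s *\<^sub>R a + t *\<^sub>R b" by (auto simp: pos2_def)
    then have "cross2 a (y - v) = 0" using c by (simp del: cross2_diff)
    then show "y \<in> {x. rot a \<bullet> x = rot a \<bullet> v}" by (simp add: cross2_def inner_diff_right)
  qed
  then show False using convex_polygon_not_subset_hyperplane[OF P, of "rot a"] assms(3) by simp
qed

text \<open>The normalising factor of the product involves v and w only through
  \<open>v + w\<close>, which the sum of the polygons determines. It is therefore the same for both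
  pairs, and the limits agree; the cone transforms are finite, so limits may be multiplied in
  \<open>ennreal\<close>.\<close>

lemma lap_tcone_product:
  assumes S: "same_convolution P Q P' Q'"
    and ex: "exposes u P v" "exposes u Q w" "exposes u P' v'" "exposes u Q' w'"
  shows "lap (tcone P v) u * lap (tcone Q w) u = lap (tcone P' v') u * lap (tcone Q' w') u"
proof -
  have lim: "(\<lambda>n. ennreal (real (Suc n) ^ 4 * exp (- (real (Suc n) * (u \<bullet> (v + w))))) *
        (lap P (real (Suc n) *\<^sub>R u) * lap Q (real (Suc n) *\<^sub>R u)))
      \<longlonglongrightarrow> lap (tcone P v) u * lap (tcone Q w) u"
    if P: "convex_polygon P" and Q: "convex_polygon Q" and "exposes u P v" "exposes u Q w" for P Q v w
  proof -
    have fin: "lap (tcone P v) u \<noteq> top" if "convex_polygon P" "exposes u P v" for P v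
    proof -
      obtain a b where "tcone P v = pos2 a b" "u \<bullet> a < 0" "u \<bullet> b < 0" "cross2 a b > 0"
        using tcone_eq_pos2[OF \<open>convex_polygon P\<close> \<open>exposes u P v\<close>] .
      then show ?thesis by (simp add: lap_pos2)
    qed
    have eq: "ennreal (real (Suc n) ^ 4 * exp (- (real (Suc n) * (u \<bullet> (v + w))))) * (lap P (real (Suc n) *\<^sub>R u) * lap Q (real (Suc n) *\<^sub>R u))
      = (ennreal (real (Suc n) ^ 2 * exp (- (real (Suc n) * (u \<bullet> v)))) * lap P (real (Suc n) *\<^sub>R u)) *
        (ennreal (real (Suc n) ^ 2 * exp (- (real (Suc n) * (u \<bullet> w)))) * lap Q (real (Suc n) *\<^sub>R u))" for n
    proof -
      define N where "N = real (Suc n)"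
      have "N ^ 4 * exp (- (N * (u \<bullet> (v + w)))) = (N ^ 2 * exp (- (N * (u \<bullet> v)))) * (N ^ 2 * exp (- (N * (u \<bullet> w))))"
        by (simp add: inner_add_right algebra_simps exp_add exp_diff exp_minus field_simps flip: power_add)
      then have "ennreal (N ^ 4 * exp (- (N * (u \<bullet> (v + w))))) = ennreal (N ^ 2 * exp (- (N * (u \<bullet> v)))) * ennreal (N ^ 2 * exp (- (N * (u \<bullet> w))))"
        by (simp add: ennreal_mult)
      then show ?thesis unfolding N_def by (simp only: mult_ac)
    qed
    show ?thesis
      unfolding eq
    proof (rule tendsto_mult_ennreal)
      show "(\<lambda>n. ennreal (real (Suc n) ^ 2 * exp (- (real (Suc n) * (u \<bullet> v)))) * lap P (real (Suc n) *\<^sub>R u)) \<longlonglongrightarrow> lap (tcone P v) u"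
        using that convex_polygonD[OF P] by (intro lap_vertex_limit) (auto simp: exposes_def)
      show "(\<lambda>n. ennreal (real (Suc n) ^ 2 * exp (- (real (Suc n) * (u \<bullet> w)))) * lap Q (real (Suc n) *\<^sub>R u)) \<longlonglongrightarrow> lap (tcone Q w) u"
        using that convex_polygonD[OF Q] by (intro lap_vertex_limit) (auto simp: exposes_def)
    qed (use fin that in auto)
  qed
  have S': "convex_polygon P" "convex_polygon Q" "convex_polygon P'" "convex_polygon Q'"
    "\<And>\<xi>. lap P \<xi> * lap Q \<xi> = lap P' \<xi> * lap Q' \<xi>"
    using S by (auto simp: same_convolution_def)
  have "(\<lambda>n. ennreal (real (Suc n) ^ 4 * exp (- (real (Suc n) * (u \<bullet> (v + w))))) *
        (lap P (real (Suc n) *\<^sub>R u) * lap Q (real (Suc n) *\<^sub>R u)))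
      \<longlonglongrightarrow> lap (tcone P' v') u * lap (tcone Q' w') u"
    using lim[OF S'(3,4) ex(3,4)] unfolding exposed_sum_eq[OF S ex] S'(5) .
  then show ?thesis using lim[OF S'(1,2) ex(1,2)] LIMSEQ_unique by blast
qed

section \<open>Varying the direction: slopes of the rays and pairing of the cones\<close>

lemma inner_perturbed:
  assumes "u \<bullet> x < 0"
  shows "(u + z *\<^sub>R rot u) \<bullet> x = (u \<bullet> x) * (1 - z * slope u x)"
  using assms by (simp add: slope_def inner_add_left field_simps)

lemma lap_pos2_perturbed:
  assumes "cross2 a b \<noteq> 0" and neg: "u \<bullet> a < 0" "u \<bullet> b < 0"
    and z: "1 - z * slope u a > 0" "1 - z * slope u b > 0"
  shows "lap (pos2 a b) (u + z *\<^sub>R rot u) =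
    ennreal (\<bar>slope u a - slope u b\<bar> / ((u \<bullet> u) * ((1 - z * slope u a) * (1 - z * slope u b))))"
proof -
  have neg': "(u + z *\<^sub>R rot u) \<bullet> a < 0" "(u + z *\<^sub>R rot u) \<bullet> b < 0"
    using neg z by (simp_all add: inner_perturbed mult_neg_pos)
  have U: "u \<bullet> u > 0" using neg by auto
  have ab: "(u \<bullet> a) * (u \<bullet> b) > 0" using neg by (simp add: mult_neg_neg)
  have "(u \<bullet> u) * \<bar>cross2 a b\<bar> = \<bar>(u \<bullet> u) * cross2 a b\<bar>" using U by (simp add: abs_mult)
  also have "\<dots> = (u \<bullet> a) * (u \<bullet> b) * \<bar>slope u a - slope u b\<bar>"
    using ab by (simp only: slope_cross2[OF neg] abs_mult[of "_ * _" "_ - _"] abs_of_pos)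
  finally have c: "\<bar>cross2 a b\<bar> = (u \<bullet> a) * (u \<bullet> b) * \<bar>slope u a - slope u b\<bar> / (u \<bullet> u)"
    using U by (simp add: field_simps)
  have "\<bar>cross2 a b\<bar> / (((u + z *\<^sub>R rot u) \<bullet> a) * ((u + z *\<^sub>R rot u) \<bullet> b))
    = \<bar>slope u a - slope u b\<bar> / ((u \<bullet> u) * ((1 - z * slope u a) * (1 - z * slope u b)))"
    unfolding inner_perturbed[OF neg(1)] inner_perturbed[OF neg(2)] c using neg by simp
  then show ?thesis using lap_pos2[OF assms(1) neg'] by simp
qed

text \<open>Small rotations of u keep the same four vertices exposed, so the product formula holds
  for all small z and reads D / F(z) = D' / F'(z) with F(0) = F'(0) = 1. Setting z = 0 yields the
  products of interval lengths; after cancelling D, the factors of F yield the slopes.\<close>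

lemma cone_slopes_eq:
  assumes S: "same_convolution P Q P' Q'"
    and mem: "v \<in> P" "w \<in> Q" "v' \<in> P'" "w' \<in> Q'"
    and cones: "tcone P v = pos2 a b" "tcone Q w = pos2 c d" "tcone P' v' = pos2 a' b'" "tcone Q' w' = pos2 c' d'"
    and neg: "u \<bullet> a < 0" "u \<bullet> b < 0" "u \<bullet> c < 0" "u \<bullet> d < 0" "u \<bullet> a' < 0" "u \<bullet> b' < 0" "u \<bullet> c' < 0" "u \<bullet> d' < 0"
  shows "{#slope u a, slope u b, slope u c, slope u d#} = {#slope u a', slope u b', slope u c', slope u d'#}"
    and "\<bar>slope u a - slope u b\<bar> * \<bar>slope u c - slope u d\<bar> = \<bar>slope u a' - slope u b'\<bar> * \<bar>slope u c' - slope u d'\<bar>"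
proof -
  let ?s = "slope u"
  have cp: "convex_polygon P" "convex_polygon Q" "convex_polygon P'" "convex_polygon Q'"
    using S by (auto simp: same_convolution_def)
  have nz: "a \<noteq> 0" "c \<noteq> 0" "a' \<noteq> 0" "c' \<noteq> 0" using neg by auto
  note cr = tcone_cross2_nonzero[OF cp(1) cones(1) nz(1)] tcone_cross2_nonzero[OF cp(2) cones(2) nz(2)]
    tcone_cross2_nonzero[OF cp(3) cones(3) nz(3)] tcone_cross2_nonzero[OF cp(4) cones(4) nz(4)]
  have U: "u \<bullet> u > 0" using neg by auto
  define D where "D = \<bar>?s a - ?s b\<bar> * \<bar>?s c - ?s d\<bar>"
  define D' where "D' = \<bar>?s a' - ?s b'\<bar> * \<bar>?s c' - ?s d'\<bar>"
  define F where "F z = (1 - z * ?s a) * (1 - z * ?s b) * ((1 - z * ?s c) * (1 - z * ?s d))" for z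
  define F' where "F' z = (1 - z * ?s a') * (1 - z * ?s b') * ((1 - z * ?s c') * (1 - z * ?s d'))" for z
  \<comment> \<open>Positivity of all factors \<open>1 - z * slope u x\<close> means precisely that
    the perturbed direction is still negative on every ray.\<close>
  have key: "D * F' z = D' * F z"
    if z: "\<forall>x\<in>{a, b, c, d, a', b', c', d'}. 1 - z * ?s x > 0" for z
  proof -
    define \<xi> where "\<xi> = u + z *\<^sub>R rot u"
    have neg': "\<xi> \<bullet> x < 0" if "x \<in> {a, b, c, d, a', b', c', d'}" for x
    proof -
      have "u \<bullet> x < 0" using that neg by auto
      moreover have "1 - z * ?s x > 0" using z that by blast
      ultimately show ?thesis by (simp add: \<xi>_def inner_perturbed mult_neg_pos)
    qed
    have "exposes \<xi> P v" "exposes \<xi> Q w" "exposes \<xi> P' v'" "exposes \<xi> Q' w'"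
      using mem cones neg' by (auto intro!: exposes_of_tcone)
    then have "lap (pos2 a b) \<xi> * lap (pos2 c d) \<xi> = lap (pos2 a' b') \<xi> * lap (pos2 c' d') \<xi>"
      using lap_tcone_product[OF S] cones by metis
    moreover define A where "A = \<bar>?s a - ?s b\<bar> / ((u \<bullet> u) * ((1 - z * ?s a) * (1 - z * ?s b)))"
    moreover define B where "B = \<bar>?s c - ?s d\<bar> / ((u \<bullet> u) * ((1 - z * ?s c) * (1 - z * ?s d)))"
    moreover define A' where "A' = \<bar>?s a' - ?s b'\<bar> / ((u \<bullet> u) * ((1 - z * ?s a') * (1 - z * ?s b')))"
    moreover define B' where "B' = \<bar>?s c' - ?s d'\<bar> / ((u \<bullet> u) * ((1 - z * ?s c') * (1 - z * ?s d')))"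
    ultimately have "ennreal A * ennreal B = ennreal A' * ennreal B'"
      using z neg cr unfolding \<xi>_def by (simp add: lap_pos2_perturbed)
    moreover have "A \<ge> 0" "B \<ge> 0" "A' \<ge> 0" "B' \<ge> 0"
      using z U by (auto simp: A_def B_def A'_def B'_def intro!: divide_nonneg_nonneg mult_nonneg_nonneg)
    ultimately have "A * B = A' * B'" by (simp flip: ennreal_mult)
    moreover have "F z > 0" "F' z > 0" using z by (simp_all add: F_def F'_def)
    moreover have "A * B = D / ((u \<bullet> u) ^ 2 * F z)" "A' * B' = D' / ((u \<bullet> u) ^ 2 * F' z)"
      by (simp_all add: A_def B_def A'_def B'_def D_def D'_def F_def F'_def power2_eq_square mult_ac)
    ultimately show ?thesis using U by (simp add: field_simps)
  qed
  have DD: "D = D'" using key[of 0] by (simp add: F_def F'_def)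
  then show "\<bar>?s a - ?s b\<bar> * \<bar>?s c - ?s d\<bar> = \<bar>?s a' - ?s b'\<bar> * \<bar>?s c' - ?s d'\<bar>" by (simp add: D_def D'_def)
  have "?s a \<noteq> ?s b" "?s c \<noteq> ?s d"
    using slope_cross2[OF neg(1,2)] slope_cross2[OF neg(3,4)] cr U by auto
  then have "D \<noteq> 0" by (simp add: D_def)
  have "eventually (\<lambda>z. \<forall>x\<in>{a, b, c, d, a', b', c', d'}. 1 - z * ?s x > 0) (nhds 0)"
  proof (rule eventually_ball_finite)
    show "\<forall>x\<in>{a, b, c, d, a', b', c', d'}. eventually (\<lambda>z. 1 - z * ?s x > 0) (nhds 0)"
    proof
      fix x
      have "((\<lambda>z. 1 - z * ?s x) \<longlongrightarrow> 1 - 0 * ?s x) (nhds 0)" by (intro tendsto_intros filterlim_ident)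
      then show "eventually (\<lambda>z. 1 - z * ?s x > 0) (nhds 0)" by (rule order_tendstoD) simp
    qed
  qed simp
  then obtain e where e: "e > 0"
    "\<And>z. \<bar>z\<bar> < e \<Longrightarrow> \<forall>x\<in>{a, b, c, d, a', b', c', d'}. 1 - z * ?s x > 0"
    unfolding eventually_nhds_metric by (auto simp: dist_real_def)
  show "{#?s a, ?s b, ?s c, ?s d#} = {#?s a', ?s b', ?s c', ?s d'#}"
  proof (rule linear_factor_mset_eq[OF e(1)])
    fix z :: real assume "\<bar>z\<bar> < e"
    then have "D * F' z = D * F z" using key e(2) DD by simp
    then have "F' z = F z" using \<open>D \<noteq> 0\<close> by simp
    then show "(\<Prod>s\<in>#{#?s a, ?s b, ?s c, ?s d#}. 1 - z * s) = (\<Prod>s\<in>#{#?s a', ?s b', ?s c', ?s d'#}. 1 - z * s)"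
      by (simp add: F_def F'_def mult_ac)
  qed simp
qed

text \<open>Counterclockwise order inside an open half-plane.\<close>

definition ordered4 :: "real^2 \<Rightarrow> real^2 \<Rightarrow> real^2 \<Rightarrow> real^2 \<Rightarrow> bool" where
  "ordered4 a b c d \<longleftrightarrow> cross2 a b > 0 \<and> cross2 a c > 0 \<and> cross2 a d > 0 \<and>
     cross2 b c > 0 \<and> cross2 b d > 0 \<and> cross2 c d > 0"

text \<open>The ambiguous configuration: the same four rays distributed as ab | cd and as ad | bc.
  It is kept apart from harmonicity because it is this part that the walk along the boundaries
  transports.\<close>

definition crossed_cones ::
  "(real^2) set \<Rightarrow> (real^2) set \<Rightarrow> (real^2) set \<Rightarrow> (real^2) set \<Rightarrow> real^2 \<Rightarrow> real^2 \<Rightarrow> real^2 \<Rightarrow> real^2 \<Rightarrow>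
    real^2 \<Rightarrow> real^2 \<Rightarrow> real^2 \<Rightarrow> real^2 \<Rightarrow> bool" where
  "crossed_cones P Q P' Q' v w v' w' a b c d \<longleftrightarrow> ordered4 a b c d \<and>
     v \<in> P \<and> w \<in> Q \<and> v' \<in> P' \<and> w' \<in> Q' \<and>
     tcone P v = pos2 a b \<and> tcone Q w = pos2 c d \<and> tcone P' v' = pos2 a d \<and> tcone Q' w' = pos2 b c"

text \<open>Cross-ratio -1: with \<open>cross2 c b\<close> for \<open>cross2 b c\<close> the two
  products are opposite, so a, c separate b, d harmonically.\<close>

definition harmonic :: "real^2 \<Rightarrow> real^2 \<Rightarrow> real^2 \<Rightarrow> real^2 \<Rightarrow> bool" where
  "harmonic a b c d \<longleftrightarrow> cross2 a b * cross2 c d = cross2 a d * cross2 b c"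

definition exceptional_vertex ::
  "(real^2) set \<Rightarrow> (real^2) set \<Rightarrow> (real^2) set \<Rightarrow> (real^2) set \<Rightarrow> bool" where
  "exceptional_vertex P Q P' Q' \<longleftrightarrow>
     (\<exists>v w v' w' a b c d. crossed_cones P Q P' Q' v w v' w' a b c d \<and> harmonic a b c d)"

text \<open>Cones are translated into slope intervals, the combinatorial lemma is applied, and the
  harmonic case is translated back. That lemma speaks of unordered pairs of intervals, hence the
  relabelled polygons A, B, A', B'.\<close>

lemma cone_dichotomy:
  assumes S: "same_convolution P Q P' Q'"
    and ex: "exposes u P v" "exposes u Q w" "exposes u P' v'" "exposes u Q' w'"
  shows "{tcone P v, tcone Q w} = {tcone P' v', tcone Q' w'} \<or>
    (\<exists>A B A' B'. ((A, B) = (P, Q) \<or> (A, B) = (Q, P)) \<and> ((A', B') = (P', Q') \<or> (A', B') = (Q', P')) \<and>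
      (exceptional_vertex A B A' B' \<or> exceptional_vertex A' B' A B))"
proof -
  have cp: "convex_polygon P" "convex_polygon Q" "convex_polygon P'" "convex_polygon Q'"
    using S by (auto simp: same_convolution_def)
  have mem: "v \<in> P" "w \<in> Q" "v' \<in> P'" "w' \<in> Q'" using ex by (auto simp: exposes_def)
  obtain a b where ab: "tcone P v = pos2 a b" "u \<bullet> a < 0" "u \<bullet> b < 0" "cross2 a b > 0"
    using tcone_eq_pos2[OF cp(1) ex(1)] .
  obtain c d where cd: "tcone Q w = pos2 c d" "u \<bullet> c < 0" "u \<bullet> d < 0" "cross2 c d > 0"
    using tcone_eq_pos2[OF cp(2) ex(2)] .
  obtain a' b' where ab': "tcone P' v' = pos2 a' b'" "u \<bullet> a' < 0" "u \<bullet> b' < 0" "cross2 a' b' > 0"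
    using tcone_eq_pos2[OF cp(3) ex(3)] .
  obtain c' d' where cd': "tcone Q' w' = pos2 c' d'" "u \<bullet> c' < 0" "u \<bullet> d' < 0" "cross2 c' d' > 0"
    using tcone_eq_pos2[OF cp(4) ex(4)] .
  have u0: "u \<noteq> 0" using ab by auto
  then have U: "u \<bullet> u > 0" by simp
  let ?s = "slope u"
  have lt: "?s b < ?s a" "?s d < ?s c" "?s b' < ?s a'" "?s d' < ?s c'"
    using ab cd ab' cd' slope_less_iff by blast+
  \<comment> \<open>The representative of the ray of slope s, normalised to
    \<open>u \<bullet> e s = - (u \<bullet> u)\<close>.\<close>
  define e where "e s = s *\<^sub>R rot u - u" for s
  have e_neg: "u \<bullet> e s < 0" for s using U by (simp add: e_def inner_diff_right)
  have e_slope: "?s (e s) = s" for s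
    using U by (simp add: slope_def e_def inner_diff_right)
  have e_cross: "cross2 (e s) (e t) = (u \<bullet> u) * (s - t)" for s t
    by (simp add: e_def cross2_eq inner2 algebra_simps)
  \<comment> \<open>The cone over a slope interval; its upper end comes first because slopes
    decrease counterclockwise.\<close>
  define C where "C = (\<lambda>(p, q). pos2 (e q) (e p))"
  have cone_C: "pos2 x y = C (?s y, ?s x)" if "u \<bullet> x < 0" "u \<bullet> y < 0" for x y
    unfolding C_def prod.case by (rule pos2_slope_cong[where u = u]) (simp_all add: that e_neg e_slope)
  have CP: "tcone P v = C (?s b, ?s a)" and CQ: "tcone Q w = C (?s d, ?s c)"
    and CP': "tcone P' v' = C (?s b', ?s a')" and CQ': "tcone Q' w' = C (?s d', ?s c')"
    using ab cd ab' cd' cone_C by auto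
  note sl = cone_slopes_eq[OF S mem ab(1) cd(1) ab'(1) cd'(1) ab(2,3) cd(2,3) ab'(2,3) cd'(2,3)]
  have ms: "{#?s b, ?s a, ?s d, ?s c#} = {#?s b', ?s a', ?s d', ?s c'#}"
    using sl(1) by (simp add: add_mset_commute)
  have pr: "(?s a - ?s b) * (?s c - ?s d) = (?s a' - ?s b') * (?s c' - ?s d')"
    using sl(2) lt by simp
  \<comment> \<open>Stated for arbitrary polygons so that it also serves when the primed pair
    carries the disjoint intervals.\<close>
  have exc: "\<exists>A B A' B'. ((A, B) = (P, Q) \<or> (A, B) = (Q, P)) \<and> ((A', B') = (P', Q') \<or> (A', B') = (Q', P')) \<and>
      exceptional_vertex A B A' B'"
    if S: "v \<in> P" "w \<in> Q" "v' \<in> P'" "w' \<in> Q'"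
      and CP: "tcone P v = C x" and CQ: "tcone Q w = C y"
      and CP': "tcone P' v' = C x'" and CQ': "tcone Q' w' = C y'"
      and s: "s1 < s2" "s2 < s3" "s3 < s4" "(s2 - s1) * (s4 - s3) = (s4 - s1) * (s3 - s2)"
      and xy: "{x, y} = {(s1, s2), (s3, s4)}" "{x', y'} = {(s1, s4), (s2, s3)}"
    for P Q P' Q' v w v' w' x y x' y' s1 s2 s3 s4
  proof -
    have o: "ordered4 (e s4) (e s3) (e s2) (e s1)"
      using s U by (simp add: ordered4_def e_cross)
    have h: "harmonic (e s4) (e s3) (e s2) (e s1)"
      unfolding harmonic_def e_cross
      using arg_cong[OF s(4), of "\<lambda>t. (u \<bullet> u) * (u \<bullet> u) * t"] by (simp only: mult_ac)
    obtain A B p q where AB: "(A, B) = (P, Q) \<or> (A, B) = (Q, P)" "p \<in> A" "q \<in> B"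
        "tcone A p = pos2 (e s4) (e s3)" "tcone B q = pos2 (e s2) (e s1)"
      using xy(1) CP CQ S by (auto simp: C_def doubleton_eq_iff)
    obtain A' B' p' q' where AB': "(A', B') = (P', Q') \<or> (A', B') = (Q', P')" "p' \<in> A'" "q' \<in> B'"
        "tcone A' p' = pos2 (e s4) (e s1)" "tcone B' q' = pos2 (e s3) (e s2)"
      using xy(2) CP' CQ' S by (auto simp: C_def doubleton_eq_iff)
    have "exceptional_vertex A B A' B'"
      unfolding exceptional_vertex_def crossed_cones_def using o h AB AB' by blast
    then show ?thesis using AB(1) AB'(1) by blast
  qed
  from cone_pair_cases[OF lt ms pr] show ?thesis
  proof (elim disjE exE conjE)
    assume "{(?s b, ?s a), (?s d, ?s c)} = {(?s b', ?s a'), (?s d', ?s c')}"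
    then have "C ` {(?s b, ?s a), (?s d, ?s c)} = C ` {(?s b', ?s a'), (?s d', ?s c')}" by simp
    then show ?thesis using CP CQ CP' CQ' by simp
  next
    fix s1 s2 s3 s4 assume "s1 < s2" "s2 < s3" "s3 < s4" "(s2 - s1) * (s4 - s3) = (s4 - s1) * (s3 - s2)"
      "{(?s b, ?s a), (?s d, ?s c)} = {(s1, s2), (s3, s4)}" "{(?s b', ?s a'), (?s d', ?s c')} = {(s1, s4), (s2, s3)}"
    from exc[OF mem CP CQ CP' CQ' this] show ?thesis by blast
  next
    fix s1 s2 s3 s4 assume "s1 < s2" "s2 < s3" "s3 < s4" "(s2 - s1) * (s4 - s3) = (s4 - s1) * (s3 - s2)"
      "{(?s b, ?s a), (?s d, ?s c)} = {(s1, s4), (s2, s3)}" "{(?s b', ?s a'), (?s d', ?s c')} = {(s1, s2), (s3, s4)}"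
    from exc[OF mem(3,4,1,2) CP' CQ' CP CQ this(1-4,6,5)] show ?thesis by blast
  qed
qed

text \<open>Two numbers are determined up to order by their sum and product. Length 0 is included,
  so the face of some of the polygons may be a vertex.\<close>

lemma edge_lengths_eq:
  assumes S: "same_convolution P Q P' Q'" and u: "u \<noteq> 0"
    and l: "l \<ge> 0" "m \<ge> 0" "l' \<ge> 0" "m' \<ge> 0"
    and F: "face_in u P = {p + s *\<^sub>R rot u | s. 0 \<le> s \<and> s \<le> l}" "face_in u Q = {q + s *\<^sub>R rot u | s. 0 \<le> s \<and> s \<le> m}"
      "face_in u P' = {p' + s *\<^sub>R rot u | s. 0 \<le> s \<and> s \<le> l'}" "face_in u Q' = {q' + s *\<^sub>R rot u | s. 0 \<le> s \<and> s \<le> m'}"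
  shows "l = l' \<and> m = m' \<or> l = m' \<and> m = l'"
proof -
  have S': "convex_polygon P" "convex_polygon Q" "convex_polygon P'" "convex_polygon Q'" "P + Q = P' + Q'"
    "\<And>\<xi>. lap P \<xi> * lap Q \<xi> = lap P' \<xi> * lap Q' \<xi>"
    using S by (auto simp: same_convolution_def)
  \<comment> \<open>The face of a Minkowski sum in a given direction is the sum of the
    faces.\<close>
  have sum: "face_in u (P + Q) = {p + q + s *\<^sub>R rot u | s. 0 \<le> s \<and> s \<le> l + m}"
    if "l \<ge> 0" "m \<ge> 0" and P: "face_in u P = {p + s *\<^sub>R rot u | s. 0 \<le> s \<and> s \<le> l}"
      and Q: "face_in u Q = {q + s *\<^sub>R rot u | s. 0 \<le> s \<and> s \<le> m}" for P Q p q l m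
  proof -
    have "p + 0 *\<^sub>R rot u \<in> face_in u P" unfolding P using that by blast
    moreover have "q + 0 *\<^sub>R rot u \<in> face_in u Q" unfolding Q using that by blast
    ultimately have pq: "p \<in> face_in u P" "q \<in> face_in u Q" by simp_all
    show ?thesis
    proof (intro equalityI subsetI)
      fix z assume z: "z \<in> face_in u (P + Q)"
      then obtain x y where xy: "z = x + y" "x \<in> P" "y \<in> Q" by (auto simp: face_in_def set_plus_def)
      have "p + q \<in> P + Q" using pq by (auto simp: face_in_def set_plus_def)
      then have "u \<bullet> p + u \<bullet> q \<le> u \<bullet> x + u \<bullet> y" using z xy by (simp add: face_in_def flip: inner_add_right)
      moreover have "u \<bullet> x \<le> u \<bullet> p" "u \<bullet> y \<le> u \<bullet> q" using xy pq by (auto simp: face_in_def)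
      ultimately have "u \<bullet> x = u \<bullet> p" "u \<bullet> y = u \<bullet> q" by linarith+
      then have "x \<in> face_in u P" "y \<in> face_in u Q" using xy pq by (auto simp: face_in_def)
      then obtain s t where "x = p + s *\<^sub>R rot u" "0 \<le> s" "s \<le> l" "y = q + t *\<^sub>R rot u" "0 \<le> t" "t \<le> m"
        unfolding P Q by auto
      then show "z \<in> {p + q + s *\<^sub>R rot u | s. 0 \<le> s \<and> s \<le> l + m}"
        unfolding xy(1) by (intro CollectI exI[of _ "s + t"]) (simp add: algebra_simps)
    next
      fix z assume "z \<in> {p + q + s *\<^sub>R rot u | s. 0 \<le> s \<and> s \<le> l + m}"
      then obtain s where s: "z = p + q + s *\<^sub>R rot u" "0 \<le> s" "s \<le> l + m" by blast
      define x y where "x = p + min s l *\<^sub>R rot u" and "y = q + (s - min s l) *\<^sub>R rot u"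
      have "x \<in> face_in u P" unfolding P x_def using s that by (intro CollectI exI[of _ "min s l"]) auto
      moreover have "y \<in> face_in u Q" unfolding Q y_def using s that by (intro CollectI exI[of _ "s - min s l"]) auto
      moreover have "z = x + y" by (simp add: s x_def y_def algebra_simps)
      ultimately show "z \<in> face_in u (P + Q)"
        by (auto simp: face_in_def set_plus_def inner_add_right intro!: add_mono)
    qed
  qed
  have eq: "{p + q + s *\<^sub>R rot u | s. 0 \<le> s \<and> s \<le> l + m} = {p' + q' + s *\<^sub>R rot u | s. 0 \<le> s \<and> s \<le> l' + m'}"
    using sum[OF l(1,2) F(1,2)] sum[OF l(3,4) F(3,4)] S'(5) by simp
  define f where "f x = rot u \<bullet> (x - (p + q)) / (u \<bullet> u)" for x
  have U: "u \<bullet> u > 0" using u by simp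
  define k where "k = f (p' + q')"
  have seg: "{x + s *\<^sub>R rot u | s. 0 \<le> s \<and> s \<le> L} = (\<lambda>s. x + s *\<^sub>R rot u) ` {0..L}" for x L
    by auto
  have f: "f (p + q + s *\<^sub>R rot u) = s" "f (p' + q' + s *\<^sub>R rot u) = k + s" for s
    using U by (simp_all add: f_def k_def inner_diff_right inner_add_right diff_divide_distrib add_divide_distrib)
  \<comment> \<open>Reading both descriptions of the face in the coordinate f along
    \<open>rot u\<close> turns an equality of segments into one of intervals.\<close>
  have "{0..l + m} = {k..k + (l' + m')}"
    using arg_cong[OF eq, of "(`) f"] unfolding seg image_image f by (simp add: add_ac)
  then have suml: "l + m = l' + m'" "k = 0" using l by (auto simp: Icc_eq_Icc)
  have "u \<bullet> (p + q) = u \<bullet> (p' + q')"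
  proof -
    have "p + q + 0 *\<^sub>R rot u \<in> {p' + q' + s *\<^sub>R rot u | s. 0 \<le> s \<and> s \<le> l' + m'}"
      unfolding eq[symmetric] using l by (intro CollectI exI[of _ 0]) simp
    then obtain s where "p + q = p' + q' + s *\<^sub>R rot u" by auto
    from arg_cong[OF this, of "(\<bullet>) u"] show ?thesis by (simp add: inner_add_right)
  qed
  note upq = this
  have lim: "(\<lambda>n. ennreal (real (Suc n) ^ 2 * exp (- (real (Suc n) * (u \<bullet> (p + q))))) *
        (lap P (real (Suc n) *\<^sub>R u) * lap Q (real (Suc n) *\<^sub>R u))) \<longlonglongrightarrow> ennreal (l * m)"
    if P: "convex_polygon P" and Q: "convex_polygon Q" and l: "l \<ge> 0" "m \<ge> 0"
      and F: "face_in u P = {p + s *\<^sub>R rot u | s. 0 \<le> s \<and> s \<le> l}" "face_in u Q = {q + s *\<^sub>R rot u | s. 0 \<le> s \<and> s \<le> m}"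
    for P Q p q l m
  proof -
    have eq: "ennreal (real (Suc n) ^ 2 * exp (- (real (Suc n) * (u \<bullet> (p + q))))) * (lap P (real (Suc n) *\<^sub>R u) * lap Q (real (Suc n) *\<^sub>R u))
      = (ennreal (real (Suc n) * exp (- (real (Suc n) * (u \<bullet> p)))) * lap P (real (Suc n) *\<^sub>R u)) *
        (ennreal (real (Suc n) * exp (- (real (Suc n) * (u \<bullet> q)))) * lap Q (real (Suc n) *\<^sub>R u))" for n
    proof -
      define N where "N = real (Suc n)"
      have "N ^ 2 * exp (- (N * (u \<bullet> (p + q)))) = (N * exp (- (N * (u \<bullet> p)))) * (N * exp (- (N * (u \<bullet> q))))"
        by (simp add: inner_add_right algebra_simps exp_add exp_diff exp_minus field_simps power2_eq_square)
      then have "ennreal (N ^ 2 * exp (- (N * (u \<bullet> (p + q))))) = ennreal (N * exp (- (N * (u \<bullet> p)))) * ennreal (N * exp (- (N * (u \<bullet> q))))"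
        by (simp add: ennreal_mult N_def)
      then show ?thesis unfolding N_def by (simp only: mult_ac)
    qed
    have "(\<lambda>n. (ennreal (real (Suc n) * exp (- (real (Suc n) * (u \<bullet> p)))) * lap P (real (Suc n) *\<^sub>R u)) *
        (ennreal (real (Suc n) * exp (- (real (Suc n) * (u \<bullet> q)))) * lap Q (real (Suc n) *\<^sub>R u))) \<longlonglongrightarrow> ennreal l * ennreal m"
      using lap_edge_limit[OF P u l(1) F(1)] lap_edge_limit[OF Q u l(2) F(2)] by (rule tendsto_mult_ennreal) simp
    then show ?thesis unfolding eq using l by (simp only: ennreal_mult)
  qed
  have "(\<lambda>n. ennreal (real (Suc n) ^ 2 * exp (- (real (Suc n) * (u \<bullet> (p + q))))) *
        (lap P (real (Suc n) *\<^sub>R u) * lap Q (real (Suc n) *\<^sub>R u))) \<longlonglongrightarrow> ennreal (l' * m')"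
    using lim[OF S'(3,4) l(3,4) F(3,4)] unfolding upq S'(6) .
  then have "ennreal (l * m) = ennreal (l' * m')"
    using lim[OF S'(1,2) l(1,2) F(1,2)] LIMSEQ_unique by blast
  then have "l * m = l' * m'" using l by simp
  moreover have m: "m = l' + m' - l" using suml by simp
  ultimately have "(l - l') * (l - m') = 0" by (simp add: algebra_simps)
  then show ?thesis using m by auto
qed

section \<open>Propagation of an exceptional vertex\<close>

lemma ordered4_rotate: "ordered4 a b c d \<Longrightarrow> ordered4 b c d (- a)"
  using cross2_commute[of a b] cross2_commute[of a c] cross2_commute[of a d]
  by (auto simp: ordered4_def)

lemma crossed_cones_sum_eq:
  assumes S: "same_convolution P Q P' Q'" and X: "crossed_cones P Q P' Q' v w v' w' a b c d"
  shows "v + w = v' + w'"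
proof -
  \<comment> \<open>A direction negative on the whole cone from a to d, so it exposes all four
    vertices at once.\<close>
  define u where "u = rot d - rot a"
  have u: "u \<bullet> x = - (cross2 a x + cross2 x d)" for x
    by (simp add: u_def inner_diff_left cross2_commute[of x d]) (simp add: cross2_def)
  have neg: "u \<bullet> a < 0" "u \<bullet> b < 0" "u \<bullet> c < 0" "u \<bullet> d < 0"
    using X by (auto simp: u crossed_cones_def ordered4_def)
  have "exposes u P v" "exposes u Q w" "exposes u P' v'" "exposes u Q' w'"
    using X neg unfolding crossed_cones_def by (auto intro!: exposes_of_tcone)
  then show ?thesis by (rule exposed_sum_eq[OF S])
qed

text \<open>Passing to the next vertex along the edge of direction \<open>a\<close> of \<open>P\<close> and \<open>P'\<close> reproduces the
  configuration with the four directions shifted cyclically and the pairs exchanged.\<close>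

lemma crossed_cones_step:
  assumes S: "same_convolution P Q P' Q'" and X: "crossed_cones P Q P' Q' v w v' w' a b c d"
  obtains l where "l > 0" "crossed_cones Q' P' P Q w' (v' + l *\<^sub>R a) (v + l *\<^sub>R a) w b c d (- a)"
proof -
  have cp: "convex_polygon P" "convex_polygon Q" "convex_polygon P'" "convex_polygon Q'"
    using S by (auto simp: same_convolution_def)
  have o: "ordered4 a b c d" and mem: "v \<in> P" "w \<in> Q" "v' \<in> P'" "w' \<in> Q'"
    and cones: "tcone P v = pos2 a b" "tcone Q w = pos2 c d" "tcone P' v' = pos2 a d" "tcone Q' w' = pos2 b c"
    using X by (auto simp: crossed_cones_def)
  define n where "n = - rot a"
  have n: "n \<bullet> x = - cross2 a x" for x by (simp add: n_def cross2_def)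
  have n_neg: "n \<bullet> a = 0" "n \<bullet> b < 0" "n \<bullet> c < 0" "n \<bullet> d < 0"
    using o by (auto simp: n ordered4_def)
  have a0: "a \<noteq> 0" using o by (auto simp: ordered4_def)
  obtain l e where l: "l > 0" "v + l *\<^sub>R a \<in> P" "tcone P (v + l *\<^sub>R a) = pos2 (- a) e" "n \<bullet> e < 0"
    using adjacent_vertex[OF cp(1) mem(1) cones(1) n_neg(1,2) a0] .
  obtain l' e' where l': "l' > 0" "v' + l' *\<^sub>R a \<in> P'" "tcone P' (v' + l' *\<^sub>R a) = pos2 (- a) e'" "n \<bullet> e' < 0"
    using adjacent_vertex[OF cp(3) mem(3) cones(3) n_neg(1,4) a0] .
  \<comment> \<open>Tilting the edge normal n slightly towards a exposes the far ends of the edges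
    of P and P' and still exposes w and w'.\<close>
  have "eventually (\<lambda>s. \<forall>x\<in>{b, c, d, e, e'}. (n + s *\<^sub>R a) \<bullet> x < 0) (at_right 0)"
  proof (rule eventually_ball_finite)
    show "\<forall>x\<in>{b, c, d, e, e'}. eventually (\<lambda>s. (n + s *\<^sub>R a) \<bullet> x < 0) (at_right 0)"
    proof
      fix x assume x: "x \<in> {b, c, d, e, e'}"
      have "((\<lambda>s. (n + s *\<^sub>R a) \<bullet> x) \<longlongrightarrow> (n + 0 *\<^sub>R a) \<bullet> x) (at_right 0)" by (intro tendsto_intros)
      then show "eventually (\<lambda>s. (n + s *\<^sub>R a) \<bullet> x < 0) (at_right 0)"
        by (rule order_tendstoD) (use x n_neg l l' in auto)
    qed
  qed simp
  moreover have "eventually (\<lambda>s::real. s > 0) (at_right 0)" by (simp add: eventually_at_right_less)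
  ultimately have "eventually (\<lambda>s. s > 0 \<and> (\<forall>x\<in>{b, c, d, e, e'}. (n + s *\<^sub>R a) \<bullet> x < 0)) (at_right 0)"
    by eventually_elim simp
  then obtain s where s: "s > 0" "\<forall>x\<in>{b, c, d, e, e'}. (n + s *\<^sub>R a) \<bullet> x < 0"
    using eventually_happens'[OF trivial_limit_at_right_real] by blast
  define u where "u = n + s *\<^sub>R a"
  have u: "u \<bullet> (- a) < 0" "u \<bullet> b < 0" "u \<bullet> c < 0" "u \<bullet> d < 0" "u \<bullet> e < 0" "u \<bullet> e' < 0"
    using s n_neg a0 by (auto simp: u_def inner_add_left)
  have "{#slope u (- a), slope u e, slope u c, slope u d#} = {#slope u (- a), slope u e', slope u b, slope u c#}"
    using cone_slopes_eq(1)[OF S l(2) mem(2) l'(2) mem(4) l(3) cones(2) l'(3) cones(4) u(1,5,3,4,1,6,2,3)] .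
  \<comment> \<open>The ray \<open>- a\<close> is common to P and P', the ray c to Q and Q'. After
    cancelling both, the new ray of P must be that of b and the new ray of P' that of d.\<close>
  then have ms: "{#slope u e, slope u d#} = {#slope u e', slope u b#}"
    by (simp add: add_mset_commute)
  have "slope u d \<noteq> slope u b"
    using slope_cross2[OF u(2,4)] o u by (auto simp: ordered4_def)
  then have sl: "slope u e = slope u b" "slope u e' = slope u d"
    using ms by (auto simp: add_eq_conv_ex)
  have "pos2 (- a) e = pos2 b (- a)" "pos2 (- a) e' = pos2 d (- a)"
    using pos2_slope_cong[OF u(1,5,1,2) refl sl(1)] pos2_slope_cong[OF u(1,6,1,4) refl sl(2)] pos2_commute by auto
  then have X': "crossed_cones Q' P' P Q w' (v' + l' *\<^sub>R a) (v + l *\<^sub>R a) w b c d (- a)"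
    using ordered4_rotate[OF o] mem l(2,3) l'(2,3) cones by (simp add: crossed_cones_def)
  have S': "same_convolution Q' P' P Q"
    using S same_convolution_swap by blast
  \<comment> \<open>The vertex sums of the two pairs agree before and after the step, so both edges
    have the same length.\<close>
  have "w' + (v' + l' *\<^sub>R a) = v + l *\<^sub>R a + w" by (rule crossed_cones_sum_eq[OF S' X'])
  moreover have "v + w = v' + w'" by (rule crossed_cones_sum_eq[OF S X])
  moreover have "w' + (v' + l' *\<^sub>R a) = (v' + w') + l' *\<^sub>R a" "v + l *\<^sub>R a + w = (v + w) + l *\<^sub>R a"
    by (simp_all only: add_ac)
  ultimately have "l' *\<^sub>R a = l *\<^sub>R a" by simp
  then have "l' = l" using a0 by simp
  then show ?thesis using that[OF l(1)] X' by simp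
qed

text \<open>Four steps, along a, b, c and d, restore the roles of the four polygons and reverse all
  four rays.\<close>

lemma crossed_cones_half_turn:
  assumes S: "same_convolution P Q P' Q'" and X: "crossed_cones P Q P' Q' v w v' w' a b c d"
  obtains i j k l where "i > 0" "j > 0" "k > 0" "l > 0"
    "crossed_cones P Q P' Q' (v + i *\<^sub>R a + j *\<^sub>R b) (w + k *\<^sub>R c + l *\<^sub>R d)
       (v' + i *\<^sub>R a + l *\<^sub>R d) (w' + j *\<^sub>R b + k *\<^sub>R c) (- a) (- b) (- c) (- d)"
    "v + i *\<^sub>R a \<in> P" "w + k *\<^sub>R c \<in> Q" "v' + i *\<^sub>R a \<in> P'" "w' + j *\<^sub>R b \<in> Q'"
proof -
  have S1: "same_convolution Q' P' P Q" and S2: "same_convolution Q P Q' P'" and S3: "same_convolution P' Q' Q P"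
    using S same_convolution_swap by blast+
  obtain i where i: "i > 0" "crossed_cones Q' P' P Q w' (v' + i *\<^sub>R a) (v + i *\<^sub>R a) w b c d (- a)"
    using crossed_cones_step[OF S X] .
  obtain j where j: "j > 0" "crossed_cones Q P Q' P' w (v + i *\<^sub>R a + j *\<^sub>R b) (w' + j *\<^sub>R b) (v' + i *\<^sub>R a) c d (- a) (- b)"
    using crossed_cones_step[OF S1 i(2)] .
  obtain k where k: "k > 0" "crossed_cones P' Q' Q P (v' + i *\<^sub>R a) (w' + j *\<^sub>R b + k *\<^sub>R c) (w + k *\<^sub>R c)
      (v + i *\<^sub>R a + j *\<^sub>R b) d (- a) (- b) (- c)"
    using crossed_cones_step[OF S2 j(2)] .
  obtain l where l: "l > 0" "crossed_cones P Q P' Q' (v + i *\<^sub>R a + j *\<^sub>R b) (w + k *\<^sub>R c + l *\<^sub>R d)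
       (v' + i *\<^sub>R a + l *\<^sub>R d) (w' + j *\<^sub>R b + k *\<^sub>R c) (- a) (- b) (- c) (- d)"
    using crossed_cones_step[OF S3 k(2)] .
  show ?thesis
    using that[OF i(1) j(1) k(1) l] i(2) j(2) k(2) by (simp add: crossed_cones_def)
qed

section \<open>The walk closes up in parallelograms\<close>

definition parallelogram :: "real^2 \<Rightarrow> real^2 \<Rightarrow> real^2 \<Rightarrow> (real^2) set" where
  "parallelogram v a b = {v + s *\<^sub>R a + t *\<^sub>R b | s t. 0 \<le> s \<and> s \<le> 1 \<and> 0 \<le> t \<and> t \<le> 1}"

text \<open>P lies in the intersection of the two opposite corner cones, which is the parallelogram;
  conversely convexity fills it in from its corners.\<close>

lemma parallelogram_eqI:
  assumes P: "convex P" and ab: "cross2 a b \<noteq> 0"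
    and cones: "tcone P v = pos2 a b" "tcone P (v + a + b) = pos2 (- a) (- b)"
    and mem: "v \<in> P" "v + a \<in> P" "v + b \<in> P" "v + a + b \<in> P"
  shows "P = parallelogram v a b"
proof (intro equalityI subsetI)
  fix x assume x: "x \<in> P"
  obtain s t where st: "x - v = s *\<^sub>R a + t *\<^sub>R b" "s \<ge> 0" "t \<ge> 0"
    using diff_in_tcone[OF x, of v] cones by (auto simp: pos2_def)
  obtain s' t' where st': "x - (v + a + b) = s' *\<^sub>R (- a) + t' *\<^sub>R (- b)" "s' \<ge> 0" "t' \<ge> 0"
    using diff_in_tcone[OF x, of "v + a + b"] cones by (auto simp: pos2_def)
  have "x - v = (x - (v + a + b)) + a + b" by simp
  then have eq: "s *\<^sub>R a + t *\<^sub>R b = s' *\<^sub>R (- a) + t' *\<^sub>R (- b) + a + b"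
    by (simp only: st(1) st'(1))
  have "s * cross2 a b = (1 - s') * cross2 a b" "t * cross2 a b = (1 - t') * cross2 a b"
    using arg_cong[OF eq, of "\<lambda>x. cross2 x b"] arg_cong[OF eq, of "cross2 a"]
    by (simp_all add: left_diff_distrib)
  then have "s = 1 - s'" "t = 1 - t'" using ab by simp_all
  moreover have "x = v + s *\<^sub>R a + t *\<^sub>R b" using st(1) by (simp add: algebra_simps)
  ultimately show "x \<in> parallelogram v a b" using st(2,3) st'(2,3) unfolding parallelogram_def
    by (intro CollectI exI[of _ s] exI[of _ t]) simp
next
  fix x assume "x \<in> parallelogram v a b"
  then obtain s t where st: "x = v + s *\<^sub>R a + t *\<^sub>R b" "0 \<le> s" "s \<le> 1" "0 \<le> t" "t \<le> 1"
    unfolding parallelogram_def by blast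
  have m1: "(1 - s) *\<^sub>R v + s *\<^sub>R (v + a) \<in> P"
    by (rule convexD[OF P mem(1,2)]) (use st in simp_all)
  have m2: "(1 - s) *\<^sub>R (v + b) + s *\<^sub>R (v + a + b) \<in> P"
    by (rule convexD[OF P mem(3,4)]) (use st in simp_all)
  have "(1 - t) *\<^sub>R ((1 - s) *\<^sub>R v + s *\<^sub>R (v + a)) + t *\<^sub>R ((1 - s) *\<^sub>R (v + b) + s *\<^sub>R (v + a + b)) \<in> P"
    by (rule convexD[OF P m1 m2]) (use st in simp_all)
  moreover have "(1 - t) *\<^sub>R ((1 - s) *\<^sub>R v + s *\<^sub>R (v + a)) + t *\<^sub>R ((1 - s) *\<^sub>R (v + b) + s *\<^sub>R (v + a + b)) = x"
    unfolding st(1) by (simp add: algebra_simps)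
  ultimately show "x \<in> P" by simp
qed

text \<open>Two half turns lead back to the original cones, hence to the original vertices. So the
  second half turn retraces the edge lengths of the first, opposite edges are equal, and the missing
  fourth corners are found in the polygons.\<close>

lemma crossed_cones_parallelograms:
  assumes S: "same_convolution P Q P' Q'" and X: "crossed_cones P Q P' Q' v w v' w' a b c d"
  obtains i j k l where "i > 0" "j > 0" "k > 0" "l > 0"
    "P = parallelogram v (i *\<^sub>R a) (j *\<^sub>R b)" "Q = parallelogram w (k *\<^sub>R c) (l *\<^sub>R d)"
    "P' = parallelogram v' (i *\<^sub>R a) (l *\<^sub>R d)" "Q' = parallelogram w' (j *\<^sub>R b) (k *\<^sub>R c)"
proof -
  have cp: "convex P" "convex Q" "convex P'" "convex Q'"
    using S convex_polygonD(1) by (auto simp: same_convolution_def)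
  have cr: "cross2 a b \<noteq> 0" "cross2 c d \<noteq> 0" "cross2 a d \<noteq> 0" "cross2 b c \<noteq> 0"
    using X by (auto simp: crossed_cones_def ordered4_def)
  obtain i j k l where p: "i > 0" "j > 0" "k > 0" "l > 0"
    and X1: "crossed_cones P Q P' Q' (v + i *\<^sub>R a + j *\<^sub>R b) (w + k *\<^sub>R c + l *\<^sub>R d)
       (v' + i *\<^sub>R a + l *\<^sub>R d) (w' + j *\<^sub>R b + k *\<^sub>R c) (- a) (- b) (- c) (- d)"
    and m1: "v + i *\<^sub>R a \<in> P" "w + k *\<^sub>R c \<in> Q" "v' + i *\<^sub>R a \<in> P'" "w' + j *\<^sub>R b \<in> Q'"
    using crossed_cones_half_turn[OF S X] .
  obtain i' j' k' l' where p': "i' > 0" "j' > 0" "k' > 0" "l' > 0"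
    and X2: "crossed_cones P Q P' Q' (v + i *\<^sub>R a + j *\<^sub>R b + i' *\<^sub>R (- a) + j' *\<^sub>R (- b))
       (w + k *\<^sub>R c + l *\<^sub>R d + k' *\<^sub>R (- c) + l' *\<^sub>R (- d))
       (v' + i *\<^sub>R a + l *\<^sub>R d + i' *\<^sub>R (- a) + l' *\<^sub>R (- d))
       (w' + j *\<^sub>R b + k *\<^sub>R c + j' *\<^sub>R (- b) + k' *\<^sub>R (- c)) (- (- a)) (- (- b)) (- (- c)) (- (- d))"
    and m2: "v + i *\<^sub>R a + j *\<^sub>R b + i' *\<^sub>R (- a) \<in> P" "w + k *\<^sub>R c + l *\<^sub>R d + k' *\<^sub>R (- c) \<in> Q"
      "v' + i *\<^sub>R a + l *\<^sub>R d + i' *\<^sub>R (- a) \<in> P'" "w' + j *\<^sub>R b + k *\<^sub>R c + j' *\<^sub>R (- b) \<in> Q'"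
    using crossed_cones_half_turn[OF S X1] .
  have par: "s = s' \<and> t = t'"
    if "x + s *\<^sub>R e + t *\<^sub>R f + s' *\<^sub>R (- e) + t' *\<^sub>R (- f) = x" "cross2 e f \<noteq> 0" for x e f :: "real^2" and s t s' t'
  proof -
    have 0: "(s - s') *\<^sub>R e + (t - t') *\<^sub>R f = 0" using that(1) by (simp add: algebra_simps)
    show ?thesis
      using arg_cong[OF 0, of "\<lambda>x. cross2 x f"] arg_cong[OF 0, of "cross2 e"] that(2) by simp
  qed
  \<comment> \<open>After a full turn the vertex of P reached has the cone \<open>pos2 a b\<close>
    again, and such a vertex is unique; likewise for Q.\<close>
  have apex: "v = v + i *\<^sub>R a + j *\<^sub>R b + i' *\<^sub>R (- a) + j' *\<^sub>R (- b)"
    "w = w + k *\<^sub>R c + l *\<^sub>R d + k' *\<^sub>R (- c) + l' *\<^sub>R (- d)"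
    using X X2 cr by (auto simp only: crossed_cones_def minus_minus intro!: tcone_apex_unique)
  have e: "i' = i" "j' = j" "k' = k" "l' = l"
    using par[OF apex(1)[symmetric] cr(1)] par[OF apex(2)[symmetric] cr(2)] by simp_all
  have m3: "v + j *\<^sub>R b \<in> P" "w + l *\<^sub>R d \<in> Q" "v' + l *\<^sub>R d \<in> P'" "w' + k *\<^sub>R c \<in> Q'"
    using m2 unfolding e by (simp_all add: algebra_simps)
  have sc: "pos2 (s *\<^sub>R x) (t *\<^sub>R y) = pos2 x y" "pos2 (- (s *\<^sub>R x)) (- (t *\<^sub>R y)) = pos2 (- x) (- y)"
    if "s > 0" "t > 0" for s t x y
    using pos2_scaleR[OF that, of x y] pos2_scaleR[OF that, of "- x" "- y"] by simp_all
  show ?thesis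
  proof (rule that[OF p])
    show "P = parallelogram v (i *\<^sub>R a) (j *\<^sub>R b)"
      using X X1 m1 m3 p cr by (intro parallelogram_eqI[OF cp(1)]) (auto simp: crossed_cones_def sc)
    show "Q = parallelogram w (k *\<^sub>R c) (l *\<^sub>R d)"
      using X X1 m1 m3 p cr by (intro parallelogram_eqI[OF cp(2)]) (auto simp: crossed_cones_def sc)
    show "P' = parallelogram v' (i *\<^sub>R a) (l *\<^sub>R d)"
      using X X1 m1 m3 p cr by (intro parallelogram_eqI[OF cp(3)]) (auto simp: crossed_cones_def sc)
    show "Q' = parallelogram w' (j *\<^sub>R b) (k *\<^sub>R c)"
      using X X1 m1 m3 p cr by (intro parallelogram_eqI[OF cp(4)]) (auto simp: crossed_cones_def sc)
  qed
qed

section \<open>Exceptional pairs and synisothesis\<close>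

definition exceptional_configuration ::
  "(real^2) set \<Rightarrow> (real^2) set \<Rightarrow> (real^2) set \<Rightarrow> (real^2) set \<Rightarrow> bool" where
  "exceptional_configuration K L K' L' \<longleftrightarrow>
     (\<exists>T i j \<alpha> \<beta> \<gamma> \<delta> y.
           affine_transformation T \<and> i \<in> {1, 2} \<and> j \<in> {1, 2} \<and> i \<noteq> j \<and>
           \<alpha> > 0 \<and> \<beta> > 0 \<and> \<gamma> > 0 \<and> \<delta> > 0 \<and>
           trivial_associate (T ` K, T ` L) (exceptional_pair i \<alpha> \<beta> \<gamma> \<delta> y) \<and>
           trivial_associate (T ` K', T ` L') (exceptional_pair j \<alpha> \<beta> \<gamma> \<delta> y))"

lemma exceptional_configuration_commute:
  "exceptional_configuration K L K' L' \<Longrightarrow> exceptional_configuration K' L' K L"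
  unfolding exceptional_configuration_def
proof (elim exE conjE, goal_cases)
  case (1 T i j \<alpha> \<beta> \<gamma> \<delta> y)
  then show ?case
    by (intro exI[of _ T] exI[of _ j] exI[of _ i] exI[of _ \<alpha>] exI[of _ \<beta>] exI[of _ \<gamma>] exI[of _ \<delta>]
        exI[of _ y] conjI) (assumption | erule not_sym)+
qed

text \<open>Exchanging the summands K and -L amounts to replacing (K, L) by (-L, -K). An affine T
  with translation part b turns negation into the point reflection of z to 2b - z, which
  interchanges the two forms of trivial associates.\<close>

lemma trivial_associate_reflect:
  assumes T: "affine_transformation T"
    and t: "trivial_associate (T ` A, T ` uminus ` B) X"
  shows "trivial_associate (T ` B, T ` uminus ` A) X"
proof -
  obtain f b where f: "linear f" "T = (\<lambda>x. f x + b)"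
    using T by (auto simp: affine_transformation_def)
  have refl: "T (- x) = 2 *\<^sub>R b - T x" for x
    using f by (simp add: linear_neg scaleR_2)
  have img: "T ` uminus ` A = (\<lambda>z. 2 *\<^sub>R b - z) ` T ` A" for A
    by (simp add: image_image refl)
  have B: "T ` B = (\<lambda>z. 2 *\<^sub>R b - z) ` T ` uminus ` B"
    by (simp add: image_image refl)
  have reflect: "(\<lambda>z. 2 *\<^sub>R b - z) ` (+) x ` Z = (+) (2 *\<^sub>R b - x) ` uminus ` Z" for x Z
    unfolding image_image by (rule image_cong) simp_all
  obtain x where "T ` A = (+) x ` fst X \<and> T ` uminus ` B = (+) x ` snd X \<or>
      T ` A = (+) x ` uminus ` snd X \<and> T ` uminus ` B = (+) x ` uminus ` fst X"
    using t by (auto simp: trivial_associate_def)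
  then show ?thesis
  proof (elim disjE conjE)
    assume a: "T ` A = (+) x ` fst X" "T ` uminus ` B = (+) x ` snd X"
    have "T ` B = (\<lambda>z. 2 *\<^sub>R b - z) ` (+) x ` snd X" by (simp only: B a(2))
    moreover have "T ` uminus ` A = (\<lambda>z. 2 *\<^sub>R b - z) ` (+) x ` fst X" by (simp only: img a(1))
    ultimately have "T ` B = (+) (2 *\<^sub>R b - x) ` uminus ` snd X" "T ` uminus ` A = (+) (2 *\<^sub>R b - x) ` uminus ` fst X"
      by (simp_all only: reflect)
    then show ?thesis unfolding trivial_associate_def by auto
  next
    assume a: "T ` A = (+) x ` uminus ` snd X" "T ` uminus ` B = (+) x ` uminus ` fst X"
    have "T ` B = (\<lambda>z. 2 *\<^sub>R b - z) ` (+) x ` uminus ` fst X" by (simp only: B a(2))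
    moreover have "T ` uminus ` A = (\<lambda>z. 2 *\<^sub>R b - z) ` (+) x ` uminus ` snd X" by (simp only: img a(1))
    ultimately have "T ` B = (+) (2 *\<^sub>R b - x) ` fst X" "T ` uminus ` A = (+) (2 *\<^sub>R b - x) ` snd X"
      by (simp_all only: reflect) (simp_all add: image_image)
    then show ?thesis unfolding trivial_associate_def by auto
  qed
qed

lemma exceptional_configuration_reflect:
  assumes "exceptional_configuration P (uminus ` Q) K' L'"
  shows "exceptional_configuration Q (uminus ` P) K' L'"
  using assms unfolding exceptional_configuration_def
proof (elim exE conjE, goal_cases)
  case (1 T i j \<alpha> \<beta> \<gamma> \<delta> y)
  from trivial_associate_reflect[OF 1(1,9)] 1 show ?case
    by (intro exI[of _ T] exI[of _ i] exI[of _ j] exI[of _ \<alpha>] exI[of _ \<beta>] exI[of _ \<gamma>] exI[of _ \<delta>]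
        exI[of _ y] conjI)
qed

section \<open>Normal form of the exceptional parallelograms\<close>

definition centred_segment :: "real^2 \<Rightarrow> (real^2) set" where
  "centred_segment x = (\<lambda>t. t *\<^sub>R x) ` {-1..1}"

lemma closed_segment_centred: "closed_segment (- x) x = centred_segment x"
proof (intro equalityI subsetI)
  fix y assume "y \<in> closed_segment (- x) x"
  then obtain s where s: "y = (1 - s) *\<^sub>R (- x) + s *\<^sub>R x" "0 \<le> s" "s \<le> 1"
    by (auto simp: closed_segment_def)
  then have "y = (2 * s - 1) *\<^sub>R x" by (simp add: vec_eq_iff algebra_simps)
  then show "y \<in> centred_segment x" using s unfolding centred_segment_def
    by (intro image_eqI[of _ _ "2 * s - 1"]) auto
next
  fix y assume "y \<in> centred_segment x"
  then obtain t where t': "y = t *\<^sub>R x" "t \<in> {-1..1}" unfolding centred_segment_def by blast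
  then have t: "y = t *\<^sub>R x" "-1 \<le> t" "t \<le> 1" by auto
  then have "y = (1 - (1 + t) / 2) *\<^sub>R (- x) + ((1 + t) / 2) *\<^sub>R x"
    by (simp add: vec_eq_iff field_simps)
  then show "y \<in> closed_segment (- x) x" using t unfolding closed_segment_def
    by (intro CollectI exI[of _ "(1 + t) / 2"]) auto
qed

lemma centred_segment_scaleR: "(*\<^sub>R) c ` centred_segment x = centred_segment (c *\<^sub>R x)"
  unfolding centred_segment_def by (simp add: image_image mult.commute)

lemma centred_segment_uminus: "uminus ` centred_segment x = centred_segment x"
proof -
  have "uminus ` centred_segment x = (\<lambda>t. t *\<^sub>R x) ` uminus ` {-1..1}"
    unfolding centred_segment_def image_image by (rule image_cong) simp_all
  then show ?thesis by (simp add: centred_segment_def)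
qed

text \<open>The generators are taken at angles 0, 45, 90 and 135 degrees, so that they occur in
  counterclockwise order like a, b, c, d.\<close>

lemma seg_centred:
  "seg1 = centred_segment (vector [1, 0])"
  "seg2 = centred_segment ((1 / sqrt 2) *\<^sub>R vector [1, 1])"
  "seg3 = centred_segment (vector [0, 1])"
  "seg4 = centred_segment ((1 / sqrt 2) *\<^sub>R vector [-1, 1])"
proof -
  have v: "vector [-1, 0] = - (vector [1, 0] :: real^2)" "vector [-1, -1] = - (vector [1, 1] :: real^2)"
    "vector [0, -1] = - (vector [0, 1] :: real^2)" "vector [1, -1] = - (vector [-1, 1] :: real^2)"
    by (simp_all add: vec_eq_iff forall_2)
  show "seg1 = centred_segment (vector [1, 0])" "seg3 = centred_segment (vector [0, 1])"
    unfolding seg1_def seg3_def v by (rule closed_segment_centred)+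
  show "seg2 = centred_segment ((1 / sqrt 2) *\<^sub>R vector [1, 1])"
    "seg4 = centred_segment ((1 / sqrt 2) *\<^sub>R vector [-1, 1])"
    unfolding seg2_def seg4_def v by (simp_all only: closed_segment_centred centred_segment_scaleR)
qed

lemma parallelogram_centred:
  "parallelogram v (2 *\<^sub>R a) (2 *\<^sub>R b) = (+) (v + a + b) ` (centred_segment a + centred_segment b)"
proof (intro equalityI subsetI)
  fix x assume "x \<in> parallelogram v (2 *\<^sub>R a) (2 *\<^sub>R b)"
  then obtain s t where x: "x = v + s *\<^sub>R 2 *\<^sub>R a + t *\<^sub>R 2 *\<^sub>R b" "0 \<le> s" "s \<le> 1" "0 \<le> t" "t \<le> 1"
    by (auto simp: parallelogram_def)
  have "x = v + a + b + ((2 * s - 1) *\<^sub>R a + (2 * t - 1) *\<^sub>R b)"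
    unfolding x(1) by (simp add: algebra_simps)
  moreover have "(2 * s - 1) *\<^sub>R a \<in> centred_segment a" "(2 * t - 1) *\<^sub>R b \<in> centred_segment b"
    using x unfolding centred_segment_def by auto
  ultimately show "x \<in> (+) (v + a + b) ` (centred_segment a + centred_segment b)"
    by (metis image_eqI set_plus_intro)
next
  fix x assume "x \<in> (+) (v + a + b) ` (centred_segment a + centred_segment b)"
  then obtain s t where x: "x = v + a + b + (s *\<^sub>R a + t *\<^sub>R b)" "-1 \<le> s" "s \<le> 1" "-1 \<le> t" "t \<le> 1"
    by (auto simp: centred_segment_def set_plus_def)
  have "x = v + ((1 + s) / 2) *\<^sub>R 2 *\<^sub>R a + ((1 + t) / 2) *\<^sub>R 2 *\<^sub>R b"
    unfolding x(1) by (simp add: vec_eq_iff field_simps)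
  then show "x \<in> parallelogram v (2 *\<^sub>R a) (2 *\<^sub>R b)"
    using x unfolding parallelogram_def by (intro CollectI exI[of _ "(1 + s) / 2"] exI[of _ "(1 + t) / 2"]) auto
qed

lemma linear_image_parallelogram:
  assumes "linear f"
  shows "f ` parallelogram v a b = parallelogram (f v) (f a) (f b)"
proof -
  have p: "parallelogram v a b = (\<lambda>(s, t). v + s *\<^sub>R a + t *\<^sub>R b) ` ({0..1} \<times> {0..1})" for v a b
  proof (intro equalityI subsetI)
    fix x assume "x \<in> parallelogram v a b"
    then obtain s t where "x = v + s *\<^sub>R a + t *\<^sub>R b" "0 \<le> s" "s \<le> 1" "0 \<le> t" "t \<le> 1"
      unfolding parallelogram_def by blast
    then show "x \<in> (\<lambda>(s, t). v + s *\<^sub>R a + t *\<^sub>R b) ` ({0..1} \<times> {0..1})"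
      by (intro image_eqI[of _ _ "(s, t)"]) simp_all
  next
    fix x assume "x \<in> (\<lambda>(s, t). v + s *\<^sub>R a + t *\<^sub>R b) ` ({0..1} \<times> {0..1})"
    then obtain q where "q \<in> {0..1} \<times> {0..1}" "x = (\<lambda>(s, t). v + s *\<^sub>R a + t *\<^sub>R b) q" by blast
    then obtain s t where "x = v + s *\<^sub>R a + t *\<^sub>R b" "s \<in> {0..1}" "t \<in> {0..1}" by (cases q) auto
    then show "x \<in> parallelogram v a b"
      unfolding parallelogram_def by (intro CollectI exI[of _ s] exI[of _ t]) simp
  qed
  show ?thesis
    unfolding p image_image using assms by (intro image_cong) (auto simp: linear_add linear_scale)
qed

lemma uminus_image_set_plus: "uminus ` (A + B) = uminus ` A + uminus ` (B :: 'a::ab_group_add set)"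
proof (intro equalityI subsetI)
  fix x assume "x \<in> uminus ` (A + B)"
  then obtain a b where "a \<in> A" "b \<in> B" "x = - a + - b" by (auto elim!: set_plus_elim)
  then show "x \<in> uminus ` A + uminus ` B" by (simp only: set_plus_intro imageI)
next
  fix x assume "x \<in> uminus ` A + uminus ` B"
  then obtain a b where "a \<in> A" "b \<in> B" "x = - (a + b)" by (auto elim!: set_plus_elim)
  then show "x \<in> uminus ` (A + B)" by (simp only: set_plus_intro imageI)
qed

lemma uminus_translated_zonotope:
  "uminus ` (+) c ` (centred_segment a + centred_segment b) = (+) (- c) ` (centred_segment a + centred_segment b)"
proof -
  have "uminus ` (+) c ` (centred_segment a + centred_segment b)
      = (+) (- c) ` uminus ` (centred_segment a + centred_segment b)"
    unfolding image_image by (rule image_cong) simp_all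
  then show ?thesis by (simp only: uminus_image_set_plus centred_segment_uminus)
qed

text \<open>Some linear f takes a and c to the positive coordinate axes. The weights
  \<open>cross2 a b\<close> and \<open>cross2 b c\<close> of its coordinates bring b to the
  diagonal; harmonicity is then exactly the condition that d goes to the antidiagonal.\<close>

lemma parallelograms_exceptional_configuration:
  assumes o: "ordered4 a b c d" and h: "harmonic a b c d" and sum: "v + w = v' + w'"
  shows "exceptional_configuration (parallelogram v a b) (uminus ` parallelogram w c d)
    (parallelogram v' a d) (uminus ` parallelogram w' b c)"
proof -
  have pos: "cross2 a b > 0" "cross2 a c > 0" "cross2 a d > 0" "cross2 b c > 0" "cross2 b d > 0" "cross2 c d > 0"
    using o by (auto simp: ordered4_def)
  define f :: "real^2 \<Rightarrow> real^2" where "f x = vector [cross2 a b * cross2 x c, cross2 b c * cross2 a x]" for x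
  have lin: "linear f" by (rule linearI) (simp_all add: f_def vec_eq_iff forall_2 algebra_simps)
  have inj: "inj f"
  proof (rule linear_injective_0[THEN iffD2, OF lin, rule_format])
    fix x assume "f x = 0"
    then have "cross2 x c = 0" "cross2 a x = 0"
      using pos by (auto simp: f_def vec_eq_iff forall_2)
    then have "cross2 a c *\<^sub>R x = 0" by (simp add: cross2_expand)
    then show "x = 0" using pos by simp
  qed
  then have "bij f" using linear_inj_imp_surj[OF lin] by (simp add: bij_def)
  then have T: "affine_transformation f"
    unfolding affine_transformation_def using lin by (intro exI[of _ f] exI[of _ 0]) auto
  \<comment> \<open>Half the image vectors, since the segments are centred; for b and d the factor
    \<open>sqrt 2\<close> compensates the normalisation of \<open>seg2\<close> and
    \<open>seg4\<close>.\<close>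
  define \<alpha> \<beta> \<gamma> \<delta> where "\<alpha> = cross2 a b * cross2 a c / 2" and "\<beta> = cross2 a b * cross2 b c / sqrt 2"
    and "\<gamma> = cross2 b c * cross2 a c / 2" and "\<delta> = cross2 b c * cross2 a d / sqrt 2"
  have p: "\<alpha> > 0" "\<beta> > 0" "\<gamma> > 0" "\<delta> > 0"
    using pos by (simp_all add: \<alpha>_def \<beta>_def \<gamma>_def \<delta>_def)
  define A B C D :: "real^2" where "A = \<alpha> *\<^sub>R vector [1, 0]" and "B = \<beta> *\<^sub>R (1 / sqrt 2) *\<^sub>R vector [1, 1]"
    and "C = \<gamma> *\<^sub>R vector [0, 1]" and "D = \<delta> *\<^sub>R (1 / sqrt 2) *\<^sub>R vector [-1, 1]"
  have "f a = 2 *\<^sub>R A" "f c = 2 *\<^sub>R C"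
    by (simp_all add: f_def A_def C_def \<alpha>_def \<gamma>_def vec_eq_iff forall_2)
  moreover have "f b = 2 *\<^sub>R B"
    by (simp add: f_def B_def \<beta>_def vec_eq_iff forall_2)
  moreover have "f d = 2 *\<^sub>R D"
    using h by (simp add: f_def D_def \<delta>_def vec_eq_iff forall_2 harmonic_def cross2_commute[of d c])
  ultimately have f2: "f a = 2 *\<^sub>R A" "f b = 2 *\<^sub>R B" "f c = 2 *\<^sub>R C" "f d = 2 *\<^sub>R D" by auto
  have segs: "(*\<^sub>R) \<alpha> ` seg1 = centred_segment A" "(*\<^sub>R) \<beta> ` seg2 = centred_segment B"
    "(*\<^sub>R) \<gamma> ` seg3 = centred_segment C" "(*\<^sub>R) \<delta> ` seg4 = centred_segment D"
    by (simp_all only: seg_centred centred_segment_scaleR A_def B_def C_def D_def)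
  \<comment> \<open>The vector from the centre of the image of K to that of L. It is the same for
    both pairs because \<open>v + w = v' + w'\<close>.\<close>
  define y where "y = - (f v + A + B) - (f w + C + D)"
  have y': "y = - (f v' + A + D) - (f w' + B + C)"
  proof -
    have "f v + f w = f v' + f w'" using sum lin by (metis linear_add)
    then show ?thesis by (simp add: y_def algebra_simps)
  qed
  have shift: "(+) (- q) ` Z = (+) p ` (Z + {- p - q})" for p q :: "real^2" and Z
  proof -
    have "Z + {- p - q} = (+) (- p - q) ` Z"
      unfolding translation_eq_singleton_plus by (rule add.commute)
    then show ?thesis by (simp only: image_image) (rule image_cong, simp_all)
  qed
  have shift1: "(+) (- (f w + C + D)) ` Z = (+) (f v + A + B) ` (Z + {y})" for Z
    unfolding y_def by (rule shift)
  have shift2: "(+) (- (f w' + B + C)) ` Z = (+) (f v' + A + D) ` (Z + {y})" for Z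
    unfolding y' by (rule shift)
  have "(2::nat) \<noteq> 1" by simp
  note if_False = if_not_P[OF this]
  have fu: "f ` uminus ` Z = uminus ` f ` Z" for Z
    using lin by (simp add: image_image linear_neg)
  have "trivial_associate (f ` parallelogram v a b, f ` uminus ` parallelogram w c d) (exceptional_pair 1 \<alpha> \<beta> \<gamma> \<delta> y)"
    unfolding trivial_associate_def exceptional_pair_def segs fu linear_image_parallelogram[OF lin] f2
      parallelogram_centred uminus_translated_zonotope
    by (rule exI[of _ "f v + A + B"], rule disjI1) (simp only: shift1 if_P[OF refl] fst_conv snd_conv)
  moreover have "trivial_associate (f ` parallelogram v' a d, f ` uminus ` parallelogram w' b c) (exceptional_pair 2 \<alpha> \<beta> \<gamma> \<delta> y)"
    unfolding trivial_associate_def exceptional_pair_def segs fu linear_image_parallelogram[OF lin] f2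
      parallelogram_centred uminus_translated_zonotope
    by (rule exI[of _ "f v' + A + D"], rule disjI1) (simp only: shift2 if_False fst_conv snd_conv)
  ultimately show ?thesis
    unfolding exceptional_configuration_def using T p
    by (intro exI[of _ f] exI[of _ "1::nat"] exI[of _ "2::nat"] exI[of _ \<alpha>] exI[of _ \<beta>] exI[of _ \<gamma>] exI[of _ \<delta>] exI[of _ y]) simp
qed

lemma exceptional_vertex_imp_configuration:
  assumes S: "same_convolution P Q P' Q'" and X: "exceptional_vertex P Q P' Q'"
  shows "exceptional_configuration P (uminus ` Q) P' (uminus ` Q')"
proof -
  obtain v w v' w' a b c d where X: "crossed_cones P Q P' Q' v w v' w' a b c d" and h: "harmonic a b c d"
    using X by (auto simp: exceptional_vertex_def)
  have o: "ordered4 a b c d" using X by (simp add: crossed_cones_def)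
  obtain i j k l where p: "i > 0" "j > 0" "k > 0" "l > 0"
    and eq: "P = parallelogram v (i *\<^sub>R a) (j *\<^sub>R b)" "Q = parallelogram w (k *\<^sub>R c) (l *\<^sub>R d)"
    "P' = parallelogram v' (i *\<^sub>R a) (l *\<^sub>R d)" "Q' = parallelogram w' (j *\<^sub>R b) (k *\<^sub>R c)"
    using crossed_cones_parallelograms[OF S X] .
  have "ordered4 (i *\<^sub>R a) (j *\<^sub>R b) (k *\<^sub>R c) (l *\<^sub>R d)" using o p by (simp add: ordered4_def)
  moreover have "harmonic (i *\<^sub>R a) (j *\<^sub>R b) (k *\<^sub>R c) (l *\<^sub>R d)" using h by (simp add: harmonic_def mult_ac)
  ultimately show ?thesis
    unfolding eq using crossed_cones_sum_eq[OF S X] by (rule parallelograms_exceptional_configuration)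
qed

text \<open>For an edge the cone is a half-plane fixed by the normal, so only the length has to be
  matched. For a vertex the cones at a common exposing direction are compared, unless the
  exceptional alternative occurs.\<close>

lemma isothetic_face_exists:
  assumes S: "same_convolution P Q P' Q'"
    and N: "\<not> exceptional_configuration P (uminus ` Q) P' (uminus ` Q')"
    and F: "proper_face P F"
  shows "\<exists>Z\<in>{P', Q'}. \<exists>G. proper_face Z G \<and> isothetic P F Z G"
proof -
  have cp: "convex_polygon P" "convex_polygon Q" "convex_polygon P'" "convex_polygon Q'"
    using S by (auto simp: same_convolution_def)
  obtain u where u: "u \<noteq> 0" "F = face_in u P" using proper_face_imp_face_in[OF cp(1) F] .
  have seg: "\<exists>p l. l \<ge> 0 \<and> face_in u Z = {p + s *\<^sub>R rot u | s. 0 \<le> s \<and> s \<le> l}" if "convex_polygon Z" for Z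
    by (rule face_in_segment[OF convex_polygonD(2,1,5)[OF that] u(1)]) blast
  obtain p l where l: "l \<ge> 0" and FP: "face_in u P = {p + s *\<^sub>R rot u | s. 0 \<le> s \<and> s \<le> l}"
    using seg[OF cp(1)] by blast
  show ?thesis
  proof (cases "l = 0")
    case False
    then have l0: "l > 0" using l by simp
    obtain q m where m: "m \<ge> 0" and FQ: "face_in u Q = {q + s *\<^sub>R rot u | s. 0 \<le> s \<and> s \<le> m}"
      using seg[OF cp(2)] by blast
    obtain p' l' where l': "l' \<ge> 0" and FP': "face_in u P' = {p' + s *\<^sub>R rot u | s. 0 \<le> s \<and> s \<le> l'}"
      using seg[OF cp(3)] by blast
    obtain q' m' where m': "m' \<ge> 0" and FQ': "face_in u Q' = {q' + s *\<^sub>R rot u | s. 0 \<le> s \<and> s \<le> m'}"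
      using seg[OF cp(4)] by blast
    have "l = l' \<or> l = m'" using edge_lengths_eq[OF S u(1) l m l' m' FP FQ FP' FQ'] by blast
    then obtain Z z where Z: "Z \<in> {P', Q'}" "convex_polygon Z" "face_in u Z = {z + s *\<^sub>R rot u | s. 0 \<le> s \<and> s \<le> l}"
      using FP' FQ' cp by auto
    have "face_in u Z = (+) (z - p) ` face_in u P"
      unfolding Z(3) FP by (auto simp: image_iff algebra_simps)
    moreover have "support_cone P (face_in u P) = support_cone Z (face_in u Z)"
      using support_cone_edge[OF cp(1) u(1) l0 FP] support_cone_edge[OF Z(2) u(1) l0 Z(3)] by simp
    ultimately have "isothetic P F Z (face_in u Z)" unfolding isothetic_def u(2) by blast
    then show ?thesis using Z(1) proper_face_face_in[OF Z(2) u(1)] by blast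
  next
    case True
    then have Fp: "face_in u P = {p}" using FP by auto
    \<comment> \<open>Even if u is normal to an edge of Z, turning it slightly towards
      \<open>rot u\<close> exposes the endpoint of that edge on this side; p remains exposed in
      P.\<close>
    have lex: "\<exists>v. v \<in> face_in u Z \<and> eventually (\<lambda>e. exposes (u + e *\<^sub>R rot u) Z v) (at_right 0)"
      if Z: "convex_polygon Z" for Z
    proof -
      obtain q m where m: "m \<ge> 0" and FZ: "face_in u Z = {q + s *\<^sub>R rot u | s. 0 \<le> s \<and> s \<le> m}"
        using seg[OF Z] by blast
      define v where "v = q + m *\<^sub>R rot u"
      have v: "v \<in> face_in u Z" unfolding FZ v_def using m by blast
      have "u \<bullet> y < u \<bullet> v \<or> u \<bullet> y = u \<bullet> v \<and> rot u \<bullet> y \<le> rot u \<bullet> v" if y: "y \<in> Z" for y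
      proof (cases "u \<bullet> y < u \<bullet> v")
        case False
        then have uy: "u \<bullet> y = u \<bullet> v" using v y by (auto simp: face_in_def)
        then have "y \<in> face_in u Z" using v y by (simp add: face_in_def)
        then obtain s where "y = q + s *\<^sub>R rot u" "s \<le> m" unfolding FZ by blast
        then have "rot u \<bullet> y \<le> rot u \<bullet> v" by (simp add: v_def inner_add_right mult_right_mono)
        then show ?thesis using uy by simp
      qed simp
      then have "eventually (\<lambda>e. exposes (u + e *\<^sub>R rot u) Z v) (at_right 0)"
        using u(1) v by (intro lexicographic_max_exposed[OF Z]) (auto simp: face_in_def)
      then show ?thesis using v by blast
    qed
    have evP: "eventually (\<lambda>e. exposes (u + e *\<^sub>R rot u) P p) (at_right 0)"
      using lex[OF cp(1)] Fp by auto
    obtain q where evQ: "eventually (\<lambda>e. exposes (u + e *\<^sub>R rot u) Q q) (at_right 0)" using lex[OF cp(2)] by blast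
    obtain p' where evP': "eventually (\<lambda>e. exposes (u + e *\<^sub>R rot u) P' p') (at_right 0)" using lex[OF cp(3)] by blast
    obtain q' where evQ': "eventually (\<lambda>e. exposes (u + e *\<^sub>R rot u) Q' q') (at_right 0)" using lex[OF cp(4)] by blast
    have "eventually (\<lambda>e. exposes (u + e *\<^sub>R rot u) P p \<and> exposes (u + e *\<^sub>R rot u) Q q \<and>
        exposes (u + e *\<^sub>R rot u) P' p' \<and> exposes (u + e *\<^sub>R rot u) Q' q') (at_right 0)"
      using evP evQ evP' evQ' by (intro eventually_conj)
    then obtain e where e: "exposes (u + e *\<^sub>R rot u) P p" "exposes (u + e *\<^sub>R rot u) Q q"
        "exposes (u + e *\<^sub>R rot u) P' p'" "exposes (u + e *\<^sub>R rot u) Q' q'"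
      using eventually_happens'[OF trivial_limit_at_right_real] by blast
    define n where "n = u + e *\<^sub>R rot u"
    have "n \<bullet> u = u \<bullet> u" by (simp add: n_def inner_add_left)
    then have n0: "n \<noteq> 0" using u(1) by auto
    have "{tcone P p, tcone Q q} = {tcone P' p', tcone Q' q'}"
    proof (rule ccontr)
      assume "\<not> ?thesis"
      then obtain A B A' B' where AB: "(A, B) = (P, Q) \<or> (A, B) = (Q, P)" "(A', B') = (P', Q') \<or> (A', B') = (Q', P')"
        "exceptional_vertex A B A' B' \<or> exceptional_vertex A' B' A B"
        using cone_dichotomy[OF S e] by blast
      note S1 = same_convolution_swap(1)[OF S]
      have SA: "same_convolution A B A' B'"
        using AB(1,2) S S1 same_convolution_swap(2)[OF S] same_convolution_swap(2)[OF S1] by auto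
      have c1: "exceptional_configuration A (uminus ` B) A' (uminus ` B')"
        using AB(3) exceptional_vertex_imp_configuration[OF SA]
          exceptional_configuration_commute[OF exceptional_vertex_imp_configuration[OF same_convolution_swap(3)[OF SA]]]
        by auto
      \<comment> \<open>Undo a possible exchange in the first pair by reflection; commuting the
        pairs allows the same for the second.\<close>
      have "exceptional_configuration P (uminus ` Q) A' (uminus ` B')"
        using AB(1) c1 exceptional_configuration_reflect[OF c1] by auto
      then have c2: "exceptional_configuration A' (uminus ` B') P (uminus ` Q)"
        by (rule exceptional_configuration_commute)
      have "exceptional_configuration P' (uminus ` Q') P (uminus ` Q)"
        using AB(2) c2 exceptional_configuration_reflect[OF c2] by auto
      then have "exceptional_configuration P (uminus ` Q) P' (uminus ` Q')"
        by (rule exceptional_configuration_commute)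
      then show False using N by contradiction
    qed
    then obtain Z z where Z: "Z \<in> {P', Q'}" "convex_polygon Z" "exposes n Z z" "tcone Z z = tcone P p"
      using e cp unfolding n_def by (auto simp: doubleton_eq_iff)
    have fz: "face_in n Z = {z}" by (rule exposes_imp_face_in[OF Z(3)])
    have pz: "proper_face Z {z}" using proper_face_face_in[OF Z(2) n0] fz by simp
    have "support_cone P {p} = tcone P p" "support_cone Z {z} = tcone Z z"
      using F pz u(2) Fp convex_polygonD(1) cp(1) Z(2) by (auto intro!: support_cone_vertex simp: proper_face_def)
    moreover have "{z} = (+) (z - p) ` {p}" by simp
    ultimately have "isothetic P F Z {z}" unfolding isothetic_def u(2) Fp using Z(4) by metis
    then show ?thesis using Z(1) pz by blast
  qed
qed

lemma isothetic_commute: "isothetic P F Q G \<Longrightarrow> isothetic Q G P F"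
proof -
  assume "isothetic P F Q G"
  then obtain t where t: "G = (+) t ` F" "support_cone P F = support_cone Q G"
    by (auto simp: isothetic_def)
  then have "F = (+) (- t) ` G" by (simp add: image_image)
  then show ?thesis using t by (metis isothetic_def)
qed

lemma same_convolution_synisothetic:
  assumes S: "same_convolution P Q P' Q'"
    and N: "\<not> exceptional_configuration P (uminus ` Q) P' (uminus ` Q')"
  shows "synisothetic (P, Q) (P', Q')"
proof -
  note S1 = same_convolution_swap(1)[OF S] and S2 = same_convolution_swap(3)[OF S]
  note S3 = same_convolution_swap(1)[OF S2]
  have N1: "\<not> exceptional_configuration Q (uminus ` P) P' (uminus ` Q')"
    using N exceptional_configuration_reflect by metis
  have N2: "\<not> exceptional_configuration P' (uminus ` Q') P (uminus ` Q)"
    using N exceptional_configuration_commute by metis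
  have N3: "\<not> exceptional_configuration Q' (uminus ` P') P (uminus ` Q)"
    using N2 exceptional_configuration_reflect by metis
  note faces = isothetic_face_exists[OF S N] isothetic_face_exists[OF S1 N1]
    isothetic_face_exists[OF S2 N2] isothetic_face_exists[OF S3 N3]
  show ?thesis
    unfolding synisothetic_def fst_conv snd_conv
  proof (intro conjI ballI allI impI)
    fix Z F assume "Z \<in> {P, Q}" "proper_face Z F"
    then show "\<exists>Y\<in>{P', Q'}. \<exists>G. proper_face Y G \<and> isothetic Z F Y G"
      using faces(1,2) by auto
  next
    fix Y G assume "Y \<in> {P', Q'}" "proper_face Y G"
    then have "\<exists>Z\<in>{P, Q}. \<exists>F. proper_face Z F \<and> isothetic Y G Z F"
      using faces(3,4) by auto
    then show "\<exists>Z\<in>{P, Q}. \<exists>F. proper_face Z F \<and> isothetic Z F Y G"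
      using isothetic_commute by blast
  qed
qed

section \<open>Summands of polygons and the covariogram\<close>

text \<open>Strictly separate a putative point x of C from A and add a point of B that minimises the
  separating functional: the sum then escapes \<open>A + B\<close>.\<close>

lemma sum_subset_cancel:
  fixes A B C :: "'a::euclidean_space set"
  assumes sub: "C + B \<subseteq> A + B" and A: "closed A" "convex A" and B: "compact B" "B \<noteq> {}"
  shows "C \<subseteq> A"
proof
  fix x assume x: "x \<in> C"
  show "x \<in> A"
  proof (rule ccontr)
    assume "x \<notin> A"
    then obtain a \<beta> where ab: "a \<bullet> x < \<beta>" "\<And>y. y \<in> A \<Longrightarrow> a \<bullet> y > \<beta>"
      using separating_hyperplane_closed_point[OF A(2,1)] by blast
    have "continuous_on B ((\<bullet>) a)" by (intro continuous_intros)
    then obtain b where b: "b \<in> B" "\<And>y. y \<in> B \<Longrightarrow> a \<bullet> b \<le> a \<bullet> y"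
      using continuous_attains_inf[OF B] by blast
    have "x + b \<in> A + B" using sub set_plus_intro[OF x b(1)] by blast
    then obtain y z where yz: "x + b = y + z" "y \<in> A" "z \<in> B" by (rule set_plus_elim)
    have "a \<bullet> x + a \<bullet> b = a \<bullet> y + a \<bullet> z" using arg_cong[OF yz(1), of "(\<bullet>) a"] by (simp add: inner_add_right)
    moreover have "a \<bullet> b \<le> a \<bullet> z" "\<beta> < a \<bullet> y" using ab b yz by auto
    ultimately show False using ab(1) by linarith
  qed
qed

text \<open>Take the half-spaces defining \<open>A + B\<close> and push each of them against A.
  Their intersection C still satisfies \<open>C + B \<subseteq> A + B\<close>, so cancellation
  leaves C = A.\<close>

lemma summand_of_polytope:
  fixes A B :: "'a::euclidean_space set"
  assumes P: "polytope (A + B)" and A: "compact A" "convex A" "A \<noteq> {}" and B: "compact B" "B \<noteq> {}"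
  shows "polytope A"
proof -
  obtain F where F: "finite F" "A + B = \<Inter>F" "\<forall>h\<in>F. \<exists>a b. a \<noteq> 0 \<and> h = {x. a \<bullet> x \<le> b}"
    using polytope_imp_polyhedron[OF P] unfolding polyhedron_def by blast
  obtain n c where nc: "\<And>h. h \<in> F \<Longrightarrow> h = {x. n h \<bullet> x \<le> c h}"
    using F(3) by metis
  have "\<exists>y\<in>A. \<forall>x\<in>A. n h \<bullet> x \<le> n h \<bullet> y" for h
    using continuous_attains_sup[OF A(1,3), of "(\<bullet>) (n h)"] by (simp add: continuous_intros)
  then obtain y where y: "\<And>h. y h \<in> A" "\<And>h x. x \<in> A \<Longrightarrow> n h \<bullet> x \<le> n h \<bullet> y h" by metis
  define C where "C = (\<Inter>h\<in>F. {x. n h \<bullet> x \<le> n h \<bullet> y h})"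
  have "C + B \<subseteq> A + B"
  proof
    fix z assume "z \<in> C + B"
    then obtain x b where xb: "z = x + b" "x \<in> C" "b \<in> B" by (rule set_plus_elim)
    show "z \<in> A + B"
      unfolding F(2)
    proof
      fix h assume h: "h \<in> F"
      have "y h + b \<in> \<Inter>F" unfolding F(2)[symmetric] using y(1) xb(3) by (rule set_plus_intro)
      then have "y h + b \<in> h" using h by blast
      then have "n h \<bullet> (y h + b) \<le> c h" using nc[OF h] by blast
      moreover have "n h \<bullet> x \<le> n h \<bullet> y h" using xb(2) h by (auto simp: C_def)
      ultimately have "n h \<bullet> z \<le> c h" by (simp add: xb(1) inner_add_right)
      then show "z \<in> h" using nc[OF h] by blast
    qed
  qed
  then have "C \<subseteq> A" using sum_subset_cancel A B compact_imp_closed by blast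
  moreover have "A \<subseteq> C" using y(2) by (auto simp: C_def)
  ultimately have "A = C" by blast
  moreover have "polyhedron C"
    unfolding C_def using F(1) by (intro polyhedron_Inter) (auto simp: polyhedron_halfspace_le)
  ultimately show ?thesis using compact_imp_bounded[OF A(1)] by (simp add: polytope_eq_bounded_polyhedron)
qed

lemma polytope_set_plus:
  fixes A B :: "'a::euclidean_space set"
  assumes "polytope A" "polytope B"
  shows "polytope (A + B)"
proof -
  obtain V W where "finite V" "A = convex hull V" "finite W" "B = convex hull W"
    using assms by (auto simp: polytope_def)
  then show ?thesis
    unfolding polytope_def using convex_hull_set_plus[of V W] finite_set_plus by metis
qed

text \<open>A convex set has positive measure exactly when it has interior points. Interiors appear
  instead of the sets themselves because they describe where the covariogram is positive even for
  unbounded sets.\<close>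

lemma interior_sum_iff_overlap:
  fixes A B :: "(real^2) set"
  assumes "closed A" "convex A" "closed B" "convex B"
  shows "emeasure lebesgue (A \<inter> (+) x ` B) \<noteq> 0 \<longleftrightarrow> x \<in> interior A + uminus ` interior B"
proof -
  have cv: "convex (A \<inter> (+) x ` B)" using assms by (intro convex_Int convex_translation)
  have "closed (A \<inter> (+) x ` B)" using assms by (intro closed_Int closed_translation)
  then have "A \<inter> (+) x ` B \<in> sets lebesgue" by simp
  then have "emeasure lebesgue (A \<inter> (+) x ` B) = 0 \<longleftrightarrow> interior (A \<inter> (+) x ` B) = {}"
    using negligible_convex_interior[OF cv] by (simp add: negligible_iff_null_sets null_sets_def)
  moreover have "interior (A \<inter> (+) x ` B) = interior A \<inter> (+) x ` interior B"
    by (simp add: interior_translation)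
  moreover have "interior A \<inter> (+) x ` interior B \<noteq> {} \<longleftrightarrow> x \<in> interior A + uminus ` interior B"
  proof
    assume "interior A \<inter> (+) x ` interior B \<noteq> {}"
    then obtain b where "x + b \<in> interior A" "b \<in> interior B" by auto
    then have "(x + b) + - b \<in> interior A + uminus ` interior B" by (intro set_plus_intro imageI)
    then show "x \<in> interior A + uminus ` interior B" by simp
  next
    assume "x \<in> interior A + uminus ` interior B"
    then obtain a b where "x = a + - b" "a \<in> interior A" "b \<in> interior B" by (auto elim!: set_plus_elim)
    then show "interior A \<inter> (+) x ` interior B \<noteq> {}" by force
  qed
  ultimately show ?thesis by blast
qed

text \<open>A translate of the interior of A sits inside the bounded sum, and a closed convex set
  with interior is the closure of its interior.\<close>

lemma compact_if_sum_interiors_bounded: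
  fixes A B :: "'a::euclidean_space set"
  assumes A: "closed A" "convex A" "interior A \<noteq> {}" and B: "B \<noteq> {}" and bd: "bounded (interior A + B)"
  shows "compact A"
proof -
  obtain b where b: "b \<in> B" using B by blast
  have "interior A \<subseteq> (+) (- b) ` (interior A + B)"
  proof
    fix x assume "x \<in> interior A"
    then have "x + b \<in> interior A + B" using b by (intro set_plus_intro)
    then show "x \<in> (+) (- b) ` (interior A + B)" by (intro image_eqI[of _ _ "x + b"]) simp_all
  qed
  then have "bounded (interior A)" using bounded_translation[OF bd] bounded_subset by blast
  then have "bounded (closure (interior A))" by (rule bounded_closure)
  then have "bounded A" using convex_closure_interior[OF A(2,3)] A(1) by (simp add: closure_closed)
  then show ?thesis using A(1) compact_eq_bounded_closed by blast
qed

lemma sum_eq_closure_interiors: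
  fixes A B :: "'a::euclidean_space set"
  assumes A: "compact A" "convex A" "interior A \<noteq> {}" and B: "compact B" "convex B" "interior B \<noteq> {}"
  shows "A + B = closure (interior A + interior B)"
proof
  have "closure (interior A) = A" "closure (interior B) = B"
    using A B convex_closure_interior compact_imp_closed closure_closed by metis+
  then show "A + B \<subseteq> closure (interior A + interior B)"
    using closure_sum[of "interior A" "interior B"] by simp
  have "A + B = {x + y | x y. x \<in> A \<and> y \<in> B}" by (auto simp: set_plus_def)
  then have "compact (A + B)" using compact_sums[OF A(1) B(1)] by simp
  then have "closed (A + B)" by (rule compact_imp_closed)
  moreover have "interior A + interior B \<subseteq> A + B" by (intro set_plus_mono2 interior_subset)
  ultimately show "closure (interior A + interior B) \<subseteq> A + B" by (intro closure_minimal)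
qed

text \<open>For compact K and L the covariogram is defined everywhere. Equality of domains then
  makes the one of K', L' finite everywhere, so the values can be compared as measures.\<close>

lemma cross_covariogram_eq_imp:
  assumes K: "convex_polygon K" and L: "convex_polygon L"
    and g: "cross_covariogram K L = cross_covariogram K' L'"
  shows "emeasure lebesgue (K \<inter> (+) x ` L) = emeasure lebesgue (K' \<inter> (+) x ` L')"
proof -
  have "compact (K \<inter> (+) x ` L)"
    using K L convex_polygonD by (intro compact_Int compact_translation) auto
  then have "K \<inter> (+) x ` L \<in> lmeasurable" by (rule lmeasurable_compact)
  then have fin: "emeasure lebesgue (K \<inter> (+) x ` L) < \<infinity>" by (auto simp: fmeasurable_def)
  then have some: "Some (measure lebesgue (K \<inter> (+) x ` L)) = cross_covariogram K' L' x"
    using fun_cong[OF g, of x] by (simp add: cross_covariogram_def)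
  then have fin': "emeasure lebesgue (K' \<inter> (+) x ` L') < \<infinity>"
    by (auto simp: cross_covariogram_def split: if_splits)
  then have "measure lebesgue (K \<inter> (+) x ` L) = measure lebesgue (K' \<inter> (+) x ` L')"
    using some by (simp add: cross_covariogram_def)
  then show ?thesis using fin fin' by (simp add: emeasure_eq_ennreal_measure)
qed

lemma lap_product_eq_covariogram:
  assumes "closed K" "closed L"
  shows "lap K \<xi> * lap (uminus ` L) \<xi> = (\<integral>\<^sup>+x. emeasure lebesgue (K \<inter> (+) x ` L) * ennreal (exp (\<xi> \<bullet> x)) \<partial>lborel)"
proof -
  have cl: "closed (uminus ` L)" using assms(2) by (rule closed_negations)
  have eq: "K \<inter> {y. x - y \<in> uminus ` L} = K \<inter> (+) x ` L" for x
  proof -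
    have "x - y \<in> uminus ` L \<longleftrightarrow> y \<in> (+) x ` L" for y
    proof
      assume "x - y \<in> uminus ` L"
      then obtain l where l: "l \<in> L" "x - y = - l" by blast
      then have "y = x + l" by (simp add: algebra_simps)
      then show "y \<in> (+) x ` L" using l(1) by blast
    qed auto
    then show ?thesis by blast
  qed
  have "emeasure lborel (K \<inter> {y. x - y \<in> uminus ` L}) = emeasure lebesgue (K \<inter> (+) x ` L)" for x
  proof -
    have "closed (K \<inter> (+) x ` L)" using assms by (intro closed_Int closed_translation)
    then show ?thesis unfolding eq by simp
  qed
  then show ?thesis
    using lap_convolution[of K "uminus ` L" \<xi>] assms(1) cl by simp
qed

lemma convex_polygon_uminus: "convex_polygon L \<Longrightarrow> convex_polygon (uminus ` L)"
  unfolding convex_polygon_def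
  by (simp add: interior_negations polytope_linear_image linear_uminus)

text \<open>Positivity of the covariogram equates the sums of interiors. That set is non-empty and
  bounded, so K' and -L' have interior and are compact; its closure is the full Minkowski sum of
  either pair, a polytope, and its summands are polytopes too.\<close>

lemma covariogram_same_convolution:
  assumes K: "convex_polygon K" and L: "convex_polygon L"
    and K': "closed K'" "convex K'" and L': "closed L'" "convex L'"
    and g: "cross_covariogram K L = cross_covariogram K' L'"
  shows "same_convolution K (uminus ` L) K' (uminus ` L')"
proof -
  note em = cross_covariogram_eq_imp[OF K L g]
  note Kp = convex_polygonD[OF K]
  have M: "convex_polygon (uminus ` L)" using L by (rule convex_polygon_uminus)
  note Mp = convex_polygonD[OF M]
  define M' where "M' = uminus ` L'"
  have M': "closed M'" "convex M'"
    unfolding M'_def using L' by (auto intro: closed_negations convex_negations)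
  have "x \<in> interior K + uminus ` interior L \<longleftrightarrow> x \<in> interior K' + uminus ` interior L'" for x
    using interior_sum_iff_overlap[OF Kp(3,1) convex_polygonD(3,1)[OF L], of x]
      interior_sum_iff_overlap[OF K' L', of x] em by simp
  then have int: "interior K + interior (uminus ` L) = interior K' + interior M'"
    unfolding M'_def interior_negations by blast
  have ne: "interior K + interior (uminus ` L) \<noteq> {}" using Kp(6) Mp(6) by (auto simp: set_plus_def)
  then have int_ne: "interior K' \<noteq> {}" "interior M' \<noteq> {}" unfolding int by (auto simp: set_plus_def)
  have sum: "K + uminus ` L = closure (interior K + interior (uminus ` L))"
    by (rule sum_eq_closure_interiors) (use Kp Mp in auto)
  have poly: "polytope (K + uminus ` L)" using Kp(7) Mp(7) by (rule polytope_set_plus)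
  have bd: "bounded (interior K' + interior M')"
    using bounded_subset[OF compact_imp_bounded[OF polytope_imp_compact[OF poly]] closure_subset[of "interior K + interior (uminus ` L)", folded sum]]
    by (simp add: int)
  have cK: "compact K'" by (rule compact_if_sum_interiors_bounded[OF K' int_ne(1) int_ne(2) bd])
  have cM: "compact M'"
    by (rule compact_if_sum_interiors_bounded[OF M' int_ne(2) int_ne(1)]) (use bd in \<open>simp add: add.commute\<close>)
  have sum': "K + uminus ` L = K' + M'"
    unfolding sum int by (rule sum_eq_closure_interiors[symmetric]) (use cK cM K' M' int_ne in auto)
  have nonempty: "K' \<noteq> {}" "M' \<noteq> {}" using int_ne by auto
  have "polytope K'"
    by (rule summand_of_polytope[of K' M']) (use poly sum' cK cM K' nonempty in auto)
  moreover have "polytope M'"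
    by (rule summand_of_polytope[of M' K']) (use poly sum' cK cM M' nonempty in \<open>auto simp: add.commute\<close>)
  ultimately have cp: "convex_polygon K'" "convex_polygon M'" using int_ne by (auto simp: convex_polygon_def)
  have "lap K \<xi> * lap (uminus ` L) \<xi> = lap K' \<xi> * lap M' \<xi>" for \<xi>
    unfolding M'_def
    using lap_product_eq_covariogram[OF Kp(3) convex_polygonD(3)[OF L], of \<xi>] lap_product_eq_covariogram[OF K'(1) L'(1), of \<xi>] em
    by simp
  then show ?thesis
    using K M cp sum' unfolding same_convolution_def M'_def by blast
qed

theorem proposition4p2:
  fixes K L K' L' :: "(real^2) set"
  assumes "convex_polygon K" and "convex_polygon L"
    and "closed K'" and "convex K'" and "closed L'" and "convex L'"
    and "cross_covariogram K L = cross_covariogram K' L'"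
  shows "convex_polygon K' \<and> convex_polygon L' \<and>
    (\<not> (\<exists>T i j \<alpha> \<beta> \<gamma> \<delta> y.
           affine_transformation T \<and> i \<in> {1, 2} \<and> j \<in> {1, 2} \<and> i \<noteq> j \<and>
           \<alpha> > 0 \<and> \<beta> > 0 \<and> \<gamma> > 0 \<and> \<delta> > 0 \<and>
           trivial_associate (T ` K, T ` L) (exceptional_pair i \<alpha> \<beta> \<gamma> \<delta> y) \<and>
           trivial_associate (T ` K', T ` L') (exceptional_pair j \<alpha> \<beta> \<gamma> \<delta> y))
     \<longrightarrow> synisothetic (K, uminus ` L) (K', uminus ` L'))"
proof -
  have S: "same_convolution K (uminus ` L) K' (uminus ` L')"
    using assms by (rule covariogram_same_convolution)
  have uu: "uminus ` uminus ` Z = Z" for Z :: "(real^2) set" by (simp add: image_image)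
  have "convex_polygon K'" "convex_polygon (uminus ` uminus ` L')"
    using S convex_polygon_uminus by (auto simp only: same_convolution_def)
  then have "convex_polygon K' \<and> convex_polygon L'" by (simp only: uu)
  moreover have "synisothetic (K, uminus ` L) (K', uminus ` L')"
    if "\<not> exceptional_configuration K L K' L'"
    by (rule same_convolution_synisothetic[OF S]) (simp only: uu that not_False_eq_True)
  ultimately show ?thesis
    unfolding exceptional_configuration_def by blast
qed

end
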